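(* If $\mathcal{Q}$ is a class of $k$-coloured graphs, then $$\limsup_{n\to\infty}\frac{\log_k|\mathcal{Q}_n|}{\binom n2}\le\max_{\Gamma\in\widehat{\mathcal{Q}}}\mathrm{Ent}(\Gamma).$$
   Context: $k\ge2$ is a fixed integer, $[k]=\{1,\dots,k\}$. A $k$-coloured graph of order $n$ is a map $E(K_n)\to[k]$, where $K_n$ is the complete graph on $[n]=\{1,\dots,n\}$. A class $\mathcal{Q}$ of $k$-coloured graphs is an arbitrary isomorphism-closed family (i.e. a set of unlabelled $k$-coloured graphs); $\mathcal{Q}_n$ is the set of unlabelled elements (isomorphism classes) of order $n$. Convention: $\log_k0=-\infty$. A $k$-graphon is a symmetric measurable $W:[0,1]^2\to\{\text{probability measures on }[k]\}$; $W_i(x,y)$ is the mass $W(x,y)$ gives to $i$. Put $d_{\square_k}(U,W)=\sup_{S,T}\sum_{i=1}^k\left|\int_{S\times T}(U_i-W_i)\,dx\,dy\right|$ (sup over measurable $S,T\subseteq[0,1]$) and $\delta_{\square_k}(U,W)=\inf_\varphi d_{\square_k}(U,W^\varphi)$, with $W^\varphi(x,y)=W(\varphi(x),\varphi(y))$ and $\varphi$ ranging over measure-preserving maps $[0,1]\to[0,1]$. A $k$-coloured graph $G$ on $[n]$ gives a step $k$-graphon $W_G$, equal on $I_i\times I_j$ ($i\ne j$, $I_i=[(i-1)/n,i/n)$) to the point mass at the colour of $ij$ (on the diagonal blocks, an arbitrary fixed point mass). $\widehat{\mathcal{Q}}$ is the set of graph limits of $\mathcal{Q}$: all (equivalence classes,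 under $\delta_{\square_k}=0$, of) $k$-graphons $W$ for which there is a sequence $(G_j)$ in $\mathcal{Q}$ with orders tending to infinity and $\delta_{\square_k}(W_{G_j},W)\to0$. The entropy of a limit $\Gamma$ represented by $W$ is $\mathrm{Ent}(\Gamma)=\mathrm{Ent}(W)=\iint_{[0,1]^2}h_k(W_1(x,y),\dots,W_k(x,y))\,dx\,dy$, where $h_k(p_1,\dots,p_k)=-\sum_{c=1}^k p_c\log_kp_c$ (with $0\log_k0=0$); this does not depend on the representative. *)

theory Defs
  imports "HOL-Probability.Probability" "HOL-Library.Ramsey"
begin

section \<open>Coloured graphs\<close>

text \<open>A \<open>k\<close>-coloured graph is a pair \<open>(n, c)\<close>, its order and the colouring
  \<open>c\<close> of the edges of \<open>K\<^sub>n\<close>. The colouring is extensional, so that two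
  labelled graphs are equal iff they have the same order and the same coloured edges.\<close>

type_synonym cgraph = "nat \<times> (nat set \<Rightarrow> nat)"

definition complete_edges :: "nat \<Rightarrow> nat set set" where
  "complete_edges n = nsets {1..n} 2"

definition coloured_graphs :: "nat \<Rightarrow> cgraph set" where
  "coloured_graphs k = (SIGMA n:UNIV. complete_edges n \<rightarrow>\<^sub>E {1..k})"

definition graph_iso :: "cgraph \<Rightarrow> cgraph \<Rightarrow> bool" where
  "graph_iso G H \<longleftrightarrow> fst G = fst H \<and>
     (\<exists>\<pi>. bij_betw \<pi> {1..fst G} {1..fst G} \<and>
          (\<forall>e\<in>complete_edges (fst G). snd H (\<pi> ` e) = snd G e))"

definition graph_iso_rel :: "nat \<Rightarrow> (cgraph \<times> cgraph) set" where
  "graph_iso_rel k =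
     {(G, H). G \<in> coloured_graphs k \<and> H \<in> coloured_graphs k \<and> graph_iso G H}"

definition graph_class :: "nat \<Rightarrow> cgraph set \<Rightarrow> bool" where
  "graph_class k Q \<longleftrightarrow> Q \<subseteq> coloured_graphs k \<and>
     (\<forall>G\<in>Q. \<forall>H\<in>coloured_graphs k. graph_iso G H \<longrightarrow> H \<in> Q)"

definition unlabelled :: "nat \<Rightarrow> cgraph set \<Rightarrow> nat \<Rightarrow> cgraph set set" where
  "unlabelled k Q n = {G \<in> Q. fst G = n} // graph_iso_rel k"

section \<open>Graphons and the cut distance\<close>

text \<open>Measurability on \<open>[0,1]\<close> and its square is Borel measurability. Probability measures
  on \<open>{1..k}\<close> are probability mass functions supported there, so \<open>W\<^sub>i(x,y)\<close> is
  \<open>pmf (W x y) i\<close>. Values of graphons outside the unit square are irrelevant.\<close>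

type_synonym graphon = "real \<Rightarrow> real \<Rightarrow> nat pmf"

definition unit_interval :: "real measure" where
  "unit_interval = restrict_space lborel {0..1}"

definition unit_square :: "(real \<times> real) measure" where
  "unit_square = unit_interval \<Otimes>\<^sub>M unit_interval"

definition graphons :: "nat \<Rightarrow> graphon set" where
  "graphons k = {W.
     (\<forall>x\<in>{0..1}. \<forall>y\<in>{0..1}. W x y = W y x \<and> set_pmf (W x y) \<subseteq> {1..k}) \<and>
     (\<forall>i\<in>{1..k}. (\<lambda>(x, y). pmf (W x y) i) \<in> borel_measurable unit_square)}"

definition cut_dist :: "nat \<Rightarrow> graphon \<Rightarrow> graphon \<Rightarrow> real" where
  "cut_dist k U W =
     (SUP (S, T)\<in>sets unit_interval \<times> sets unit_interval.
        \<Sum>i=1..k. \<bar>LINT z:S \<times> T|unit_square.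
           pmf (U (fst z) (snd z)) i - pmf (W (fst z) (snd z)) i\<bar>)"

definition measure_preserving_maps :: "(real \<Rightarrow> real) set" where
  "measure_preserving_maps = {\<phi> \<in> measurable unit_interval unit_interval.
     distr unit_interval unit_interval \<phi> = unit_interval}"

definition pullback :: "graphon \<Rightarrow> (real \<Rightarrow> real) \<Rightarrow> graphon" where
  "pullback W \<phi> = (\<lambda>x y. W (\<phi> x) (\<phi> y))"

definition graphon_dist :: "nat \<Rightarrow> graphon \<Rightarrow> graphon \<Rightarrow> real" where
  "graphon_dist k U W = (INF \<phi>\<in>measure_preserving_maps. cut_dist k U (pullback W \<phi>))"

text \<open>The parameter \<open>d\<close> is the colour put on the diagonal blocks. For \<open>x < 1\<close>, the
  index \<open>i\<close> with \<open>x \<in> [(i-1)/n, i/n)\<close> is \<open>\<lfloor>n x\<rfloor> + 1\<close>; for \<open>x = 1\<close>, which lies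
  in no such interval, this gives \<open>n + 1\<close> and hence also the colour \<open>d\<close>.\<close>

definition step_graphon :: "nat \<Rightarrow> cgraph \<Rightarrow> graphon" where
  "step_graphon d G = (\<lambda>x y.
     let n = fst G; e = {nat \<lfloor>real n * x\<rfloor> + 1, nat \<lfloor>real n * y\<rfloor> + 1}
     in return_pmf (if e \<in> complete_edges n then snd G e else d))"

section \<open>Graph limits and entropy\<close>

definition limit_of :: "nat \<Rightarrow> graphon \<Rightarrow> graphon set" where
  "limit_of k W = {U \<in> graphons k. graphon_dist k U W = 0}"

definition graph_limits :: "nat \<Rightarrow> nat \<Rightarrow> cgraph set \<Rightarrow> graphon set set" where
  "graph_limits k d Q = {limit_of k W | W. W \<in> graphons k \<and>
     (\<exists>G. (\<forall>j. G j \<in> Q) \<and> filterlim (\<lambda>j. fst (G j)) at_top sequentially \<and>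
          (\<lambda>j. graphon_dist k (step_graphon d (G j)) W) \<longlonglongrightarrow> 0)}"

definition entropy_fun :: "nat \<Rightarrow> (nat \<Rightarrow> real) \<Rightarrow> real" where
  "entropy_fun k p = - (\<Sum>c=1..k. p c * log (real k) (p c))"

definition graphon_entropy :: "nat \<Rightarrow> graphon \<Rightarrow> real" where
  "graphon_entropy k W = (LINT z|unit_square. entropy_fun k (pmf (W (fst z) (snd z))))"

text \<open>All representatives of a graph limit have the same entropy, so the choice of the
  representative is immaterial.\<close>

definition limit_entropy :: "nat \<Rightarrow> graphon set \<Rightarrow> real" where
  "limit_entropy k \<Gamma> = graphon_entropy k (SOME W. W \<in> \<Gamma>)"

definition log_card :: "nat \<Rightarrow> 'a set \<Rightarrow> ereal" where
  "log_card k A = (if card A = 0 then - \<infinity> else ereal (log (real k) (real (card A))))"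

end

theory Submission
  imports Defs "HOL-Combinatorics.Permutations"
begin

text \<open>Entropy is an infimum of functionals that are continuous in the cut distance: for edge costs
  \<open>g\<close> with \<open>\<Sum>c. k powr - g c \<le> 1\<close>, Gibbs' inequality bounds \<open>Ent W\<close> by the expected cost
  \<open>\<integral> \<Sum>c. W\<^sub>c g\<^sub>c\<close>, and \<open>g = - log k W\<close>, perturbed to be bounded, almost attains it.
  Hence entropy is upper semicontinuous. The same costs count graphs: interpreting \<open>k powr - g\<close> as
  independent edge weights, at most \<open>k powr (t n\<^sup>2 / 2)\<close> graphs of order \<open>n\<close> have expected cost at
  most \<open>t\<close>, so there are few graphs close to \<open>W\<close>.

  A class is closed under relabelling, which makes compactness simple. In every graph, sort the vertices
  so that the rectangles of its Frieze--Kannan decomposition become products of unions of boundedly many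
  intervals. Along a filter on which all bounded sequences converge, the decompositions converge in
  \<open>L\<^sup>1\<close> and the step graphons converge weakly to a Radon--Nikodym density \<open>W\<close>; together this is
  convergence in the cut distance.

  If \<open>Q\<close> is too large for infinitely many orders, total boundedness yields large subfamilies of
  diameter tending to 0. A limit of these has entropy at least the growth rate, by the counting bound.
  The maximum exists by compactness and semicontinuity.\<close>

text \<open>The obstacle is that \<open>graphon_dist\<close> pulls back only its second argument,
  along maps that need not be invertible, so a triangle inequality for it would take extra work.
  Nothing here relies on one: graphs are compared by \<open>cut_dist\<close> after an explicit
  relabelling, which is an invertible pullback along \<open>block_perm\<close>, and the other maps
  \<phi> are moved onto the test function. Hence the estimates for costs have to be uniform in
  \<phi>. Counting needs no factor n!: one labelled representative per isomorphism class is kept,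
  and the bound for labelled graphs applies to these. Each is aligned separately with a finite net;
  afterwards all of them are moved by one common permutation, which changes neither their number nor
  increases their mutual distances. The depth of the decomposition is never tied to an error. The
  greedy steps go on for ever, graph number j is sorted by the first j of them, and the cut estimate
  is proved for fixed t before t grows. A single filter replaces all diagonal subsequences.\<close>

abbreviation pr :: "graphon \<Rightarrow> nat \<Rightarrow> real \<times> real \<Rightarrow> real" where
  "pr W c z \<equiv> pmf (W (fst z) (snd z)) c"

section \<open>The unit square as a probability space\<close>

lemma space_unit_interval [simp]: "space unit_interval = {0..1}"
  by (simp add: unit_interval_def space_restrict_space)

lemma sets_unit_interval: "sets unit_interval = {A \<in> sets borel. A \<subseteq> {0..1}}"
  by (auto simp: unit_interval_def sets_restrict_space)

interpretation unit_interval: prob_space unit_interval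
proof
  show "emeasure unit_interval (space unit_interval) = 1"
    by (simp add: unit_interval_def emeasure_restrict_space space_restrict_space)
qed

interpretation unit_pair: pair_prob_space unit_interval unit_interval ..

interpretation unit_square: prob_space unit_square
  unfolding unit_square_def by unfold_locales

lemma space_unit_square [simp]: "space unit_square = {0..1} \<times> {0..1}"
  by (simp add: unit_square_def space_pair_measure)

lemma rect_in_unit_square [measurable (raw)]:
  "S \<in> sets unit_interval \<Longrightarrow> T \<in> sets unit_interval \<Longrightarrow> S \<times> T \<in> sets unit_square"
  by (simp add: unit_square_def)

lemma integrable_bounded_square:
  assumes "f \<in> borel_measurable unit_square" "\<And>z. z \<in> space unit_square \<Longrightarrow> \<bar>f z\<bar> \<le> (B::real)"
  shows "integrable unit_square f"
  by (rule unit_square.integrable_const_bound[of _ B]) (use assms in \<open>auto intro: AE_I2\<close>)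

lemma pr_measurable:
  assumes "W \<in> graphons k" "c \<in> {1..k}"
  shows "pr W c \<in> borel_measurable unit_square"
  using assms by (auto simp: graphons_def case_prod_unfold)

lemma pr_integrable:
  assumes "W \<in> graphons k" "c \<in> {1..k}"
  shows "integrable unit_square (pr W c)"
  by (rule integrable_bounded_square[where B=1]) (auto simp: pmf_le_1 pr_measurable[OF assms])

lemma sum_pr:
  assumes "W \<in> graphons k" "z \<in> space unit_square"
  shows "(\<Sum>c=1..k. pr W c z) = 1"
proof -
  have "fst z \<in> {0..1}" "snd z \<in> {0..1}" using assms(2) by (auto simp: mem_Times_iff)
  then have "set_pmf (W (fst z) (snd z)) \<subseteq> {1..k}" using assms(1) unfolding graphons_def by blast
  then show ?thesis by (intro sum_pmf_eq_1) auto
qed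

lemma set_integral_bound:
  assumes "f \<in> borel_measurable unit_square" "\<And>z. z \<in> space unit_square \<Longrightarrow> \<bar>f z\<bar> \<le> (B::real)"
    "A \<in> sets unit_square"
  shows "\<bar>LINT z:A|unit_square. f z\<bar> \<le> B * measure unit_square A"
proof -
  have "0 \<le> B" using assms(2)[of "(0,0)"] by auto
  have "integrable unit_square (\<lambda>z. indicator A z *\<^sub>R f z)"
    by (rule integrable_bounded_square[where B=B])
       (use assms \<open>0 \<le> B\<close> in \<open>auto simp: indicator_def\<close>)
  moreover have "integrable unit_square (\<lambda>z. B * indicator A z)"
    by (rule integrable_bounded_square[where B=B])
       (use assms \<open>0 \<le> B\<close> in \<open>auto simp: indicator_def\<close>)
  ultimately have "norm (LINT z:A|unit_square. f z) \<le> (LINT z|unit_square. B * indicator A z)"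
    unfolding set_lebesgue_integral_def
    by (rule Bochner_Integration.integral_norm_bound_integral)
       (use assms \<open>0 \<le> B\<close> in \<open>auto simp: indicator_def\<close>)
  moreover have "A \<inter> ({0..1} \<times> {0..1}) = A" using sets.sets_into_space[OF assms(3)] by auto
  ultimately show ?thesis by simp
qed

lemma set_integral_bound1:
  assumes "f \<in> borel_measurable unit_square" "\<And>z. z \<in> space unit_square \<Longrightarrow> \<bar>f z\<bar> \<le> (B::real)"
    "A \<in> sets unit_square"
  shows "\<bar>LINT z:A|unit_square. f z\<bar> \<le> B"
proof -
  have "0 \<le> B" using assms(2)[of "(0,0)"] by auto
  then have "B * measure unit_square A \<le> B * 1"
    by (intro mult_left_mono) (auto simp: unit_square.prob_le_1)
  with set_integral_bound[OF assms] show ?thesis by simp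
qed

section \<open>The cut distance as a pseudometric on graphons\<close>

definition rect_discrepancy :: "nat \<Rightarrow> graphon \<Rightarrow> graphon \<Rightarrow> real set \<Rightarrow> real set \<Rightarrow> real" where
  "rect_discrepancy k U W S T = (\<Sum>i=1..k. \<bar>LINT z:S \<times> T|unit_square. pr U i z - pr W i z\<bar>)"

lemma rect_discrepancy_le:
  assumes "U \<in> graphons k" "W \<in> graphons k" "S \<in> sets unit_interval" "T \<in> sets unit_interval"
  shows "rect_discrepancy k U W S T \<le> real k"
proof -
  have "\<bar>LINT z:S \<times> T|unit_square. pr U i z - pr W i z\<bar> \<le> 1" if "i \<in> {1..k}" for i
  proof (rule set_integral_bound1)
    show "\<bar>pr U i z - pr W i z\<bar> \<le> 1" for z
      using pmf_le_1[of "U (fst z) (snd z)" i] pmf_le_1[of "W (fst z) (snd z)" i]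
        pmf_nonneg[of "U (fst z) (snd z)" i] pmf_nonneg[of "W (fst z) (snd z)" i] by linarith
  qed (use assms that in \<open>auto intro!: borel_measurable_diff pr_measurable\<close>)
  then show ?thesis unfolding rect_discrepancy_def
    using sum_bounded_above[of "{1..k}" _ "1::real"] by fastforce
qed

lemma cut_dist_eq:
  "cut_dist k U W = (SUP (S, T)\<in>sets unit_interval \<times> sets unit_interval. rect_discrepancy k U W S T)"
  by (simp add: cut_dist_def rect_discrepancy_def)

lemma cut_dist_upper:
  assumes "U \<in> graphons k" "W \<in> graphons k" "S \<in> sets unit_interval" "T \<in> sets unit_interval"
  shows "rect_discrepancy k U W S T \<le> cut_dist k U W"
  unfolding cut_dist_eq
proof (rule cSUP_upper2[of _ _ "(S,T)"])
  \<comment> \<open>A real supremum dominates its elements only if the set is bounded; the bound k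
    allows one unit for each colour.\<close>
  show "bdd_above ((\<lambda>(S, T). rect_discrepancy k U W S T) ` (sets unit_interval \<times> sets unit_interval))"
    by (rule bdd_aboveI[of _ "real k"]) (use rect_discrepancy_le assms in auto)
qed (use assms in auto)

lemma cut_dist_least:
  assumes "\<And>S T. S \<in> sets unit_interval \<Longrightarrow> T \<in> sets unit_interval \<Longrightarrow> rect_discrepancy k U W S T \<le> B"
  shows "cut_dist k U W \<le> B"
  unfolding cut_dist_eq by (rule cSUP_least) (use assms in auto)

lemma cut_dist_upper_colour:
  assumes "U \<in> graphons k" "W \<in> graphons k" "S \<in> sets unit_interval" "T \<in> sets unit_interval"
    "c \<in> {1..k}"
  shows "\<bar>LINT z:S \<times> T|unit_square. pr U c z - pr W c z\<bar> \<le> cut_dist k U W"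
proof -
  have "\<bar>LINT z:S \<times> T|unit_square. pr U c z - pr W c z\<bar> \<le> rect_discrepancy k U W S T"
    unfolding rect_discrepancy_def by (rule member_le_sum) (use assms in auto)
  with cut_dist_upper[OF assms(1-4)] show ?thesis by simp
qed

lemma cut_dist_nonneg:
  assumes "U \<in> graphons k" "W \<in> graphons k"
  shows "0 \<le> cut_dist k U W"
proof -
  have "0 \<le> rect_discrepancy k U W {} {}" by (simp add: rect_discrepancy_def sum_nonneg)
  also have "\<dots> \<le> cut_dist k U W" by (rule cut_dist_upper) (use assms in auto)
  finally show ?thesis .
qed

lemma cut_dist_self [simp]: "cut_dist k U U = 0"
proof -
  have "sets unit_interval \<times> sets unit_interval \<noteq> {}" by auto
  then show ?thesis
    by (simp add: cut_dist_eq rect_discrepancy_def case_prod_unfold set_lebesgue_integral_def)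
qed

lemma cut_dist_commute: "cut_dist k U W = cut_dist k W U"
proof -
  have "\<bar>LINT z:S \<times> T|unit_square. pr U i z - pr W i z\<bar> = \<bar>LINT z:S \<times> T|unit_square. pr W i z - pr U i z\<bar>"
    for i S T
  proof -
    have "(LINT z:S \<times> T|unit_square. pr U i z - pr W i z) = - (LINT z:S \<times> T|unit_square. pr W i z - pr U i z)"
      unfolding set_lebesgue_integral_def
      by (subst Bochner_Integration.integral_minus[symmetric]) (simp add: algebra_simps)
    then show ?thesis by simp
  qed
  then show ?thesis unfolding cut_dist_eq rect_discrepancy_def by simp
qed

lemma set_integrable_pr_diff:
  assumes "U \<in> graphons k" "W \<in> graphons k" "c \<in> {1..k}" "A \<in> sets unit_square"
  shows "set_integrable unit_square A (\<lambda>z. pr U c z - pr W c z)"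
  unfolding set_integrable_def
  by (rule integrable_mult_indicator) (use assms in \<open>auto intro!: Bochner_Integration.integrable_diff pr_integrable\<close>)

lemma cut_dist_triangle:
  assumes "U \<in> graphons k" "V \<in> graphons k" "W \<in> graphons k"
  shows "cut_dist k U W \<le> cut_dist k U V + cut_dist k V W"
proof (rule cut_dist_least)
  fix S T assume S: "S \<in> sets unit_interval" "T \<in> sets unit_interval"
  then have ST: "S \<times> T \<in> sets unit_square" by measurable
  have "\<bar>LINT z:S \<times> T|unit_square. pr U i z - pr W i z\<bar> \<le>
      \<bar>LINT z:S \<times> T|unit_square. pr U i z - pr V i z\<bar> + \<bar>LINT z:S \<times> T|unit_square. pr V i z - pr W i z\<bar>"
    if i: "i \<in> {1..k}" for i
  proof -
    have "(LINT z:S \<times> T|unit_square. pr U i z - pr W i z) =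
       (LINT z:S \<times> T|unit_square. pr U i z - pr V i z) + (LINT z:S \<times> T|unit_square. pr V i z - pr W i z)"
      by (subst set_integral_add(2)[symmetric]) (use set_integrable_pr_diff assms i ST in auto)
    then show ?thesis by linarith
  qed
  then have "rect_discrepancy k U W S T \<le> rect_discrepancy k U V S T + rect_discrepancy k V W S T"
    unfolding rect_discrepancy_def by (subst sum.distrib[symmetric]) (rule sum_mono, auto)
  also have "\<dots> \<le> cut_dist k U V + cut_dist k V W"
    by (intro add_mono cut_dist_upper assms S)
  finally show "rect_discrepancy k U W S T \<le> cut_dist k U V + cut_dist k V W" .
qed

section \<open>Pullbacks along measure preserving maps\<close>

lemma mpm_measurable:
  "\<phi> \<in> measure_preserving_maps \<Longrightarrow> \<phi> \<in> measurable unit_interval unit_interval"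
  by (simp add: measure_preserving_maps_def)

lemma mpm_distr:
  "\<phi> \<in> measure_preserving_maps \<Longrightarrow> distr unit_interval unit_interval \<phi> = unit_interval"
  by (simp add: measure_preserving_maps_def)

lemma mpm_in: "\<phi> \<in> measure_preserving_maps \<Longrightarrow> x \<in> {0..1} \<Longrightarrow> \<phi> x \<in> {0..1}"
  using measurable_space[OF mpm_measurable] by fastforce

lemma id_mpm: "(\<lambda>x. x) \<in> measure_preserving_maps"
  by (simp add: measure_preserving_maps_def distr_id)

definition square_map :: "(real \<Rightarrow> real) \<Rightarrow> real \<times> real \<Rightarrow> real \<times> real" where
  "square_map \<phi> z = (\<phi> (fst z), \<phi> (snd z))"

lemma square_map_measurable [measurable (raw)]:
  assumes "\<phi> \<in> measure_preserving_maps"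
  shows "square_map \<phi> \<in> measurable unit_square unit_square"
  using mpm_measurable[OF assms] unfolding square_map_def unit_square_def by measurable

lemma square_map_distr:
  assumes "\<phi> \<in> measure_preserving_maps"
  shows "distr unit_square unit_square (square_map \<phi>) = unit_square"
proof -
  note [measurable] = mpm_measurable[OF assms]
  have "distr unit_interval unit_interval \<phi> \<Otimes>\<^sub>M distr unit_interval unit_interval \<phi>
      = distr (unit_interval \<Otimes>\<^sub>M unit_interval) (unit_interval \<Otimes>\<^sub>M unit_interval) (\<lambda>(x, y). (\<phi> x, \<phi> y))"
    by (rule pair_measure_distr) (auto simp: mpm_distr[OF assms] unit_interval.sigma_finite_measure_axioms)
  then show ?thesis
    by (simp add: mpm_distr[OF assms] unit_square_def square_map_def[abs_def] case_prod_unfold)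
qed

lemma square_map_integral:
  assumes "\<phi> \<in> measure_preserving_maps" "f \<in> borel_measurable unit_square"
  shows "(LINT z|unit_square. f (square_map \<phi> z)) = (LINT z|unit_square. f z :: real)"
  by (subst (2) square_map_distr[OF assms(1), symmetric], subst integral_distr)
     (use assms square_map_measurable in auto)

lemma pr_pullback: "pr (pullback W \<phi>) c z = pr W c (square_map \<phi> z)"
  by (simp add: pullback_def square_map_def)

lemma pullback_graphon:
  assumes "W \<in> graphons k" "\<phi> \<in> measure_preserving_maps"
  shows "pullback W \<phi> \<in> graphons k"
proof -
  have "(\<lambda>z. pr W i (square_map \<phi> z)) \<in> borel_measurable unit_square" if "i \<in> {1..k}" for i
    by (rule measurable_compose[OF square_map_measurable[OF assms(2)] pr_measurable[OF assms(1) that]])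
  then show ?thesis using assms(1) mpm_in[OF assms(2)]
    by (auto simp: graphons_def pullback_def square_map_def case_prod_unfold)
qed

lemma pullback_id [simp]: "pullback W (\<lambda>x. x) = W"
  by (simp add: pullback_def)

lemma entropy_measurable:
  assumes "W \<in> graphons k"
  shows "(\<lambda>z. entropy_fun k (pmf (W (fst z) (snd z)))) \<in> borel_measurable unit_square"
  unfolding entropy_fun_def
  by (intro borel_measurable_uminus borel_measurable_sum borel_measurable_times borel_measurable_log
    pr_measurable[OF assms] borel_measurable_const)

lemma entropy_pullback:
  assumes "W \<in> graphons k" "\<phi> \<in> measure_preserving_maps"
  shows "graphon_entropy k (pullback W \<phi>) = graphon_entropy k W"
  using square_map_integral[OF assms(2) entropy_measurable[OF assms(1)]]
  by (simp add: graphon_entropy_def pullback_def square_map_def)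

text \<open>Since \<tau> undoes \<sigma>, each test set S is the \<sigma>-preimage of the
  \<tau>-preimage of S, so every rectangle testing the pulled back pair comes from one testing the
  original pair. Without such an inverse, a measurable set need not be a preimage under
  \<sigma>.\<close>

lemma cut_dist_pullback_le:
  assumes "U \<in> graphons k" "W \<in> graphons k"
    and s: "\<sigma> \<in> measure_preserving_maps" and t: "\<tau> \<in> measure_preserving_maps"
    and inv: "\<And>x. x \<in> {0..1} \<Longrightarrow> \<tau> (\<sigma> x) = x"
  shows "cut_dist k (pullback U \<sigma>) (pullback W \<sigma>) \<le> cut_dist k U W"
proof (rule cut_dist_least)
  fix S T assume S: "S \<in> sets unit_interval" "T \<in> sets unit_interval"
  define S' T' where "S' = \<tau> -` S \<inter> {0..1}" and "T' = \<tau> -` T \<inter> {0..1}"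
  have S': "S' \<in> sets unit_interval" "T' \<in> sets unit_interval"
    using measurable_sets[OF mpm_measurable[OF t]] S by (auto simp: S'_def T'_def)
  have "(LINT z:S \<times> T|unit_square. pr (pullback U \<sigma>) i z - pr (pullback W \<sigma>) i z) =
      (LINT z:S' \<times> T'|unit_square. pr U i z - pr W i z)" if i: "i \<in> {1..k}" for i
  proof -
    have "(LINT z:S \<times> T|unit_square. pr (pullback U \<sigma>) i z - pr (pullback W \<sigma>) i z) =
      (LINT z|unit_square. (\<lambda>z. indicator (S' \<times> T') z *\<^sub>R (pr U i z - pr W i z)) (square_map \<sigma> z))"
      unfolding set_lebesgue_integral_def
    proof (rule Bochner_Integration.integral_cong[OF refl])
      fix z assume z: "z \<in> space unit_square"
      then have "square_map \<sigma> z \<in> S' \<times> T' \<longleftrightarrow> z \<in> S \<times> T"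
        using mpm_in[OF s] inv by (auto simp: square_map_def S'_def T'_def mem_Times_iff)
      then show "indicator (S \<times> T) z *\<^sub>R (pr (pullback U \<sigma>) i z - pr (pullback W \<sigma>) i z) =
        indicator (S' \<times> T') (square_map \<sigma> z) *\<^sub>R (pr U i (square_map \<sigma> z) - pr W i (square_map \<sigma> z))"
        by (simp add: pr_pullback indicator_def)
    qed
    also have "\<dots> = (LINT z:S' \<times> T'|unit_square. pr U i z - pr W i z)"
      unfolding set_lebesgue_integral_def
      by (rule square_map_integral[OF s])
         (use rect_in_unit_square[OF S'] pr_measurable[OF assms(1) i] pr_measurable[OF assms(2) i] in measurable)
    finally show ?thesis .
  qed
  then have "rect_discrepancy k (pullback U \<sigma>) (pullback W \<sigma>) S T = rect_discrepancy k U W S' T'"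
    unfolding rect_discrepancy_def by (intro sum.cong) auto
  also have "\<dots> \<le> cut_dist k U W" by (rule cut_dist_upper[OF assms(1,2) S'])
  finally show "rect_discrepancy k (pullback U \<sigma>) (pullback W \<sigma>) S T \<le> cut_dist k U W" .
qed

lemma graphon_dist_le_cut_dist:
  assumes "U \<in> graphons k" "W \<in> graphons k" "\<phi> \<in> measure_preserving_maps"
  shows "graphon_dist k U W \<le> cut_dist k U (pullback W \<phi>)"
  unfolding graphon_dist_def
proof (rule cINF_lower[OF _ assms(3)])
  show "bdd_below ((\<lambda>\<phi>. cut_dist k U (pullback W \<phi>)) ` measure_preserving_maps)"
    by (rule bdd_belowI[of _ 0]) (use cut_dist_nonneg pullback_graphon assms in auto)
qed

lemma graphon_dist_nonneg:
  assumes "U \<in> graphons k" "W \<in> graphons k"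
  shows "0 \<le> graphon_dist k U W"
  unfolding graphon_dist_def
  by (rule cINF_greatest) (use id_mpm cut_dist_nonneg pullback_graphon assms in auto)

lemma graphon_dist_lessD:
  assumes "graphon_dist k U W < e"
  obtains \<phi> where "\<phi> \<in> measure_preserving_maps" "cut_dist k U (pullback W \<phi>) < e"
proof -
  have "(\<lambda>\<phi>. cut_dist k U (pullback W \<phi>)) ` measure_preserving_maps \<noteq> {}" using id_mpm by auto
  from cInf_lessD[OF this assms[unfolded graphon_dist_def]] show ?thesis using that by auto
qed

section \<open>Weak convergence\<close>

text \<open>The test function is composed with an arbitrary \<phi>, but \<delta> must not depend on
  \<phi>. A cost chosen for \<open>W\<close> then serves all \<open>pullback W \<phi>\<close> with
  the same \<delta>, as an infimum over \<phi> requires.\<close>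

definition cut_controls :: "nat \<Rightarrow> (real \<times> real \<Rightarrow> real) \<Rightarrow> real \<Rightarrow> real \<Rightarrow> bool" where
  "cut_controls k g \<delta> e \<longleftrightarrow> (\<forall>U V \<phi> c. U \<in> graphons k \<longrightarrow> V \<in> graphons k \<longrightarrow>
     \<phi> \<in> measure_preserving_maps \<longrightarrow> c \<in> {1..k} \<longrightarrow> cut_dist k U V < \<delta> \<longrightarrow>
       \<bar>LINT z|unit_square. (pr U c z - pr V c z) * g (square_map \<phi> z)\<bar> < e)"

definition cut_weakly_null :: "nat \<Rightarrow> (real \<times> real \<Rightarrow> real) \<Rightarrow> bool" where
  "cut_weakly_null k g \<longleftrightarrow> (\<forall>e>0. \<exists>\<delta>>0. cut_controls k g \<delta> e)"

lemma cut_controlsD: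
  assumes "cut_controls k g \<delta> e" "U \<in> graphons k" "V \<in> graphons k"
    "\<phi> \<in> measure_preserving_maps" "c \<in> {1..k}" "cut_dist k U V < \<delta>"
  shows "\<bar>LINT z|unit_square. (pr U c z - pr V c z) * g (square_map \<phi> z)\<bar> < e"
  by (rule assms(1)[unfolded cut_controls_def, rule_format]) (fact assms)+

lemma cut_controlsI:
  assumes "\<And>U V \<phi> c. U \<in> graphons k \<Longrightarrow> V \<in> graphons k \<Longrightarrow>
    \<phi> \<in> measure_preserving_maps \<Longrightarrow> c \<in> {1..k} \<Longrightarrow> cut_dist k U V < \<delta> \<Longrightarrow>
    \<bar>LINT z|unit_square. (pr U c z - pr V c z) * g (square_map \<phi> z)\<bar> < e"
  shows "cut_controls k g \<delta> e"
  unfolding cut_controls_def by (intro allI impI) (rule assms)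

lemma cut_weakly_nullD:
  assumes "cut_weakly_null k g" "e > 0"
  obtains \<delta> where "\<delta> > 0" "cut_controls k g \<delta> e"
  using assms unfolding cut_weakly_null_def by blast

lemma cut_weakly_nullI:
  assumes "\<And>e. e > 0 \<Longrightarrow> \<exists>\<delta>>0. cut_controls k g \<delta> e"
  shows "cut_weakly_null k g"
  using assms unfolding cut_weakly_null_def by blast

lemma pr_diff_le_1: "\<bar>pr U c z - pr V c z\<bar> \<le> 1"
  using pmf_le_1[of "U (fst z) (snd z)" c] pmf_le_1[of "V (fst z) (snd z)" c]
    pmf_nonneg[of "U (fst z) (snd z)" c] pmf_nonneg[of "V (fst z) (snd z)" c] by linarith

lemma integrable_pr_diff_mult:
  assumes "U \<in> graphons k" "V \<in> graphons k" "c \<in> {1..k}" "\<phi> \<in> measure_preserving_maps"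
    and g: "integrable unit_square g"
  shows "integrable unit_square (\<lambda>z. (pr U c z - pr V c z) * (g (square_map \<phi> z) :: real))"
proof (rule Bochner_Integration.integrable_bound)
  show "integrable unit_square (\<lambda>z. g (square_map \<phi> z))"
    using g by (subst (asm) square_map_distr[OF assms(4), symmetric], subst (asm) integrable_distr_eq)
      (auto simp: square_map_measurable assms(4))
  then have "(\<lambda>z. g (square_map \<phi> z)) \<in> borel_measurable unit_square" by simp
  then show "(\<lambda>z. (pr U c z - pr V c z) * g (square_map \<phi> z)) \<in> borel_measurable unit_square"
    by (intro borel_measurable_times borel_measurable_diff pr_measurable[OF assms(1,3)]
        pr_measurable[OF assms(2,3)])
  have "\<bar>pr U c z - pr V c z\<bar> * \<bar>g (square_map \<phi> z)\<bar> \<le> 1 * \<bar>g (square_map \<phi> z)\<bar>" for z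
    by (intro mult_right_mono pr_diff_le_1) auto
  then show "AE z in unit_square. norm ((pr U c z - pr V c z) * g (square_map \<phi> z)) \<le> norm (g (square_map \<phi> z))"
    by (auto simp: abs_mult)
qed

text \<open>The bound is free of \<phi> because \<phi> preserves the measure. Approximating g in
  \<open>L\<^sup>1\<close> is therefore equally good for all its pullbacks.\<close>

lemma integral_pr_diff_mult_le:
  assumes "U \<in> graphons k" "V \<in> graphons k" "c \<in> {1..k}" "\<phi> \<in> measure_preserving_maps"
    and g: "integrable unit_square g"
  shows "\<bar>LINT z|unit_square. (pr U c z - pr V c z) * g (square_map \<phi> z)\<bar> \<le> (LINT z|unit_square. \<bar>g z\<bar>)"
proof -
  have int: "integrable unit_square (\<lambda>z. \<bar>g (square_map \<phi> z)\<bar>)"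
    using integrable_abs[OF g]
    by (subst (asm) square_map_distr[OF assms(4), symmetric], subst (asm) integrable_distr_eq)
      (use g in \<open>auto simp: square_map_measurable assms(4)\<close>)
  have "norm (LINT z|unit_square. (pr U c z - pr V c z) * g (square_map \<phi> z))
      \<le> (LINT z|unit_square. \<bar>g (square_map \<phi> z)\<bar>)"
  proof (rule Bochner_Integration.integral_norm_bound_integral[OF integrable_pr_diff_mult[OF assms] int])
    fix z
    have "\<bar>pr U c z - pr V c z\<bar> * \<bar>g (square_map \<phi> z)\<bar> \<le> 1 * \<bar>g (square_map \<phi> z)\<bar>"
      by (intro mult_right_mono pr_diff_le_1) auto
    then show "norm ((pr U c z - pr V c z) * g (square_map \<phi> z)) \<le> \<bar>g (square_map \<phi> z)\<bar>"
      by (simp add: abs_mult)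
  qed
  also have "\<dots> = (LINT z|unit_square. \<bar>g z\<bar>)"
    by (rule square_map_integral[OF assms(4)]) (use g in measurable)
  finally show ?thesis by simp
qed

text \<open>The preimage of a rectangle under \<open>square_map \<phi>\<close> is again a measurable
  rectangle, so the cut distance itself is the bound and \<delta> = e works for every
  \<phi>.\<close>

lemma cut_weakly_null_rect:
  assumes S: "S \<in> sets unit_interval" "T \<in> sets unit_interval"
  shows "cut_weakly_null k (indicator (S \<times> T))"
proof (rule cut_weakly_nullI)
  fix e :: real assume "e > 0"
  show "\<exists>\<delta>>0. cut_controls k (indicator (S \<times> T)) \<delta> e"
  proof (intro exI[of _ e] conjI \<open>e > 0\<close> cut_controlsI)
    fix U V \<phi> c assume *: "U \<in> graphons k" "V \<in> graphons k" "\<phi> \<in> measure_preserving_maps"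
      "c \<in> {1..k}" "cut_dist k U V < e"
    define S' T' where "S' = \<phi> -` S \<inter> {0..1}" and "T' = \<phi> -` T \<inter> {0..1}"
    have S': "S' \<in> sets unit_interval" "T' \<in> sets unit_interval"
      using measurable_sets[OF mpm_measurable[OF *(3)]] S by (auto simp: S'_def T'_def)
    have "(LINT z|unit_square. (pr U c z - pr V c z) * indicator (S \<times> T) (square_map \<phi> z))
       = (LINT z:S' \<times> T'|unit_square. pr U c z - pr V c z)"
      unfolding set_lebesgue_integral_def
      by (rule Bochner_Integration.integral_cong)
         (auto simp: S'_def T'_def square_map_def indicator_def mem_Times_iff)
    with cut_dist_upper_colour[OF *(1,2) S' *(4)] *(5)
    show "\<bar>LINT z|unit_square. (pr U c z - pr V c z) * indicator (S \<times> T) (square_map \<phi> z)\<bar> < e"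
      by simp
  qed
qed

lemma cut_weakly_null_scale:
  assumes "cut_weakly_null k f"
  shows "cut_weakly_null k (\<lambda>z. a * f z)"
proof (rule cut_weakly_nullI)
  fix e :: real assume "e > 0"
  then have e': "e / (\<bar>a\<bar> + 1) > 0" by simp
  obtain \<delta> where \<delta>: "\<delta> > 0" and H: "cut_controls k f \<delta> (e / (\<bar>a\<bar> + 1))"
    by (rule cut_weakly_nullD[OF assms e']) blast
  have "\<bar>LINT z|unit_square. (pr U c z - pr V c z) * (a * f (square_map \<phi> z))\<bar> < e"
    if "\<bar>LINT z|unit_square. (pr U c z - pr V c z) * f (square_map \<phi> z)\<bar> < e / (\<bar>a\<bar> + 1)" for U V c \<phi>
  proof -
    let ?I = "LINT z|unit_square. (pr U c z - pr V c z) * f (square_map \<phi> z)"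
    have "(LINT z|unit_square. (pr U c z - pr V c z) * (a * f (square_map \<phi> z))) = a * ?I"
      by (subst Bochner_Integration.integral_mult_right_zero[symmetric]) (simp add: mult_ac)
    moreover have "\<bar>a\<bar> * \<bar>?I\<bar> \<le> (\<bar>a\<bar> + 1) * \<bar>?I\<bar>" by (intro mult_right_mono) auto
    moreover have "(\<bar>a\<bar> + 1) * \<bar>?I\<bar> < e" using that by (simp add: field_simps)
    ultimately show ?thesis by (simp add: abs_mult)
  qed
  then have "cut_controls k (\<lambda>z. a * f z) \<delta> e"
    by (intro cut_controlsI) (use cut_controlsD[OF H] in blast)
  with \<delta> show "\<exists>\<delta>>0. cut_controls k (\<lambda>z. a * f z) \<delta> e" by blast
qed

lemma cut_weakly_null_add:
  assumes "cut_weakly_null k f" "cut_weakly_null k g"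
    and fg: "integrable unit_square f" "integrable unit_square g"
  shows "cut_weakly_null k (\<lambda>z. f z + g z)"
proof (rule cut_weakly_nullI)
  fix e :: real assume "e > 0"
  then have e2: "e / 2 > 0" by simp
  obtain \<delta>1 where \<delta>1: "\<delta>1 > 0" and H1: "cut_controls k f \<delta>1 (e / 2)"
    by (rule cut_weakly_nullD[OF assms(1) e2]) blast
  obtain \<delta>2 where \<delta>2: "\<delta>2 > 0" and H2: "cut_controls k g \<delta>2 (e / 2)"
    by (rule cut_weakly_nullD[OF assms(2) e2]) blast
  show "\<exists>\<delta>>0. cut_controls k (\<lambda>z. f z + g z) \<delta> e"
  proof (intro exI[of _ "min \<delta>1 \<delta>2"] conjI cut_controlsI)
    fix U V \<phi> c assume *: "U \<in> graphons k" "V \<in> graphons k" "\<phi> \<in> measure_preserving_maps"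
      "c \<in> {1..k}" "cut_dist k U V < min \<delta>1 \<delta>2"
    have "(LINT z|unit_square. (pr U c z - pr V c z) * (f (square_map \<phi> z) + g (square_map \<phi> z))) =
      (LINT z|unit_square. (pr U c z - pr V c z) * f (square_map \<phi> z)) +
      (LINT z|unit_square. (pr U c z - pr V c z) * g (square_map \<phi> z))"
      by (subst Bochner_Integration.integral_add[symmetric])
         (use integrable_pr_diff_mult[OF *(1,2,4,3)] fg in \<open>auto simp: algebra_simps\<close>)
    with cut_controlsD[OF H1 *(1-4)] cut_controlsD[OF H2 *(1-4)] *(5)
    show "\<bar>LINT z|unit_square. (pr U c z - pr V c z) * (f (square_map \<phi> z) + g (square_map \<phi> z))\<bar> < e"
      by linarith
  qed (use \<delta>1 \<delta>2 in auto)
qed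

text \<open>Half of e pays for replacing f by some \<open>s i\<close>, uniformly in the graphons and
  \<phi> by \<open>integral_pr_diff_mult_le\<close>; the other half is the modulus of that one
  \<open>s i\<close>.\<close>

lemma cut_weakly_null_lim:
  assumes s: "\<And>i. cut_weakly_null k (s i)" and int: "\<And>i. integrable unit_square (s i)"
    and f: "integrable unit_square f"
    and lim: "(\<lambda>i. LINT z|unit_square. \<bar>f z - s i z\<bar>) \<longlonglongrightarrow> 0"
  shows "cut_weakly_null k f"
proof (rule cut_weakly_nullI)
  fix e :: real assume "e > 0"
  then have e2: "e / 2 > 0" by simp
  with lim have "\<forall>\<^sub>F i in sequentially. (LINT z|unit_square. \<bar>f z - s i z\<bar>) < e / 2"
    by (rule order_tendstoD)
  then obtain i where i: "(LINT z|unit_square. \<bar>f z - s i z\<bar>) < e / 2"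
    by (meson eventually_sequentially order_refl)
  obtain \<delta> where \<delta>: "\<delta> > 0" and H: "cut_controls k (s i) \<delta> (e / 2)"
    by (rule cut_weakly_nullD[OF s[of i] e2]) blast
  show "\<exists>\<delta>>0. cut_controls k f \<delta> e"
  proof (intro exI[of _ \<delta>] conjI cut_controlsI \<delta>)
    fix U V \<phi> c assume *: "U \<in> graphons k" "V \<in> graphons k" "\<phi> \<in> measure_preserving_maps"
      "c \<in> {1..k}" "cut_dist k U V < \<delta>"
    have fs: "integrable unit_square (\<lambda>z. f z - s i z)" using f int by auto
    have "(LINT z|unit_square. (pr U c z - pr V c z) * f (square_map \<phi> z)) =
      (LINT z|unit_square. (pr U c z - pr V c z) * (f (square_map \<phi> z) - s i (square_map \<phi> z))) +
      (LINT z|unit_square. (pr U c z - pr V c z) * s i (square_map \<phi> z))"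
      by (subst Bochner_Integration.integral_add[symmetric])
         (use integrable_pr_diff_mult[OF *(1,2,4,3) fs] integrable_pr_diff_mult[OF *(1,2,4,3) int[of i]]
           in \<open>auto simp: algebra_simps\<close>)
    with cut_controlsD[OF H *] integral_pr_diff_mult_le[OF *(1,2,4,3) fs] i
    show "\<bar>LINT z|unit_square. (pr U c z - pr V c z) * f (square_map \<phi> z)\<bar> < e" by linarith
  qed
qed

lemma tendsto_integral_abs_diff_0:
  assumes f: "integrable M (f :: 'a \<Rightarrow> real)" and s: "\<And>i. integrable M (s i)"
    and lim: "\<And>x. x \<in> space M \<Longrightarrow> (\<lambda>i. s i x) \<longlonglongrightarrow> f x"
    and bd: "\<And>i x. x \<in> space M \<Longrightarrow> \<bar>s i x\<bar> \<le> w x" and w: "integrable M w"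
  shows "(\<lambda>i. LINT z|M. \<bar>f z - s i z\<bar>) \<longlonglongrightarrow> 0"
proof -
  have "(\<lambda>i. LINT z|M. \<bar>f z - s i z\<bar>) \<longlonglongrightarrow> (LINT z|M. 0)"
  proof (rule integral_dominated_convergence[where w="\<lambda>x. \<bar>f x\<bar> + w x"])
    show "AE x in M. (\<lambda>i. \<bar>f x - s i x\<bar>) \<longlonglongrightarrow> 0"
    proof (rule AE_I2)
      fix x assume "x \<in> space M"
      from tendsto_rabs[OF tendsto_diff[OF tendsto_const[of "f x"] lim[OF this]]]
      show "(\<lambda>i. \<bar>f x - s i x\<bar>) \<longlonglongrightarrow> 0" by simp
    qed
    show "AE x in M. norm \<bar>f x - s i x\<bar> \<le> \<bar>f x\<bar> + w x" for i
    proof (rule AE_I2)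
      fix x assume "x \<in> space M"
      from bd[OF this, of i] abs_triangle_ineq4[of "f x" "s i x"]
      show "norm \<bar>f x - s i x\<bar> \<le> \<bar>f x\<bar> + w x" by simp
    qed
  qed (use f s w in auto)
  then show ?thesis by simp
qed

text \<open>Dynkin's argument: rectangles form an intersection-stable generator, complements are
  differences from the whole square, and countable disjoint unions are \<open>L\<^sup>1\<close>
  limits of finite ones. The modulus \<delta> is allowed to depend on the set.\<close>

lemma cut_weakly_null_set:
  assumes "A \<in> sets unit_square"
  shows "cut_weakly_null k (indicator A)"
proof -
  let ?G = "{S \<times> T | S T. S \<in> sets unit_interval \<and> T \<in> sets unit_interval}"
  have eq: "sets unit_square = sigma_sets ({0..1} \<times> {0..1}) ?G"
    using sets_pair_measure[of unit_interval unit_interval] by (simp add: unit_square_def)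
  have ii: "integrable unit_square (indicator B :: _ \<Rightarrow> real)" if "B \<in> sets unit_square" for B
    using that by (intro integrable_bounded_square[where B=1]) auto
  have G: "?G \<subseteq> Pow ({0..1} \<times> {0..1})" using sets.sets_into_space[of _ unit_interval] by fastforce
  have A: "A \<in> sigma_sets ({0..1} \<times> {0..1}) ?G" using assms eq by simp
  have space: "cut_weakly_null k (indicator ({0..1} \<times> {0..1}))"
    by (rule cut_weakly_null_rect) (use sets.top[of unit_interval] in simp_all)
  show ?thesis
  proof (rule sigma_sets_induct_disjoint[OF Int_stable_pair_measure_generator[of unit_interval unit_interval] G A])
    fix B assume "B \<in> ?G" then show "cut_weakly_null k (indicator B)" using cut_weakly_null_rect by auto
  next
    show "cut_weakly_null k (indicator {})" using cut_weakly_null_rect[of "{}" "{}" k] by simp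
  next
    fix B assume B: "B \<in> sigma_sets ({0..1} \<times> {0..1}) ?G" and IH: "cut_weakly_null k (indicator B)"
    have B': "B \<in> sets unit_square" using B eq by simp
    have S: "{0..1} \<times> {0..1} \<in> sets unit_square" using sets.top[of unit_square] by simp
    have "indicator ({0..1} \<times> {0..1} - B) = (\<lambda>z. indicator ({0..1} \<times> {0..1}) z + (-1) * indicator B z :: real)"
      using sets.sets_into_space[OF B'] by (auto simp: fun_eq_iff indicator_def)
    then show "cut_weakly_null k (indicator ({0..1} \<times> {0..1} - B))"
      using cut_weakly_null_add[OF space cut_weakly_null_scale[OF IH, of "-1"] ii[OF S]] ii[OF B'] by simp
  next
    fix B :: "nat \<Rightarrow> _" assume d: "disjoint_family B"
      and B: "range B \<subseteq> sigma_sets ({0..1} \<times> {0..1}) ?G"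
      and IH: "\<And>i. cut_weakly_null k (indicator (B i))"
    have B': "B i \<in> sets unit_square" for i using B eq by auto
    define s where "s m z = (\<Sum>i<m. indicator (B i) z :: real)" for m z
    have sint: "integrable unit_square (s m)" for m
      unfolding s_def using ii[OF B'] by auto
    have s: "cut_weakly_null k (s m)" for m
    proof (induction m)
      case 0
      have "s 0 = indicator ({} \<times> {})" by (simp add: s_def fun_eq_iff)
      then show ?case by (simp only:) (rule cut_weakly_null_rect, auto)
    next
      case (Suc m)
      have "s (Suc m) = (\<lambda>z. s m z + indicator (B m) z)" by (simp add: s_def fun_eq_iff)
      then show ?case using cut_weakly_null_add[OF Suc IH sint ii[OF B']] by simp
    qed
    have U: "(\<Union>i. B i) \<in> sets unit_square" using B' by auto
    have su: "(\<lambda>i. indicator (B i) z) sums (indicator (\<Union>i. B i) z :: real)" for z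
      using indicator_sums[of B z] d by (auto simp: disjoint_family_on_def)
    have le1: "\<bar>s m z\<bar> \<le> 1" for m z
    proof -
      have "s m z \<le> indicator (\<Union>i. B i) z"
        unfolding s_def using sum_le_suminf[OF sums_summable[OF su], of "{..<m}" z] sums_unique[OF su, of z]
        by simp
      also have "\<dots> \<le> 1" by (simp add: indicator_def)
      finally show ?thesis by (simp add: s_def sum_nonneg)
    qed
    show "cut_weakly_null k (indicator (\<Union>i. B i))"
    proof (rule cut_weakly_null_lim[OF s sint ii[OF U]])
      show "(\<lambda>m. LINT z|unit_square. \<bar>indicator (\<Union>i. B i) z - s m z\<bar>) \<longlonglongrightarrow> 0"
        by (rule tendsto_integral_abs_diff_0[OF ii[OF U] sint _ le1])
           (use su in \<open>auto simp: sums_def s_def\<close>)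
    qed
  qed
qed

text \<open>This is the sense in which cut convergence implies weak convergence: against each fixed
  integrable function, not uniformly over bounded ones. It is applied only to edge costs.\<close>

lemma cut_weakly_null_integrable:
  assumes "integrable unit_square g"
  shows "cut_weakly_null k g"
  using assms
proof (induction rule: integrable_induct)
  case (base A c)
  then show ?case
    using cut_weakly_null_scale[OF cut_weakly_null_set[of A k], of c] by (simp add: mult.commute)
next
  case (add f g)
  then show ?case using cut_weakly_null_add by blast
next
  case (lim f s)
  show ?case
    by (rule cut_weakly_null_lim[of k s, OF lim(5) lim(1) lim(4)])
       (rule tendsto_integral_abs_diff_0[OF lim(4,1,2), where w="\<lambda>x. 2 * norm (f x)"],
         use lim in auto)
qed

section \<open>Entropy as an infimum of linear functionals\<close>

text \<open>A cost \<open>g\<close> encodes the sub-probability weights \<open>k\<^sup>-\<^sup>g\<close>; by Gibbs' inequality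
  the expected cost of a graphon dominates its entropy.\<close>

definition edge_cost :: "nat \<Rightarrow> (nat \<Rightarrow> real \<times> real \<Rightarrow> real) \<Rightarrow> bool" where
  "edge_cost k g \<longleftrightarrow>
     (\<forall>c\<in>{1..k}. g c \<in> borel_measurable unit_square) \<and>
     (\<exists>B. \<forall>c\<in>{1..k}. \<forall>z\<in>space unit_square. 0 \<le> g c z \<and> g c z \<le> B) \<and>
     (\<forall>c\<in>{1..k}. \<forall>x\<in>{0..1}. \<forall>y\<in>{0..1}. g c (x, y) = g c (y, x)) \<and>
     (\<forall>z\<in>space unit_square. (\<Sum>c=1..k. real k powr (- g c z)) \<le> 1)"

definition expected_cost :: "nat \<Rightarrow> graphon \<Rightarrow> (nat \<Rightarrow> real \<times> real \<Rightarrow> real) \<Rightarrow> real" where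
  "expected_cost k W g = (LINT z|unit_square. (\<Sum>c=1..k. pr W c z * g c z))"

lemma edge_cost_integrable:
  assumes "edge_cost k g" "c \<in> {1..k}"
  shows "integrable unit_square (g c)"
proof -
  from assms obtain B where "\<And>z. z \<in> space unit_square \<Longrightarrow> 0 \<le> g c z \<and> g c z \<le> B"
    unfolding edge_cost_def by blast
  then show ?thesis using assms
    by (intro integrable_bounded_square[where B=B]) (auto simp: edge_cost_def)
qed

lemma pr_mult_integrable:
  assumes "W \<in> graphons k" "edge_cost k g" "c \<in> {1..k}"
  shows "integrable unit_square (\<lambda>z. pr W c z * g c z)"
proof (rule Bochner_Integration.integrable_bound[OF edge_cost_integrable[OF assms(2,3)]])
  show "(\<lambda>z. pr W c z * g c z) \<in> borel_measurable unit_square"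
    using assms by (intro borel_measurable_times pr_measurable) (auto simp: edge_cost_def)
  have "\<bar>pr W c z * g c z\<bar> \<le> 1 * \<bar>g c z\<bar>" for z
    unfolding abs_mult by (intro mult_right_mono) (auto simp: pmf_le_1)
  then show "AE z in unit_square. norm (pr W c z * g c z) \<le> norm (g c z)" by simp
qed

lemma edge_cost_square_map:
  assumes "edge_cost k g" "\<phi> \<in> measure_preserving_maps"
  shows "edge_cost k (\<lambda>c z. g c (square_map \<phi> z))"
  unfolding edge_cost_def
proof (intro conjI ballI)
  have sp: "square_map \<phi> z \<in> space unit_square" if "z \<in> space unit_square" for z
    using measurable_space[OF square_map_measurable[OF assms(2)] that] .
  show "(\<lambda>z. g c (square_map \<phi> z)) \<in> borel_measurable unit_square" if "c \<in> {1..k}" for c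
    using assms that by (intro measurable_compose[OF square_map_measurable]) (auto simp: edge_cost_def)
  show "\<exists>B. \<forall>c\<in>{1..k}. \<forall>z\<in>space unit_square. 0 \<le> g c (square_map \<phi> z) \<and> g c (square_map \<phi> z) \<le> B"
    using assms(1) sp unfolding edge_cost_def by blast
  show "g c (square_map \<phi> (x, y)) = g c (square_map \<phi> (y, x))"
    if "c \<in> {1..k}" "x \<in> {0..1}" "y \<in> {0..1}" for c x y
    using assms that mpm_in[OF assms(2)] unfolding edge_cost_def square_map_def by (metis fst_conv snd_conv)
  show "(\<Sum>c=1..k. real k powr (- g c (square_map \<phi> z))) \<le> 1" if "z \<in> space unit_square" for z
    using assms(1) sp[OF that] unfolding edge_cost_def by blast
qed

lemma expected_cost_pullback:
  assumes "W \<in> graphons k" "edge_cost k g" "\<phi> \<in> measure_preserving_maps"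
  shows "expected_cost k (pullback W \<phi>) (\<lambda>c z. g c (square_map \<phi> z)) = expected_cost k W g"
proof -
  have "(\<lambda>z. \<Sum>c=1..k. pr W c z * g c z) \<in> borel_measurable unit_square"
    using assms by (intro borel_measurable_sum borel_measurable_times pr_measurable) (auto simp: edge_cost_def)
  from square_map_integral[OF assms(3) this] show ?thesis
    by (simp add: expected_cost_def pullback_def square_map_def)
qed

text \<open>Termwise from \<open>ln t \<le> t - 1\<close> at the ratio of
  \<open>b powr (- q i)\<close> to \<open>p i\<close>. Summing leaves the total of the weights minus
  1, which is why sub-probability weights suffice.\<close>

lemma gibbs:
  fixes p q :: "'a \<Rightarrow> real"
  assumes "finite I" "b > 1" "\<And>i. i \<in> I \<Longrightarrow> p i \<ge> 0" "sum p I = 1"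
    and q: "(\<Sum>i\<in>I. b powr (- q i)) \<le> 1"
  shows "- (\<Sum>i\<in>I. p i * log b (p i)) \<le> (\<Sum>i\<in>I. p i * q i)"
proof -
  have "- (p i * log b (p i)) - p i * q i \<le> (b powr (- q i) - p i) / ln b" if "i \<in> I" for i
  proof (cases "p i = 0")
    case True then show ?thesis using assms(2) by simp
  next
    case False
    then have p: "p i > 0" using assms(3)[OF that] by simp
    have "ln (b powr (- q i) / p i) \<le> b powr (- q i) / p i - 1"
      by (rule ln_le_minus_one) (use p assms(2) in simp)
    moreover have "ln (b powr (- q i) / p i) = - q i * ln b - ln (p i)"
      using p assms(2) by (simp add: ln_div ln_powr)
    ultimately have "p i * (- q i * ln b - ln (p i)) \<le> p i * (b powr (- q i) / p i - 1)"
      using p by (intro mult_left_mono) auto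
    also have "\<dots> = b powr (- q i) - p i" using p by (simp add: field_simps)
    finally have "p i * (- q i * ln b - ln (p i)) / ln b \<le> (b powr (- q i) - p i) / ln b"
      using assms(2) by (intro divide_right_mono) auto
    moreover have "p i * (- q i * ln b - ln (p i)) / ln b = - (p i * log b (p i)) - p i * q i"
      using assms(2) by (simp add: log_def field_simps)
    ultimately show ?thesis by simp
  qed
  then have "(\<Sum>i\<in>I. - (p i * log b (p i)) - p i * q i) \<le> (\<Sum>i\<in>I. (b powr (- q i) - p i) / ln b)"
    by (rule sum_mono)
  also have "\<dots> = ((\<Sum>i\<in>I. b powr (- q i)) - 1) / ln b"
    by (simp add: sum_divide_distrib[symmetric] sum_subtractf assms(4))
  also have "\<dots> \<le> 0" using q assms(2) by (simp add: divide_le_0_iff)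
  finally show ?thesis by (simp add: sum_subtractf sum_negf)
qed

lemma entropy_le_one_fun:
  assumes "k \<ge> 2" "W \<in> graphons k" "z \<in> space unit_square"
  shows "entropy_fun k (pmf (W (fst z) (snd z))) \<le> 1"
proof -
  \<comment> \<open>The constant cost 1 corresponds to the uniform distribution, of total weight k /
    k.\<close>
  have "- (\<Sum>i=1..k. pr W i z * log (real k) (pr W i z)) \<le> (\<Sum>i=1..k. pr W i z * 1)"
    by (rule gibbs) (use assms sum_pr[OF assms(2,3)] in \<open>auto simp: powr_minus field_simps\<close>)
  then show ?thesis using sum_pr[OF assms(2,3)] by (simp add: entropy_fun_def)
qed

lemma entropy_fun_nonneg:
  assumes "k \<ge> 2"
  shows "0 \<le> entropy_fun k (pmf p)"
proof -
  have "pmf p c * log (real k) (pmf p c) \<le> 0" for c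
    using assms pmf_le_1[of p c] pmf_nonneg[of p c]
    by (cases "pmf p c = 0") (auto intro!: mult_nonneg_nonpos simp: order_less_le)
  then show ?thesis unfolding entropy_fun_def by (simp add: sum_nonpos)
qed

lemma entropy_integrable:
  assumes "k \<ge> 2" "W \<in> graphons k"
  shows "integrable unit_square (\<lambda>z. entropy_fun k (pmf (W (fst z) (snd z))))"
  by (rule integrable_bounded_square[OF entropy_measurable[OF assms(2)], where B=1])
     (use entropy_le_one_fun[OF assms] entropy_fun_nonneg[OF assms(1)] in \<open>auto simp: abs_le_iff intro: order_trans[OF _ entropy_fun_nonneg[OF assms(1)]]\<close>)

lemma entropy_le_1:
  assumes "k \<ge> 2" "W \<in> graphons k"
  shows "graphon_entropy k W \<le> 1"
proof -
  have "graphon_entropy k W \<le> (LINT z|unit_square. 1)"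
    unfolding graphon_entropy_def
    by (rule Bochner_Integration.integral_mono[OF entropy_integrable[OF assms]])
       (use entropy_le_one_fun[OF assms] in auto)
  then show ?thesis using unit_square.prob_space by simp
qed

lemma entropy_le_expected_cost:
  assumes "k \<ge> 2" "W \<in> graphons k" "edge_cost k g"
  shows "graphon_entropy k W \<le> expected_cost k W g"
  unfolding graphon_entropy_def expected_cost_def
proof (rule Bochner_Integration.integral_mono[OF entropy_integrable[OF assms(1,2)]])
  show "integrable unit_square (\<lambda>z. \<Sum>c=1..k. pr W c z * g c z)"
    using pr_mult_integrable[OF assms(2,3)] by auto
  show "entropy_fun k (pmf (W (fst z) (snd z))) \<le> (\<Sum>c=1..k. pr W c z * g c z)"
    if "z \<in> space unit_square" for z
    unfolding entropy_fun_def
    by (rule gibbs) (use assms sum_pr[OF assms(2) that] that in \<open>auto simp: edge_cost_def\<close>)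
qed

text \<open>The optimal cost - log p is unbounded where p vanishes. Adding \<eta> to each of the k
  probabilities raises their sum to 1 + k \<eta>, and \<eta> is chosen so that this is q = k^e.
  Dividing by q restores total weight 1 and adds exactly e to the cost, while \<eta> itself only
  lowers it.\<close>

lemma near_optimal_cost:
  assumes "k \<ge> 2" "W \<in> graphons k" "e > 0"
  obtains g where "edge_cost k g" "expected_cost k W g \<le> graphon_entropy k W + e"
proof -
  define q where "q = real k powr e"
  have k1: "real k > 1" using assms(1) by simp
  have q: "q > 1" unfolding q_def using k1 assms(3) by simp
  define \<eta> where "\<eta> = (q - 1) / real k"
  have \<eta>: "\<eta> > 0" using q k1 by (simp add: \<eta>_def)
  \<comment> \<open>This gives p + \<eta> \<le> q for every probability p, which is nonnegativity of
    the cost.\<close>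
  have "\<eta> * 1 \<le> \<eta> * real k" using \<eta> k1 by (intro mult_left_mono) auto
  then have \<eta>q: "1 + \<eta> \<le> q" using k1 by (simp add: \<eta>_def)
  define g where "g c z = - log (real k) ((pr W c z + \<eta>) / q)" for c z
  have pos: "(pr W c z + \<eta>) / q > 0" for c z using \<eta> q by (simp add: add_nonneg_pos)
  have powr: "real k powr (- g c z) = (pr W c z + \<eta>) / q" for c z
    unfolding g_def using pos[of z c] k1 by simp
  have cost: "edge_cost k g"
    unfolding edge_cost_def
  proof (intro conjI ballI exI)
    show "g c \<in> borel_measurable unit_square" if "c \<in> {1..k}" for c
      unfolding g_def
      by (intro borel_measurable_uminus borel_measurable_log borel_measurable_divide borel_measurable_add
          pr_measurable[OF assms(2) that] borel_measurable_const)
    show "0 \<le> g c z" for c z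
    proof -
      have "(pr W c z + \<eta>) / q \<le> 1" using \<eta>q pmf_le_1[of "W (fst z) (snd z)" c] q by simp
      then show ?thesis unfolding g_def using pos[of z c] k1 by simp
    qed
    show "g c z \<le> - log (real k) (\<eta> / q)" for c z
      unfolding g_def using \<eta> q k1 pos[of z c] by (simp add: divide_right_mono)
    show "g c (x, y) = g c (y, x)" if "x \<in> {0..1}" "y \<in> {0..1}" for c x y
      using assms(2) that unfolding graphons_def g_def by simp
    show "(\<Sum>c=1..k. real k powr (- g c z)) \<le> 1" if "z \<in> space unit_square" for z
      unfolding powr using sum_pr[OF assms(2) that] k1 q
      by (simp add: sum_divide_distrib[symmetric] sum.distrib \<eta>_def)
  qed
  have "expected_cost k W g \<le> (LINT z|unit_square. entropy_fun k (pmf (W (fst z) (snd z))) + e)"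
    unfolding expected_cost_def
  proof (rule Bochner_Integration.integral_mono)
    show "integrable unit_square (\<lambda>z. \<Sum>c=1..k. pr W c z * g c z)"
      using pr_mult_integrable[OF assms(2) cost] by auto
    show "integrable unit_square (\<lambda>z. entropy_fun k (pmf (W (fst z) (snd z))) + e)"
      using entropy_integrable[OF assms(1,2)] by auto
    fix z assume z: "z \<in> space unit_square"
    have "pr W c z * g c z \<le> - (pr W c z * log (real k) (pr W c z)) + pr W c z * e" for c
    proof (cases "pr W c z = 0")
      case False
      then have p: "pr W c z > 0" using pmf_nonneg[of "W (fst z) (snd z)" c] by simp
      have "log (real k) (pr W c z) \<le> log (real k) (pr W c z + \<eta>)" using p \<eta> k1 by simp
      moreover have "log (real k) ((pr W c z + \<eta>) / q) = log (real k) (pr W c z + \<eta>) - e"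
        using p \<eta> q k1 by (subst log_divide) (auto simp: q_def)
      ultimately have "g c z \<le> - log (real k) (pr W c z) + e" unfolding g_def by simp
      then have "pr W c z * g c z \<le> pr W c z * (- log (real k) (pr W c z) + e)"
        using p by (intro mult_left_mono) auto
      then show ?thesis by (simp add: algebra_simps)
    qed simp
    then have "(\<Sum>c=1..k. pr W c z * g c z) \<le> (\<Sum>c=1..k. - (pr W c z * log (real k) (pr W c z)) + pr W c z * e)"
      by (rule sum_mono)
    also have "\<dots> = entropy_fun k (pmf (W (fst z) (snd z))) + e"
      using sum_pr[OF assms(2) z]
      by (simp add: entropy_fun_def sum_subtractf sum_distrib_right[symmetric])
    finally show "(\<Sum>c=1..k. pr W c z * g c z) \<le> entropy_fun k (pmf (W (fst z) (snd z))) + e" .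
  qed
  also have "\<dots> = graphon_entropy k W + e"
    using entropy_integrable[OF assms(1,2)] unit_square.prob_space by (simp add: graphon_entropy_def)
  finally show thesis using that cost by blast
qed

lemma expected_cost_close:
  assumes "k \<ge> 1" "edge_cost k g" "e > 0"
  obtains \<delta> where "\<delta> > 0" "\<And>U V \<phi>. U \<in> graphons k \<Longrightarrow> V \<in> graphons k \<Longrightarrow>
    \<phi> \<in> measure_preserving_maps \<Longrightarrow> cut_dist k U V < \<delta> \<Longrightarrow>
    expected_cost k U (\<lambda>c z. g c (square_map \<phi> z)) \<le> expected_cost k V (\<lambda>c z. g c (square_map \<phi> z)) + e"
proof -
  define e' where "e' = e / real k"
  have "e' > 0" using assms by (simp add: e'_def)
  have "\<exists>\<delta>>0. cut_controls k (g c) \<delta> e'" if c: "c \<in> {1..k}" for c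
    using cut_weakly_null_integrable[OF edge_cost_integrable[OF assms(2) c], of k] \<open>e' > 0\<close>
    unfolding cut_weakly_null_def by blast
  then obtain d where d: "\<And>c. c \<in> {1..k} \<Longrightarrow> d c > 0" and
    H: "\<And>c. c \<in> {1..k} \<Longrightarrow> cut_controls k (g c) (d c) e'"
    by metis
  define \<delta> where "\<delta> = Min (d ` {1..k})"
  show thesis
  proof
    show "\<delta> > 0" unfolding \<delta>_def using d assms(1) by (subst Min_gr_iff) auto
    fix U V \<phi> assume *: "U \<in> graphons k" "V \<in> graphons k" "\<phi> \<in> measure_preserving_maps" "cut_dist k U V < \<delta>"
    let ?g = "\<lambda>c z. g c (square_map \<phi> z)"
    have cost: "edge_cost k ?g" by (rule edge_cost_square_map[OF assms(2) *(3)])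
    have "expected_cost k U ?g - expected_cost k V ?g
       = (LINT z|unit_square. (\<Sum>c=1..k. (pr U c z - pr V c z) * ?g c z))"
      unfolding expected_cost_def
      by (subst Bochner_Integration.integral_diff[symmetric])
         (use pr_mult_integrable[OF *(1) cost] pr_mult_integrable[OF *(2) cost] in
           \<open>auto simp: sum_subtractf[symmetric] algebra_simps\<close>)
    also have "\<dots> = (\<Sum>c=1..k. LINT z|unit_square. (pr U c z - pr V c z) * ?g c z)"
      by (rule Bochner_Integration.integral_sum)
         (use integrable_pr_diff_mult[OF *(1,2) _ *(3) edge_cost_integrable[OF assms(2)]] in auto)
    also have "\<dots> \<le> (\<Sum>c=1..k. e')"
    proof (rule sum_mono)
      fix c assume c: "c \<in> {1..k}"
      then have "\<delta> \<le> d c" unfolding \<delta>_def by (intro Min_le) auto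
      with *(4) have "cut_dist k U V < d c" by simp
      from cut_controlsD[OF H[OF c] *(1-3) c this] show "(LINT z|unit_square. (pr U c z - pr V c z) * ?g c z) \<le> e'" by simp
    qed
    also have "\<dots> = e" using assms(1) by (simp add: e'_def)
    finally show "expected_cost k U ?g \<le> expected_cost k V ?g + e" by simp
  qed
qed

text \<open>One cost g, nearly optimal for \<open>W\<close>, is used for all \<phi>: composed with
  \<open>square_map \<phi>\<close> it bounds the entropy of U from above, and its expectation under
  \<open>pullback W \<phi>\<close> equals that of g under \<open>W\<close>. So \<delta> does not
  depend on \<phi>.\<close>

lemma entropy_upper_semicontinuous:
  assumes "k \<ge> 2" "W \<in> graphons k" "e > 0"
  obtains \<delta> where "\<delta> > 0" "\<And>U \<phi>. U \<in> graphons k \<Longrightarrow> \<phi> \<in> measure_preserving_maps \<Longrightarrow>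
    cut_dist k U (pullback W \<phi>) < \<delta> \<Longrightarrow> graphon_entropy k U \<le> graphon_entropy k W + e"
proof -
  have e2: "e / 2 > 0" and k: "k \<ge> 1" using assms by auto
  obtain g where g: "edge_cost k g" "expected_cost k W g \<le> graphon_entropy k W + e / 2"
    by (rule near_optimal_cost[OF assms(1,2) e2])
  obtain \<delta> where \<delta>: "\<delta> > 0" "\<And>U V \<phi>. U \<in> graphons k \<Longrightarrow> V \<in> graphons k \<Longrightarrow>
    \<phi> \<in> measure_preserving_maps \<Longrightarrow> cut_dist k U V < \<delta> \<Longrightarrow>
    expected_cost k U (\<lambda>c z. g c (square_map \<phi> z)) \<le> expected_cost k V (\<lambda>c z. g c (square_map \<phi> z)) + e / 2"
    by (rule expected_cost_close[OF k g(1) e2]) blast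
  show thesis
  proof (rule that[OF \<delta>(1)])
    fix U \<phi> assume *: "U \<in> graphons k" "\<phi> \<in> measure_preserving_maps" "cut_dist k U (pullback W \<phi>) < \<delta>"
    have "graphon_entropy k U \<le> expected_cost k U (\<lambda>c z. g c (square_map \<phi> z))"
      by (rule entropy_le_expected_cost[OF assms(1) *(1) edge_cost_square_map[OF g(1) *(2)]])
    also have "\<dots> \<le> expected_cost k (pullback W \<phi>) (\<lambda>c z. g c (square_map \<phi> z)) + e / 2"
      by (rule \<delta>(2)[OF *(1) pullback_graphon[OF assms(2) *(2)] *(2,3)])
    also have "\<dots> = expected_cost k W g + e / 2"
      by (simp add: expected_cost_pullback[OF assms(2) g(1) *(2)])
    finally show "graphon_entropy k U \<le> graphon_entropy k W + e" using g(2) by simp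
  qed
qed

text \<open>\<open>graphon_dist\<close> is asymmetric in form, so the two inequalities use it
  differently. The first is semicontinuity at \<open>W\<close> along \<phi>. The second is
  semicontinuity at the chosen representative U, applied to \<open>pullback W \<phi>\<close>, which
  has the entropy of \<open>W\<close>.\<close>

lemma limit_entropy_eq:
  assumes "k \<ge> 2" "W \<in> graphons k"
  shows "limit_entropy k (limit_of k W) = graphon_entropy k W"
proof -
  define U where "U = (SOME U. U \<in> limit_of k W)"
  have "graphon_dist k W W = 0"
    using graphon_dist_le_cut_dist[OF assms(2,2) id_mpm] graphon_dist_nonneg[OF assms(2,2)] by simp
  then have "W \<in> limit_of k W" using assms(2) by (simp add: limit_of_def)
  then have "U \<in> limit_of k W" unfolding U_def by (rule someI[of "\<lambda>U. U \<in> limit_of k W"])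
  then have U: "U \<in> graphons k" "graphon_dist k U W = 0" by (auto simp: limit_of_def)
  have "graphon_entropy k U \<le> graphon_entropy k W"
  proof (rule field_le_epsilon)
    fix e :: real assume "e > 0"
    then obtain \<delta> where \<delta>: "\<delta> > 0" "\<And>U \<phi>. U \<in> graphons k \<Longrightarrow> \<phi> \<in> measure_preserving_maps \<Longrightarrow>
      cut_dist k U (pullback W \<phi>) < \<delta> \<Longrightarrow> graphon_entropy k U \<le> graphon_entropy k W + e"
      by (rule entropy_upper_semicontinuous[OF assms]) blast
    obtain \<phi> where "\<phi> \<in> measure_preserving_maps" "cut_dist k U (pullback W \<phi>) < \<delta>"
      by (rule graphon_dist_lessD[of k U W \<delta>]) (use U \<delta> in auto)
    then show "graphon_entropy k U \<le> graphon_entropy k W + e" using \<delta>(2) U(1) by blast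
  qed
  moreover have "graphon_entropy k W \<le> graphon_entropy k U"
  proof (rule field_le_epsilon)
    fix e :: real assume "e > 0"
    then obtain \<delta> where \<delta>: "\<delta> > 0" "\<And>V \<phi>. V \<in> graphons k \<Longrightarrow> \<phi> \<in> measure_preserving_maps \<Longrightarrow>
      cut_dist k V (pullback U \<phi>) < \<delta> \<Longrightarrow> graphon_entropy k V \<le> graphon_entropy k U + e"
      by (rule entropy_upper_semicontinuous[OF assms(1) U(1)]) blast
    obtain \<phi> where \<phi>: "\<phi> \<in> measure_preserving_maps" "cut_dist k U (pullback W \<phi>) < \<delta>"
      by (rule graphon_dist_lessD[of k U W \<delta>]) (use U \<delta> in auto)
    have "graphon_entropy k (pullback W \<phi>) \<le> graphon_entropy k U + e"
      by (rule \<delta>(2)[OF pullback_graphon[OF assms(2) \<phi>(1)] id_mpm])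
         (use \<phi>(2) in \<open>simp add: cut_dist_commute\<close>)
    then show "graphon_entropy k W \<le> graphon_entropy k U + e"
      by (simp add: entropy_pullback[OF assms(2) \<phi>(1)])
  qed
  ultimately show ?thesis by (simp add: limit_entropy_def U_def)
qed

section \<open>Step graphons and relabelling\<close>

definition vertex_index :: "nat \<Rightarrow> real \<Rightarrow> nat" where
  "vertex_index n x = nat \<lfloor>real n * x\<rfloor> + 1"

definition pair_colour :: "nat \<Rightarrow> cgraph \<Rightarrow> nat \<Rightarrow> nat \<Rightarrow> nat" where
  "pair_colour d G u v = (if {u, v} \<in> complete_edges (fst G) then snd G {u, v} else d)"

definition block :: "nat \<Rightarrow> nat \<Rightarrow> real set" where
  "block n u = {x \<in> {0..1}. vertex_index n x = u}"

lemma complete_edges_iff [simp]: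
  "{u, v} \<in> complete_edges n \<longleftrightarrow> u \<noteq> v \<and> u \<in> {1..n} \<and> v \<in> {1..n}"
  by (auto simp: complete_edges_def nsets_def card_insert_if)

lemma complete_edgesE:
  assumes "e \<in> complete_edges n"
  obtains u v where "e = {u, v}" "u < v" "u \<in> {1..n}" "v \<in> {1..n}"
proof -
  from assms have "card e = 2" "e \<subseteq> {1..n}" by (auto simp: complete_edges_def nsets_def)
  then obtain u v where "e = {u, v}" "u \<noteq> v" by (meson card_2_iff)
  with \<open>e \<subseteq> {1..n}\<close> show thesis
    by (cases "u < v") (auto intro: that[of u v] that[of v u] simp: insert_commute)
qed

lemma finite_complete_edges [simp]: "finite (complete_edges n)"
  by (simp add: complete_edges_def finite_imp_finite_nsets)

lemma coloured_graph_colour: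
  assumes "G \<in> coloured_graphs k" "e \<in> complete_edges (fst G)"
  shows "snd G e \<in> {1..k}"
  using assms by (auto simp: coloured_graphs_def)

lemma pair_colour_range:
  assumes "G \<in> coloured_graphs k" "d \<in> {1..k}"
  shows "pair_colour d G u v \<in> {1..k}"
  using coloured_graph_colour[OF assms(1)] assms(2) unfolding pair_colour_def by auto

lemma pair_colour_commute: "pair_colour d G u v = pair_colour d G v u"
  by (simp add: pair_colour_def insert_commute)

lemma step_graphon_eq:
  "step_graphon d G x y =
     return_pmf (pair_colour d G (vertex_index (fst G) x) (vertex_index (fst G) y))"
  by (simp add: step_graphon_def pair_colour_def vertex_index_def Let_def)

lemma pr_step_graphon:
  "pr (step_graphon d G) c z = of_bool
     (pair_colour d G (vertex_index (fst G) (fst z)) (vertex_index (fst G) (snd z)) = c)"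
  by (simp add: step_graphon_eq pmf_return indicator_def)

lemma unit_interval_measurable_id [measurable]: "(\<lambda>x. x) \<in> borel_measurable unit_interval"
  by (simp add: unit_interval_def measurable_restrict_space1)

lemma vertex_index_measurable [measurable]:
  "vertex_index n \<in> measurable unit_interval (count_space UNIV)"
  unfolding vertex_index_def[abs_def] by measurable

lemma fst_unit_square [measurable]: "fst \<in> measurable unit_square unit_interval"
  and snd_unit_square [measurable]: "snd \<in> measurable unit_square unit_interval"
  by (simp_all add: unit_square_def)

lemma step_fun_measurable [measurable]:
  "(\<lambda>z. F (vertex_index n (fst z)) (vertex_index n (snd z)) :: real) \<in> borel_measurable unit_square"
proof (rule measurable_compose_countable[where f="\<lambda>i z. F i (vertex_index n (snd z))"])
  show "(\<lambda>z. vertex_index n (fst z)) \<in> measurable unit_square (count_space UNIV)"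
    by (rule measurable_compose[OF fst_unit_square vertex_index_measurable])
  show "(\<lambda>z. F i (vertex_index n (snd z))) \<in> borel_measurable unit_square" for i
    by (rule measurable_compose[OF measurable_compose[OF snd_unit_square vertex_index_measurable], of "F i"]) simp
qed

lemma step_graphon_graphon:
  assumes "G \<in> coloured_graphs k" "d \<in> {1..k}"
  shows "step_graphon d G \<in> graphons k"
proof -
  have "(\<lambda>z. pr (step_graphon d G) i z) \<in> borel_measurable unit_square" for i
    unfolding pr_step_graphon
    by (rule step_fun_measurable[where F="\<lambda>u v. of_bool (pair_colour d G u v = i)"])
  then show ?thesis using pair_colour_range[OF assms]
    by (auto simp: graphons_def case_prod_unfold step_graphon_eq pair_colour_commute)
qed

lemma block_sets [measurable]: "block n u \<in> sets unit_interval"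
proof -
  have "block n u = vertex_index n -` {u} \<inter> space unit_interval" by (auto simp: block_def)
  also have "\<dots> \<in> sets unit_interval" by measurable
  finally show ?thesis .
qed

lemma block_eq:
  assumes "u \<in> {1..n}"
  shows "block n u = {(real u - 1) / real n..<real u / real n}"
proof -
  have n: "real n > 0" using assms by auto
  have "vertex_index n x = u \<longleftrightarrow> real u - 1 \<le> real n * x \<and> real n * x < real u" if "x \<ge> 0" for x
  proof -
    have "vertex_index n x = u \<longleftrightarrow> \<lfloor>real n * x\<rfloor> = int u - 1"
      using that n assms by (auto simp: vertex_index_def)
    then show ?thesis by (simp add: floor_eq_iff)
  qed
  moreover have I: "x \<in> {(real u - 1) / real n..<real u / real n} \<longleftrightarrow> real u - 1 \<le> real n * x \<and> real n * x < real u" for x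
    using n by (simp add: pos_divide_le_eq pos_less_divide_eq mult.commute)
  moreover have "x \<in> {0..1}" if "x \<in> {(real u - 1) / real n..<real u / real n}" for x
  proof -
    have "(real u - 1) / real n \<ge> 0" "real u / real n \<le> 1" using assms by auto
    with that show ?thesis unfolding atLeastLessThan_iff atLeastAtMost_iff by linarith
  qed
  ultimately show ?thesis unfolding block_def by (intro set_eqI) (metis (mono_tags, lifting) atLeastAtMost_iff mem_Collect_eq)
qed

lemma emeasure_unit_interval:
  "A \<in> sets unit_interval \<Longrightarrow> emeasure unit_interval A = emeasure lborel A"
  unfolding unit_interval_def by (subst emeasure_restrict_space) (auto simp: sets_restrict_space)

lemma measure_unit_interval:
  "A \<in> sets unit_interval \<Longrightarrow> measure unit_interval A = measure lborel A"
  by (simp add: measure_def emeasure_unit_interval)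

lemma measure_block:
  assumes "u \<in> {1..n}"
  shows "measure unit_interval (block n u) = 1 / real n"
proof -
  have "measure unit_interval (block n u) = measure lborel {(real u - 1) / real n..<real u / real n}"
    using measure_unit_interval[OF block_sets, of n u] block_eq[OF assms] by simp
  also have "\<dots> = real u / real n - (real u - 1) / real n"
    by (subst measure_lborel_Ico) (auto simp: divide_right_mono)
  finally show ?thesis by (simp add: diff_divide_distrib)
qed

lemma measure_rect:
  assumes "S \<in> sets unit_interval" "T \<in> sets unit_interval"
  shows "measure unit_square (S \<times> T) = measure unit_interval S * measure unit_interval T"
  using assms
  by (simp add: measure_def unit_square_def unit_interval.emeasure_pair_measure_Times enn2real_mult)

lemma vertex_index_range:
  assumes "x \<in> {0..1}" "x \<noteq> 1" "n \<ge> 1"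
  shows "vertex_index n x \<in> {1..n}"
proof -
  have "real n * x < real n * 1" by (rule mult_strict_left_mono) (use assms in auto)
  then have "\<lfloor>real n * x\<rfloor> < int n" by (simp add: floor_less_iff)
  then show ?thesis using assms by (auto simp: vertex_index_def)
qed

text \<open>For n \<ge> 1 the point 1 is the only one with index n + 1; discarding it lets integrals
  of step functions become sums over the vertices alone.\<close>

lemma AE_unit_square_not_1: "AE z in unit_square. fst z \<noteq> 1 \<and> snd z \<noteq> 1"
proof (rule AE_I'[of "{1} \<times> {0..1} \<union> {0..1} \<times> {1}"])
  have one: "{1} \<in> sets unit_interval" "{0..1} \<in> sets unit_interval" "emeasure unit_interval {1} = 0"
    using sets.top[of unit_interval] by (auto simp: sets_unit_interval emeasure_unit_interval)
  have "emeasure unit_square ({1} \<times> {0..1}) = 0" "emeasure unit_square ({0..1} \<times> {1}) = 0"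
    using one by (simp_all add: unit_square_def unit_interval.emeasure_pair_measure_Times)
  then show "{1} \<times> {0..1} \<union> {0..1} \<times> {1} \<in> null_sets unit_square"
    using one by (intro null_sets.Un) (auto intro!: null_setsI)
qed (auto simp: mem_Times_iff)

text \<open>The weight h is an edge cost when graphs are counted and the indicator of a test
  rectangle when cut distances are estimated.\<close>

lemma step_fun_integral:
  assumes n: "n \<ge> 1" and h: "integrable unit_square (h :: _ \<Rightarrow> real)"
  shows "(LINT z|unit_square. F (vertex_index n (fst z)) (vertex_index n (snd z)) * h z) =
    (\<Sum>u=1..n. \<Sum>v=1..n. F u v * (LINT z:block n u \<times> block n v|unit_square. h z))"
proof -
  have i: "integrable unit_square (\<lambda>z. indicator (block n u \<times> block n v) z * h z)" for u v
    using integrable_mult_indicator[OF rect_in_unit_square[OF block_sets block_sets] h] by simp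
  have "(LINT z|unit_square. F (vertex_index n (fst z)) (vertex_index n (snd z)) * h z) =
    (LINT z|unit_square. (\<Sum>u=1..n. \<Sum>v=1..n. F u v * (indicator (block n u \<times> block n v) z * h z)))"
  proof (rule integral_cong_AE)
    show "(\<lambda>z. F (vertex_index n (fst z)) (vertex_index n (snd z)) * h z) \<in> borel_measurable unit_square"
      using h by measurable
    show "(\<lambda>z. \<Sum>u=1..n. \<Sum>v=1..n. F u v * (indicator (block n u \<times> block n v) z * h z))
       \<in> borel_measurable unit_square"
      by (intro borel_measurable_sum borel_measurable_times borel_measurable_const
          borel_measurable_integrable[OF i])
    show "AE z in unit_square. F (vertex_index n (fst z)) (vertex_index n (snd z)) * h z =
      (\<Sum>u=1..n. \<Sum>v=1..n. F u v * (indicator (block n u \<times> block n v) z * h z))"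
      using AE_unit_square_not_1 AE_space
    proof eventually_elim
      case (elim z)
      let ?u = "vertex_index n (fst z)" and ?v = "vertex_index n (snd z)"
      have r: "?u \<in> {1..n}" "?v \<in> {1..n}"
        by (rule vertex_index_range; use elim n in \<open>simp add: mem_Times_iff\<close>)+
      have "(\<Sum>u=1..n. \<Sum>v=1..n. F u v * (indicator (block n u \<times> block n v) z * h z)) =
        (\<Sum>u=1..n. \<Sum>v=1..n. if v = ?v then (if u = ?u then F u v * h z else 0) else 0)"
        using elim by (intro sum.cong refl) (auto simp: indicator_def block_def mem_Times_iff)
      also have "\<dots> = F ?u ?v * h z" using r by (simp add: sum.delta)
      finally show ?case by simp
    qed
  qed
  also have "\<dots> = (\<Sum>u=1..n. \<Sum>v=1..n. F u v * (LINT z:block n u \<times> block n v|unit_square. h z))"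
    using i by (simp add: set_lebesgue_integral_def integral_sum)
  finally show ?thesis .
qed

text \<open>Position u of the new graph is occupied by the old vertex \<open>\<pi> u\<close>. With
  this contravariant convention the new step graphon is the pullback along \<open>block_perm\<close>
  of the same \<pi>, and the isomorphism from the old graph is \<open>inv \<pi>\<close>. The
  restriction to edges keeps the colouring extensional.\<close>

definition relabel :: "(nat \<Rightarrow> nat) \<Rightarrow> cgraph \<Rightarrow> cgraph" where
  "relabel \<pi> G = (fst G, \<lambda>e\<in>complete_edges (fst G). snd G (\<pi> ` e))"

lemma fst_relabel [simp]: "fst (relabel \<pi> G) = fst G"
  by (simp add: relabel_def)

lemma image_complete_edges:
  assumes "\<pi> permutes {1..n}" "e \<in> complete_edges n"
  shows "\<pi> ` e \<in> complete_edges n"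
proof -
  from assms(2) obtain u v where e: "e = {u, v}" "u < v" "u \<in> {1..n}" "v \<in> {1..n}"
    by (rule complete_edgesE)
  have "\<pi> u \<noteq> \<pi> v" using permutes_inj[OF assms(1)] e by (auto dest: injD)
  then show ?thesis using e permutes_in_image[OF assms(1)] by simp
qed

lemma relabel_coloured_graph:
  assumes "G \<in> coloured_graphs k" "\<pi> permutes {1..fst G}"
  shows "relabel \<pi> G \<in> coloured_graphs k"
  using assms coloured_graph_colour[OF assms(1)] image_complete_edges[OF assms(2)]
  by (auto simp: coloured_graphs_def relabel_def)

lemma relabel_relabel_inv:
  assumes "G \<in> coloured_graphs k" "\<pi> permutes {1..fst G}"
  shows "relabel (inv \<pi>) (relabel \<pi> G) = G"
proof (rule prod_eqI)
  show "snd (relabel (inv \<pi>) (relabel \<pi> G)) = snd G"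
  proof
    fix e
    show "snd (relabel (inv \<pi>) (relabel \<pi> G)) e = snd G e"
    proof (cases "e \<in> complete_edges (fst G)")
      case True
      have "\<pi> ` inv \<pi> ` e = e"
        using permutes_surj[OF assms(2)] by (simp add: image_f_inv_f)
      then show ?thesis using True image_complete_edges[OF permutes_inv[OF assms(2)] True]
        by (simp add: relabel_def)
    next
      case False
      then show ?thesis using assms(1)
        by (auto simp: relabel_def coloured_graphs_def PiE_def extensional_def)
    qed
  qed
qed simp

lemma graph_iso_relabel:
  assumes "G \<in> coloured_graphs k" "\<pi> permutes {1..fst G}"
  shows "graph_iso G (relabel \<pi> G)"
  unfolding graph_iso_def
proof (intro conjI exI[of _ "inv \<pi>"] ballI)
  show "bij_betw (inv \<pi>) {1..fst G} {1..fst G}"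
    using permutes_imp_bij[OF permutes_inv[OF assms(2)]] .
  fix e assume e: "e \<in> complete_edges (fst G)"
  have "\<pi> ` inv \<pi> ` e = e"
    using permutes_surj[OF assms(2)] by (simp add: image_f_inv_f)
  then show "snd (relabel \<pi> G) (inv \<pi> ` e) = snd G e"
    using image_complete_edges[OF permutes_inv[OF assms(2)] e] by (simp add: relabel_def)
qed simp

lemma relabel_in_class:
  assumes "graph_class k Q" "G \<in> Q" "\<pi> permutes {1..fst G}"
  shows "relabel \<pi> G \<in> Q"
  using assms graph_iso_relabel relabel_coloured_graph unfolding graph_class_def by blast

lemma pair_colour_relabel:
  assumes "\<pi> permutes {1..fst G}"
  shows "pair_colour d (relabel \<pi> G) u v = pair_colour d G (\<pi> u) (\<pi> v)"
proof -
  have "\<pi> u = \<pi> v \<longleftrightarrow> u = v" using permutes_inj[OF assms] by (auto dest: injD)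
  then show ?thesis using permutes_in_image[OF assms]
    by (simp add: pair_colour_def relabel_def del: atLeastAtMost_iff)
qed

text \<open>The point \<open>1\<close> lies in no block; its index \<open>n + 1\<close> is fixed by every permutation
  of \<open>{1..n}\<close>.\<close>

definition block_perm :: "nat \<Rightarrow> (nat \<Rightarrow> nat) \<Rightarrow> real \<Rightarrow> real" where
  "block_perm n \<pi> x = x + (real (\<pi> (vertex_index n x)) - real (vertex_index n x)) / real n"

lemma vertex_index_1 [simp]: "vertex_index n 1 = n + 1"
  by (simp add: vertex_index_def)

lemma block_perm_1:
  assumes "\<pi> permutes {1..n}"
  shows "block_perm n \<pi> 1 = 1"
  using permutes_not_in[OF assms, of "n + 1"] by (simp add: block_perm_def)

lemma block_perm_in_block:
  assumes "\<pi> permutes {1..n}" "u \<in> {1..n}" "x \<in> block n u"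
  shows "block_perm n \<pi> x \<in> block n (\<pi> u)"
proof -
  have pu: "\<pi> u \<in> {1..n}" using assms permutes_in_image by metis
  have n: "real n > 0" using assms by auto
  have "vertex_index n x = u" using assms by (simp add: block_def)
  then have "block_perm n \<pi> x = x + (real (\<pi> u) / n - real u / n)"
    by (simp add: block_perm_def diff_divide_distrib)
  with assms(3) show ?thesis unfolding block_eq[OF pu] block_eq[OF assms(2)]
    by (simp add: diff_divide_distrib)
qed

lemma vertex_index_block_perm:
  assumes "\<pi> permutes {1..n}" "n \<ge> 1" "x \<in> {0..1}"
  shows "vertex_index n (block_perm n \<pi> x) = \<pi> (vertex_index n x)" "block_perm n \<pi> x \<in> {0..1}"
proof -
  have "vertex_index n (block_perm n \<pi> x) = \<pi> (vertex_index n x) \<and> block_perm n \<pi> x \<in> {0..1}"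
  proof (cases "x = 1")
    case True
    then show ?thesis using block_perm_1[OF assms(1)] permutes_not_in[OF assms(1), of "n + 1"] by simp
  next
    case False
    then have "vertex_index n x \<in> {1..n}" using vertex_index_range assms by blast
    from block_perm_in_block[OF assms(1) this, of x] show ?thesis
      using assms(3) by (auto simp: block_def)
  qed
  then show "vertex_index n (block_perm n \<pi> x) = \<pi> (vertex_index n x)" "block_perm n \<pi> x \<in> {0..1}" by auto
qed

lemma block_perm_inv:
  assumes "\<pi> permutes {1..n}" "n \<ge> 1" "x \<in> {0..1}"
  shows "block_perm n (inv \<pi>) (block_perm n \<pi> x) = x"
  using vertex_index_block_perm[OF assms] permutes_inverses(2)[OF assms(1)]
  by (simp add: block_perm_def[of n "inv \<pi>"]) (simp add: block_perm_def diff_divide_distrib)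

text \<open>On each block the map is a translation onto another block. Cutting a set along the
  blocks, translation invariance of Lebesgue measure gives the pieces, and permuting the sum
  reassembles them.\<close>

lemma block_perm_mpm:
  assumes \<pi>: "\<pi> permutes {1..n}" and n: "n \<ge> 1"
  shows "block_perm n \<pi> \<in> measure_preserving_maps"
proof -
  have "(\<lambda>x. F (vertex_index n x)) \<in> borel_measurable unit_interval" for F :: "nat \<Rightarrow> real"
    by (rule measurable_compose[OF vertex_index_measurable]) simp
  from borel_measurable_add[OF unit_interval_measurable_id this[of "\<lambda>u. (real (\<pi> u) - real u) / real n"]]
  have "block_perm n \<pi> \<in> borel_measurable unit_interval"
    by (simp add: block_perm_def[abs_def])
  then have meas: "block_perm n \<pi> \<in> measurable unit_interval unit_interval"
    using vertex_index_block_perm(2)[OF \<pi> n]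
    unfolding unit_interval_def by (intro measurable_restrict_space2) (auto simp: space_restrict_space)
  \<comment> \<open>The blocks miss only the point 1, hence an equality up to a null set.\<close>
  have split: "measure unit_interval A = (\<Sum>u=1..n. measure unit_interval (A \<inter> block n u))"
    if A: "A \<in> sets unit_interval" for A
  proof -
    have "measure unit_interval A = measure unit_interval (\<Union>u\<in>{1..n}. A \<inter> block n u)"
    proof (rule unit_interval.finite_measure_eq_AE)
      have "AE x in unit_interval. x \<noteq> 1"
        by (rule AE_I'[of "{1}"]) (auto intro!: null_setsI simp: sets_unit_interval emeasure_unit_interval)
      then show "AE x in unit_interval. x \<in> A \<longleftrightarrow> x \<in> (\<Union>u\<in>{1..n}. A \<inter> block n u)"
        using AE_space
      proof eventually_elim
        case (elim x)
        then have "vertex_index n x \<in> {1..n}" using vertex_index_range n by simp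
        then show ?case using elim by (auto simp: block_def)
      qed
    qed (use A in auto)
    also have "\<dots> = (\<Sum>u=1..n. measure unit_interval (A \<inter> block n u))"
    proof (rule unit_interval.finite_measure_finite_Union)
      show "disjoint_family_on (\<lambda>u. A \<inter> block n u) {1..n}"
        by (auto simp: disjoint_family_on_def block_def)
    qed (use A in auto)
    finally show ?thesis .
  qed
  have "distr unit_interval unit_interval (block_perm n \<pi>) = unit_interval"
  proof (rule measure_eqI)
    fix A assume "A \<in> sets (distr unit_interval unit_interval (block_perm n \<pi>))"
    then have A: "A \<in> sets unit_interval" by simp
    let ?B = "block_perm n \<pi> -` A \<inter> {0..1}"
    have B: "?B \<in> sets unit_interval" using measurable_sets[OF meas A] by simp
    have "measure unit_interval (?B \<inter> block n u) = measure unit_interval (A \<inter> block n (\<pi> u))"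
      if u: "u \<in> {1..n}" for u
    proof -
      have pu: "\<pi> u \<in> {1..n}" using u permutes_in_image[OF \<pi>] by metis
      define t where "t = (real (\<pi> u) - real u) / real n"
      have bt: "x + t \<in> block n (\<pi> u) \<longleftrightarrow> x \<in> block n u" for x
        unfolding block_eq[OF u] block_eq[OF pu] t_def by (simp add: diff_divide_distrib) linarith
      have eq: "?B \<inter> block n u = (+) t -` (A \<inter> block n (\<pi> u))"
      proof (intro set_eqI iffI)
        fix x assume "x \<in> ?B \<inter> block n u"
        then have "x \<in> block n u" "block_perm n \<pi> x \<in> A" by auto
        moreover from this have "block_perm n \<pi> x = t + x" by (simp add: block_perm_def block_def t_def)
        ultimately show "x \<in> (+) t -` (A \<inter> block n (\<pi> u))" using bt[of x] by (simp add: add.commute)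
      next
        fix x assume "x \<in> (+) t -` (A \<inter> block n (\<pi> u))"
        then have "x \<in> block n u" "t + x \<in> A" using bt[of x] by (auto simp: add.commute)
        moreover from this have "block_perm n \<pi> x = t + x" by (simp add: block_perm_def block_def t_def)
        ultimately show "x \<in> ?B \<inter> block n u" by (auto simp: block_def)
      qed
      have Ab: "A \<inter> block n (\<pi> u) \<in> sets borel" "A \<inter> block n (\<pi> u) \<in> sets unit_interval"
        using A block_sets[of n "\<pi> u"] by (auto simp: sets_unit_interval)
      have "emeasure lborel ((+) t -` (A \<inter> block n (\<pi> u))) = emeasure lborel (A \<inter> block n (\<pi> u))"
        by (subst (2) lborel_distr_plus[of t, symmetric], subst emeasure_distr) (use Ab in auto)
      then have "measure lborel ((+) t -` (A \<inter> block n (\<pi> u))) = measure lborel (A \<inter> block n (\<pi> u))"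
        by (simp add: measure_def)
      moreover have "?B \<inter> block n u \<in> sets unit_interval" using B by auto
      ultimately show ?thesis using Ab eq by (simp add: measure_unit_interval)
    qed
    then have "measure unit_interval ?B = (\<Sum>u=1..n. measure unit_interval (A \<inter> block n (\<pi> u)))"
      by (subst split[OF B]) (rule sum.cong, auto)
    also have "\<dots> = (\<Sum>u=1..n. measure unit_interval (A \<inter> block n u))"
      using sum.permute[OF \<pi>, of "\<lambda>u. measure unit_interval (A \<inter> block n u)"] by (simp add: comp_def)
    also have "\<dots> = measure unit_interval A" by (rule split[OF A, symmetric])
    finally show "emeasure (distr unit_interval unit_interval (block_perm n \<pi>)) A = emeasure unit_interval A"
      using A by (simp add: emeasure_distr[OF meas] unit_interval.emeasure_eq_measure)
  qed simp
  with meas show ?thesis by (simp add: measure_preserving_maps_def)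
qed

text \<open>A relabelled step graphon agrees with the corresponding pullback only on the unit
  square, not as a function on all reals.\<close>

lemma cut_dist_cong:
  assumes "\<And>x y. x \<in> {0..1} \<Longrightarrow> y \<in> {0..1} \<Longrightarrow> U x y = U' x y"
    "\<And>x y. x \<in> {0..1} \<Longrightarrow> y \<in> {0..1} \<Longrightarrow> W x y = W' x y"
  shows "cut_dist k U W = cut_dist k U' W'"
proof -
  have "(LINT z:A|unit_square. pr U i z - pr W i z) = (LINT z:A|unit_square. pr U' i z - pr W' i z)" for A i
    unfolding set_lebesgue_integral_def
    by (rule Bochner_Integration.integral_cong) (use assms in \<open>auto simp: mem_Times_iff\<close>)
  then show ?thesis by (simp add: cut_dist_def)
qed

lemma step_graphon_relabel:
  assumes "\<pi> permutes {1..fst G}" "fst G \<ge> 1" "x \<in> {0..1}" "y \<in> {0..1}"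
  shows "step_graphon d (relabel \<pi> G) x y = pullback (step_graphon d G) (block_perm (fst G) \<pi>) x y"
  using assms vertex_index_block_perm(1)[OF assms(1,2)]
  by (simp add: step_graphon_eq pullback_def pair_colour_relabel)

text \<open>Block permutations have block permutations as inverses, so pulling back both graphons
  along one of them cannot increase the cut distance. An approximation of G thus survives any later
  relabelling of G, up to a pullback of the approximating graphon.\<close>

lemma cut_dist_relabel_pullback_le:
  assumes G: "G \<in> coloured_graphs k" "d \<in> {1..k}" "\<pi> permutes {1..fst G}" "fst G \<ge> 1"
    and W: "W \<in> graphons k"
  shows "cut_dist k (step_graphon d (relabel \<pi> G)) (pullback W (block_perm (fst G) \<pi>))
    \<le> cut_dist k (step_graphon d G) W"
proof -
  have "cut_dist k (step_graphon d (relabel \<pi> G)) (pullback W (block_perm (fst G) \<pi>)) =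
    cut_dist k (pullback (step_graphon d G) (block_perm (fst G) \<pi>)) (pullback W (block_perm (fst G) \<pi>))"
    by (rule cut_dist_cong) (use step_graphon_relabel[OF G(3,4)] in auto)
  also have "\<dots> \<le> cut_dist k (step_graphon d G) W"
    by (rule cut_dist_pullback_le[OF step_graphon_graphon[OF G(1,2)] W block_perm_mpm[OF G(3,4)]
          block_perm_mpm[OF permutes_inv[OF G(3)] G(4)] block_perm_inv[OF G(3,4)]])
  finally show ?thesis .
qed

text \<open>A common permutation may thus be applied to a whole cluster of graphs without enlarging
  its diameter.\<close>

lemma cut_dist_relabel_le:
  assumes G: "G \<in> coloured_graphs k" "d \<in> {1..k}" "\<pi> permutes {1..fst G}" "fst G \<ge> 1"
    and H: "H \<in> coloured_graphs k" "fst H = fst G"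
  shows "cut_dist k (step_graphon d (relabel \<pi> G)) (step_graphon d (relabel \<pi> H))
    \<le> cut_dist k (step_graphon d G) (step_graphon d H)"
proof -
  have "cut_dist k (step_graphon d (relabel \<pi> G)) (step_graphon d (relabel \<pi> H)) =
    cut_dist k (step_graphon d (relabel \<pi> G)) (pullback (step_graphon d H) (block_perm (fst G) \<pi>))"
    by (rule cut_dist_cong) (use step_graphon_relabel[of \<pi> H] G H in auto)
  also have "\<dots> \<le> cut_dist k (step_graphon d G) (step_graphon d H)"
    by (rule cut_dist_relabel_pullback_le[OF G step_graphon_graphon[OF H(1) G(2)]])
  finally show ?thesis .
qed

section \<open>Counting graphs of bounded cost\<close>

text \<open>This is the average of \<open>g c\<close> over the block, whose area is 1 / n^2 for
  vertices u and v.\<close>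

definition block_cost :: "(nat \<Rightarrow> real \<times> real \<Rightarrow> real) \<Rightarrow> nat \<Rightarrow> nat \<Rightarrow> nat \<Rightarrow> nat \<Rightarrow> real" where
  "block_cost g n c u v = (real n)\<^sup>2 * (LINT z:block n u \<times> block n v|unit_square. g c z)"

lemma block_cost_nonneg:
  assumes "edge_cost k g" "c \<in> {1..k}"
  shows "0 \<le> block_cost g n c u v"
proof -
  have "0 \<le> (LINT z:block n u \<times> block n v|unit_square. g c z)"
    unfolding set_lebesgue_integral_def
  proof (rule Bochner_Integration.integral_nonneg)
    fix z assume "z \<in> space unit_square"
    then have "0 \<le> g c z" using assms unfolding edge_cost_def by blast
    then show "0 \<le> indicator (block n u \<times> block n v) z *\<^sub>R g c z" by simp
  qed
  then show ?thesis by (simp add: block_cost_def)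
qed

lemma unit_square_swap:
  assumes "f \<in> borel_measurable unit_square"
  shows "(LINT z|unit_square. f (snd z, fst z)) = (LINT z|unit_square. f z :: real)"
  using unit_pair.integral_product_swap[of f] assms
  by (simp add: unit_square_def case_prod_unfold)

lemma block_cost_commute:
  assumes "edge_cost k g" "c \<in> {1..k}"
  shows "block_cost g n c u v = block_cost g n c v u"
proof -
  have "(\<lambda>z. indicator (block n v \<times> block n u) z *\<^sub>R g c z) \<in> borel_measurable unit_square"
    using assms by (intro borel_measurable_scaleR borel_measurable_indicator rect_in_unit_square block_sets)
      (auto simp: edge_cost_def)
  from unit_square_swap[OF this]
  have "(LINT z:block n v \<times> block n u|unit_square. g c z) =
      (LINT z|unit_square. indicator (block n v \<times> block n u) (snd z, fst z) *\<^sub>R g c (snd z, fst z))"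
    by (simp add: set_lebesgue_integral_def)
  also have "\<dots> = (LINT z:block n u \<times> block n v|unit_square. g c z)"
    unfolding set_lebesgue_integral_def
  proof (rule Bochner_Integration.integral_cong[OF refl])
    fix z assume "z \<in> space unit_square"
    then have "g c (snd z, fst z) = g c (fst z, snd z)"
      using assms unfolding edge_cost_def by (auto simp: mem_Times_iff)
    then show "indicator (block n v \<times> block n u) (snd z, fst z) *\<^sub>R g c (snd z, fst z) =
        indicator (block n u \<times> block n v) z *\<^sub>R g c z"
      by (auto simp: indicator_def mem_Times_iff)
  qed
  finally show ?thesis by (simp add: block_cost_def)
qed

lemma measure_block_rect:
  assumes "u \<in> {1..n}" "v \<in> {1..n}"
  shows "measure unit_square (block n u \<times> block n v) = 1 / (real n)\<^sup>2"
  unfolding measure_rect[OF block_sets block_sets] measure_block[OF assms(1)] measure_block[OF assms(2)]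
  by (simp add: power2_eq_square)

text \<open>Jensen's inequality for the convex function \<open>y \<mapsto> k\<^sup>-\<^sup>y\<close>, through its tangent
  at the mean cost.\<close>

lemma block_cost_kraft:
  assumes k: "k \<ge> 2" and g: "edge_cost k g" and uv: "u \<in> {1..n}" "v \<in> {1..n}"
  shows "(\<Sum>c=1..k. real k powr (- block_cost g n c u v)) \<le> 1"
proof -
  let ?R = "block n u \<times> block n v"
  have n: "real n > 0" using uv by auto
  have R: "?R \<in> sets unit_square" by (rule rect_in_unit_square[OF block_sets block_sets])
  have bI: "integrable unit_square (\<lambda>z. indicator ?R z *\<^sub>R f z)"
    if "integrable unit_square f" for f :: "_ \<Rightarrow> real"
    by (rule integrable_mult_indicator[OF R that])
  have c1: "(LINT z:?R|unit_square. a) = a / (real n)\<^sup>2" for a :: real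
  proof -
    have "?R \<inter> space unit_square = ?R" using sets.sets_into_space[OF R] by blast
    then show ?thesis using measure_block_rect[OF uv]
      by (simp add: set_lebesgue_integral_def del: space_unit_square)
  qed
  have pint: "integrable unit_square (\<lambda>z. real k powr (- g c z))" if c: "c \<in> {1..k}" for c
  proof (rule integrable_bounded_square[where B=1])
    show "(\<lambda>z. real k powr (- g c z)) \<in> borel_measurable unit_square"
    proof -
      have [measurable]: "g c \<in> borel_measurable unit_square" using g c by (auto simp: edge_cost_def)
      show ?thesis by measurable
    qed
    fix z assume z: "z \<in> space unit_square"
    then have "0 \<le> g c z" using g c unfolding edge_cost_def by blast
    then have "real k powr (- g c z) \<le> real k powr 0" using k by (intro powr_mono) auto
    then show "\<bar>real k powr (- g c z)\<bar> \<le> 1" using k by simp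
  qed
  have jensen: "real k powr (- block_cost g n c u v) / (real n)\<^sup>2 \<le> (LINT z:?R|unit_square. real k powr (- g c z))"
    if c: "c \<in> {1..k}" for c
  proof -
    let ?a = "block_cost g n c u v"
    have gi: "integrable unit_square (g c)" by (rule edge_cost_integrable[OF g c])
    have "real k powr (- ?a) * (1 - (y - ?a) * ln (real k)) \<le> real k powr (- y)" for y
    proof -
      have "1 + (?a - y) * ln (real k) \<le> exp ((?a - y) * ln (real k))" by (rule exp_ge_add_one_self)
      then have "real k powr (- ?a) * (1 + (?a - y) * ln (real k)) \<le> real k powr (- ?a) * real k powr (?a - y)"
        using k by (intro mult_left_mono) (auto simp: powr_def)
      also have "\<dots> = real k powr (- y)" using k by (simp add: powr_add[symmetric])
      finally show ?thesis by (simp add: algebra_simps)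
    qed
    then have "(LINT z:?R|unit_square. real k powr (- ?a) * (1 - (g c z - ?a) * ln (real k)))
        \<le> (LINT z:?R|unit_square. real k powr (- g c z))"
      unfolding set_lebesgue_integral_def
      by (intro Bochner_Integration.integral_mono bI pint c)
         (auto intro!: mult_left_mono Bochner_Integration.integrable_mult_right Bochner_Integration.integrable_diff
            Bochner_Integration.integrable_mult_left gi)
    moreover have "(LINT z:?R|unit_square. real k powr (- ?a) * (1 - (g c z - ?a) * ln (real k)))
       = real k powr (- ?a) / (real n)\<^sup>2"
    proof -
      have "(LINT z:?R|unit_square. real k powr (- ?a) * (1 - (g c z - ?a) * ln (real k))) =
        (LINT z:?R|unit_square. real k powr (- ?a) * (1 + ?a * ln (real k))) -
        (LINT z:?R|unit_square. (real k powr (- ?a) * ln (real k)) * g c z)"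
      proof -
        have "(\<lambda>z. real k powr (- ?a) * (1 - (g c z - ?a) * ln (real k))) =
          (\<lambda>z. real k powr (- ?a) * (1 + ?a * ln (real k)) - (real k powr (- ?a) * ln (real k)) * g c z)"
          by (simp add: algebra_simps)
        moreover have "set_integrable unit_square ?R (\<lambda>z. real k powr (- ?a) * (1 + ?a * ln (real k)))"
          unfolding set_integrable_def by (rule bI) simp
        moreover have "set_integrable unit_square ?R (\<lambda>z. (real k powr (- ?a) * ln (real k)) * g c z)"
          unfolding set_integrable_def by (rule bI) (use gi in auto)
        ultimately show ?thesis by (simp only: set_integral_diff(2))
      qed
      also have "\<dots> = real k powr (- ?a) * (1 + ?a * ln (real k)) / (real n)\<^sup>2 -
        (real k powr (- ?a) * ln (real k)) * (?a / (real n)\<^sup>2)"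
        using n by (subst c1) (simp add: block_cost_def)
      also have "\<dots> = real k powr (- ?a) / (real n)\<^sup>2"
        using n by (simp add: field_simps)
      finally show ?thesis .
    qed
    ultimately show ?thesis by simp
  qed
  have "(\<Sum>c=1..k. real k powr (- block_cost g n c u v) / (real n)\<^sup>2)
      \<le> (\<Sum>c=1..k. LINT z:?R|unit_square. real k powr (- g c z))"
    by (rule sum_mono) (rule jensen)
  also have "\<dots> = (LINT z:?R|unit_square. (\<Sum>c=1..k. real k powr (- g c z)))"
    unfolding set_lebesgue_integral_def scaleR_sum_right
    by (rule Bochner_Integration.integral_sum[symmetric]) (rule bI[OF pint])
  also have "\<dots> \<le> (LINT z:?R|unit_square. 1)"
    unfolding set_lebesgue_integral_def
  proof (rule Bochner_Integration.integral_mono)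
    show "integrable unit_square (\<lambda>z. indicator ?R z *\<^sub>R (\<Sum>c=1..k. real k powr (- g c z)))"
      by (rule bI) (intro Bochner_Integration.integrable_sum pint)
    show "integrable unit_square (\<lambda>z. indicator ?R z *\<^sub>R (1::real))" by (rule bI) simp
    fix z assume "z \<in> space unit_square"
    then have "(\<Sum>c=1..k. real k powr (- g c z)) \<le> 1" using g unfolding edge_cost_def by blast
    then show "indicator ?R z *\<^sub>R (\<Sum>c=1..k. real k powr (- g c z)) \<le> indicator ?R z *\<^sub>R 1"
      by (intro scaleR_left_mono) auto
  qed
  also have "\<dots> = 1 / (real n)\<^sup>2" by (rule c1)
  finally show ?thesis using n by (simp add: sum_divide_distrib[symmetric] divide_le_cancel)
qed

text \<open>An edge is an unordered pair; by \<open>block_cost_commute\<close> either order would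
  do, and \<open>Min\<close>, \<open>Max\<close> merely fix one.\<close>

definition edge_block_cost :: "(nat \<Rightarrow> real \<times> real \<Rightarrow> real) \<Rightarrow> nat \<Rightarrow> nat \<Rightarrow> nat set \<Rightarrow> real" where
  "edge_block_cost g n c e = block_cost g n c (Min e) (Max e)"

text \<open>Each edge fills two blocks, mirror images of equal cost, whence the factor 2. The
  diagonal blocks, coloured by d, are dropped because costs are nonnegative.\<close>

lemma expected_cost_step_graphon:
  assumes G: "G \<in> coloured_graphs k" "d \<in> {1..k}" "fst G = n" "n \<ge> 1" and g: "edge_cost k g"
  shows "2 * (\<Sum>e\<in>complete_edges n. edge_block_cost g n (snd G e) e)
    \<le> (real n)\<^sup>2 * expected_cost k (step_graphon d G) g"
proof -
  let ?C = "pair_colour d G" and ?b = "block_cost g n"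
  have n: "real n > 0" using G by simp
  let ?P = "{1..n} \<times> {1..n}"
  define D where "D = {(u, v) \<in> ?P. u < v}"
  have "expected_cost k (step_graphon d G) g =
    (\<Sum>c=1..k. LINT z|unit_square. pr (step_graphon d G) c z * g c z)"
    unfolding expected_cost_def
    by (rule Bochner_Integration.integral_sum) (rule pr_mult_integrable[OF step_graphon_graphon[OF G(1,2)] g])
  also have "\<dots> = (\<Sum>c=1..k. \<Sum>u=1..n. \<Sum>v=1..n. of_bool (?C u v = c) * (LINT z:block n u \<times> block n v|unit_square. g c z))"
    unfolding pr_step_graphon G(3)
    by (rule sum.cong[OF refl], rule step_fun_integral[OF G(4) edge_cost_integrable[OF g]])
  finally have "(real n)\<^sup>2 * expected_cost k (step_graphon d G) g =
      (\<Sum>c=1..k. \<Sum>u=1..n. \<Sum>v=1..n. of_bool (?C u v = c) * ?b c u v)"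
    by (simp only: sum_distrib_left block_cost_def mult.left_commute)
  also have "\<dots> = (\<Sum>u=1..n. \<Sum>v=1..n. \<Sum>c=1..k. of_bool (?C u v = c) * ?b c u v)"
    by (subst sum.swap, rule sum.cong[OF refl], rule sum.swap)
  also have "\<dots> = (\<Sum>u=1..n. \<Sum>v=1..n. ?b (?C u v) u v)"
  proof (intro sum.cong refl)
    fix u v
    have "(\<Sum>c=1..k. of_bool (?C u v = c) * ?b c u v) = (\<Sum>c=1..k. if ?C u v = c then ?b c u v else 0)"
      by (intro sum.cong) auto
    then show "(\<Sum>c=1..k. of_bool (?C u v = c) * ?b c u v) = ?b (?C u v) u v"
      using pair_colour_range[OF G(1,2), of u v] by simp
  qed
  also have "\<dots> = (\<Sum>(u,v)\<in>?P. ?b (?C u v) u v)" by (simp add: sum.cartesian_product)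
  finally have E: "(real n)\<^sup>2 * expected_cost k (step_graphon d G) g = (\<Sum>(u,v)\<in>?P. ?b (?C u v) u v)" .
  have fin: "finite ?P" by simp
  then have finD: "finite D" by (rule rev_finite_subset) (auto simp: D_def)
  have "(\<Sum>(u,v)\<in>D. ?b (?C u v) u v) + (\<Sum>(u,v)\<in>prod.swap ` D. ?b (?C u v) u v) =
      (\<Sum>(u,v)\<in>D \<union> prod.swap ` D. ?b (?C u v) u v)"
    by (rule sum.union_disjoint[symmetric]) (use finD in \<open>auto simp: D_def\<close>)
  also have "\<dots> \<le> (\<Sum>(u,v)\<in>?P. ?b (?C u v) u v)"
    by (rule sum_mono2[OF fin]) (auto simp: D_def intro!: block_cost_nonneg[OF g pair_colour_range[OF G(1,2)]])
  finally have "(\<Sum>(u,v)\<in>D. ?b (?C u v) u v) + (\<Sum>(u,v)\<in>prod.swap ` D. ?b (?C u v) u v)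
      \<le> (\<Sum>(u,v)\<in>?P. ?b (?C u v) u v)" .
  moreover have "(\<Sum>(u,v)\<in>prod.swap ` D. ?b (?C u v) u v) = (\<Sum>(u,v)\<in>D. ?b (?C u v) u v)"
    by (subst sum.reindex)
       (auto intro!: sum.cong simp: pair_colour_commute[of d G] block_cost_commute[OF g pair_colour_range[OF G(1,2)]]
          inj_on_def)
  moreover have "(\<Sum>(u,v)\<in>D. ?b (?C u v) u v) = (\<Sum>e\<in>complete_edges n. edge_block_cost g n (snd G e) e)"
  proof (rule sum.reindex_bij_witness[where i="\<lambda>e. (Min e, Max e)" and j="\<lambda>(u,v). {u,v}"])
    fix e assume "e \<in> complete_edges n"
    then obtain u v where "e = {u, v}" "u < v" "u \<in> {1..n}" "v \<in> {1..n}" by (rule complete_edgesE)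
    then show "(case (Min e, Max e) of (u, v) \<Rightarrow> {u, v}) = e" "(Min e, Max e) \<in> D" by (auto simp: D_def)
  qed (auto simp: D_def edge_block_cost_def pair_colour_def G(3))
  ultimately show ?thesis using E by simp
qed

text \<open>A colouring gets the product of its edge weights. These products sum to at most 1 over
  all colourings, while every member of A has weight at least k^(- t n^2 / 2), because its edges
  cost at most half of t n^2.\<close>

lemma card_low_cost_graphs:
  assumes k: "k \<ge> 2" and d: "d \<in> {1..k}" and n: "n \<ge> 1" and g: "edge_cost k g"
    and A: "A \<subseteq> {G \<in> coloured_graphs k. fst G = n}"
    and t: "\<And>G. G \<in> A \<Longrightarrow> expected_cost k (step_graphon d G) g \<le> t"
  shows "real (card A) \<le> real k powr (t * (real n)\<^sup>2 / 2)"
proof -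
  let ?E = "complete_edges n"
  let ?T = "t * (real n)\<^sup>2 / 2"
  let ?w = "\<lambda>f. \<Prod>e\<in>?E. real k powr (- edge_block_cost g n (f e) e)"
  have "real (card A) = real (card (snd ` A))"
  proof -
    \<comment> \<open>All members of A have order n, so the colouring determines the graph.\<close>
    have "inj_on snd A" by (intro inj_onI prod_eqI) (use A in auto)
    then show ?thesis by (simp add: card_image)
  qed
  have sub: "snd ` A \<subseteq> ?E \<rightarrow>\<^sub>E {1..k}"
  proof
    fix f assume "f \<in> snd ` A"
    then obtain G where "G \<in> coloured_graphs k" "fst G = n" "f = snd G" using A by blast
    then show "f \<in> ?E \<rightarrow>\<^sub>E {1..k}" by (cases G) (simp add: coloured_graphs_def)
  qed
  have fin: "finite (?E \<rightarrow>\<^sub>E {1..k})" by (intro finite_PiE) auto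
  have low: "real k powr (- ?T) \<le> ?w (snd G)" if "G \<in> A" for G
  proof -
    have "2 * (\<Sum>e\<in>?E. edge_block_cost g n (snd G e) e) \<le> (real n)\<^sup>2 * expected_cost k (step_graphon d G) g"
      by (rule expected_cost_step_graphon) (use A that d n g in auto)
    also have "\<dots> \<le> (real n)\<^sup>2 * t" by (intro mult_left_mono t that) auto
    finally have "- ?T \<le> (\<Sum>e\<in>?E. - edge_block_cost g n (snd G e) e)" by (simp add: sum_negf mult.commute)
    then have "real k powr (- ?T) \<le> real k powr (\<Sum>e\<in>?E. - edge_block_cost g n (snd G e) e)"
      using k by (intro powr_mono) auto
    also have "\<dots> = ?w (snd G)" using k by (subst powr_sum) auto
    finally show ?thesis .
  qed
  have "real (card (snd ` A)) * real k powr (- ?T) = (\<Sum>f\<in>snd ` A. real k powr (- ?T))" by simp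
  also have "\<dots> \<le> (\<Sum>f\<in>snd ` A. ?w f)" by (rule sum_mono) (use low in auto)
  also have "\<dots> \<le> (\<Sum>f\<in>?E \<rightarrow>\<^sub>E {1..k}. ?w f)"
    by (rule sum_mono2[OF fin sub]) (auto intro: prod_nonneg)
  \<comment> \<open>Independence of the edges: the sum over all colourings factorises, and each
    factor is bounded by Kraft's inequality for the averaged costs.\<close>
  also have "\<dots> = (\<Prod>e\<in>?E. \<Sum>c=1..k. real k powr (- edge_block_cost g n c e))"
    by (subst prod_sum_PiE) auto
  also have "\<dots> \<le> (\<Prod>e\<in>?E. 1)"
  proof (rule prod_mono, intro conjI)
    fix e assume e: "e \<in> ?E"
    then obtain u v where "e = {u, v}" "u < v" "u \<in> {1..n}" "v \<in> {1..n}" by (rule complete_edgesE)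
    then show "(\<Sum>c=1..k. real k powr (- edge_block_cost g n c e)) \<le> 1"
      using block_cost_kraft[OF k g, of u n v] by (auto simp: edge_block_cost_def)
  qed (auto intro: sum_nonneg)
  finally have "real (card (snd ` A)) * real k powr (- ?T) \<le> 1" by simp
  with \<open>real (card A) = _\<close> show ?thesis using k by (simp add: powr_minus field_simps)
qed

text \<open>Half of e pays for the near-optimal cost of \<open>W\<close>, half for the passage from
  \<open>W\<close> to a nearby graph. The exponent contains n^2 / 2 instead of the number of edges;
  the linear difference is absorbed when n is large, in \<open>growth_gives_limit\<close>.\<close>

lemma card_graphs_near_graphon:
  assumes k: "k \<ge> 2" and d: "d \<in> {1..k}" and W: "W \<in> graphons k" and e: "e > 0"
  obtains \<delta> where "\<delta> > 0" "\<And>n A. n \<ge> 1 \<Longrightarrow> A \<subseteq> {G \<in> coloured_graphs k. fst G = n} \<Longrightarrow>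
    (\<And>G. G \<in> A \<Longrightarrow> cut_dist k (step_graphon d G) W < \<delta>) \<Longrightarrow>
    real (card A) \<le> real k powr ((graphon_entropy k W + e) * (real n)\<^sup>2 / 2)"
proof -
  have e2: "e / 2 > 0" and k1: "k \<ge> 1" using e k by auto
  obtain g where g: "edge_cost k g" "expected_cost k W g \<le> graphon_entropy k W + e / 2"
    by (rule near_optimal_cost[OF k W e2])
  obtain \<delta> where \<delta>: "\<delta> > 0" "\<And>U V \<phi>. U \<in> graphons k \<Longrightarrow> V \<in> graphons k \<Longrightarrow>
    \<phi> \<in> measure_preserving_maps \<Longrightarrow> cut_dist k U V < \<delta> \<Longrightarrow>
    expected_cost k U (\<lambda>c z. g c (square_map \<phi> z)) \<le> expected_cost k V (\<lambda>c z. g c (square_map \<phi> z)) + e / 2"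
    by (rule expected_cost_close[OF k1 g(1) e2]) blast
  show thesis
  proof (rule that[OF \<delta>(1)])
    fix n A assume n: "n \<ge> 1" and A: "A \<subseteq> {G \<in> coloured_graphs k. fst G = n}"
      and cd: "\<And>G. G \<in> A \<Longrightarrow> cut_dist k (step_graphon d G) W < \<delta>"
    show "real (card A) \<le> real k powr ((graphon_entropy k W + e) * (real n)\<^sup>2 / 2)"
    proof (rule card_low_cost_graphs[OF k d n g(1) A])
      fix G assume G: "G \<in> A"
      have "expected_cost k (step_graphon d G) g \<le> expected_cost k W g + e / 2"
        using \<delta>(2)[OF step_graphon_graphon W id_mpm cd[OF G]] A G d
        by (auto simp: square_map_def)
      with g(2) show "expected_cost k (step_graphon d G) g \<le> graphon_entropy k W + e" by simp
    qed
  qed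
qed

section \<open>Weak limits along an ultrafilter\<close>

lemma compact_unit_cube:
  "compact (PiE UNIV (\<lambda>_. {0..1}) :: ('i \<Rightarrow> real) set)"
proof -
  have "compactin (product_topology (\<lambda>_. euclidean) UNIV) (PiE UNIV (\<lambda>_::'i. {0..1::real}))"
    by (subst compactin_PiE) auto
  then show ?thesis by (simp only: euclidean_product_topology compactin_euclidean_iff)
qed

text \<open>A substitute for a free ultrafilter that demands only what is used: bounded real
  sequences converge along \<open>F\<close>, and every tail of the naturals is eventually reached.
  Countably many limits can then be taken at once.\<close>

definition limit_filter :: "nat filter \<Rightarrow> bool" where
  "limit_filter F \<longleftrightarrow> F \<noteq> bot \<and> F \<le> sequentially \<and>
     (\<forall>(f :: nat \<Rightarrow> real) B. (\<forall>j. \<bar>f j\<bar> \<le> B) \<longrightarrow> (\<exists>l. (f \<longlongrightarrow> l) F))"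

lemma limit_filter_convergent:
  assumes "limit_filter F" "\<And>j. \<bar>f j\<bar> \<le> (B :: real)"
  obtains l where "(f \<longlongrightarrow> l) F"
  using assms unfolding limit_filter_def by blast

lemma limit_filter_not_bot: "limit_filter F \<Longrightarrow> F \<noteq> bot"
  by (simp add: limit_filter_def)

text \<open>By Tychonoff's theorem, the sequence of evaluations has a cluster point in the cube indexed
  by all bounded sequences; the filter below is the trace of its neighbourhoods.\<close>

lemma exists_limit_filter:
  obtains F where "limit_filter F"
proof -
  \<comment> \<open>Clamping places every evaluation in the unit cube, even at unbounded sequences;
    sequences with values in [0, 1] are unaffected.\<close>
  define e :: "nat \<Rightarrow> (nat \<Rightarrow> real) \<Rightarrow> real" where "e j f = max 0 (min 1 (f j))" for j f
  let ?K = "PiE UNIV (\<lambda>_. {0..1}) :: ((nat \<Rightarrow> real) \<Rightarrow> real) set"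
  have "eventually (\<lambda>x. x \<in> ?K) (filtermap e sequentially)"
  proof -
    have "e j \<in> ?K" for j by (auto simp: e_def PiE_iff)
    then show ?thesis by (simp add: eventually_filtermap)
  qed
  moreover have "filtermap e sequentially \<noteq> bot" by (simp add: filtermap_bot_iff)
  ultimately obtain x where x: "inf (nhds x) (filtermap e sequentially) \<noteq> bot"
    using compact_unit_cube unfolding compact_filter by blast
  define F where "F = inf sequentially (filtercomap e (nhds x))"
  have "F \<noteq> bot"
  proof
    assume "F = bot"
    then have "eventually (\<lambda>_. False) F" by simp
    then obtain P Q where P: "eventually P sequentially" and Q: "eventually Q (filtercomap e (nhds x))"
      and PQ: "\<And>j. P j \<Longrightarrow> Q j \<Longrightarrow> False"
      unfolding F_def eventually_inf by auto
    from Q obtain R where R: "eventually R (nhds x)" "\<And>j. R (e j) \<Longrightarrow> Q j"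
      unfolding eventually_filtercomap by auto
    have "eventually (\<lambda>y. \<not> R y) (filtermap e sequentially)"
      unfolding eventually_filtermap using P by eventually_elim (use PQ R in blast)
    with R(1) have "eventually (\<lambda>_. False) (inf (nhds x) (filtermap e sequentially))"
      unfolding eventually_inf by blast
    with x show False by (simp add: trivial_limit_def)
  qed
  moreover have "F \<le> sequentially" by (simp add: F_def)
  moreover have "\<exists>l. (f \<longlongrightarrow> l) F" if f: "\<forall>j. \<bar>f j\<bar> \<le> B" for f :: "nat \<Rightarrow> real" and B
  proof -
    have "filtermap e F \<le> filtermap e (filtercomap e (nhds x))"
      by (rule filtermap_mono) (simp add: F_def)
    also have "\<dots> \<le> nhds x" by (rule filtermap_filtercomap)
    finally have lim: "(e \<longlongrightarrow> x) F" by (simp add: filterlim_def)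
    have lim': "((\<lambda>j. e j g) \<longlongrightarrow> x g) F" for g
      using continuous_on_product_coordinates[of g, where 'b=real] lim
      by (rule continuous_on_tendsto_compose) auto
    define B' where "B' = \<bar>B\<bar> + 1"
    have B': "B' > 0" "\<And>j. \<bar>f j\<bar> \<le> B'" using f by (auto simp: B'_def intro: order_trans)
    \<comment> \<open>An affine image of f with values in [0, 1], where clamping does nothing; the
      limit of f is recovered by the inverse affine map.\<close>
    let ?g = "\<lambda>j. (f j / B' + 1) / 2"
    have "e j ?g = ?g j" for j
    proof -
      have "\<bar>f j / B'\<bar> \<le> 1" using B'(2)[of j] B'(1) by simp
      then have "- 1 \<le> f j / B'" "f j / B' \<le> 1" by (auto simp only: abs_le_iff)
      then show ?thesis by (simp add: e_def)
    qed
    then have "(\<lambda>j. e j ?g) = ?g" by (rule ext)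
    with lim'[of ?g] have "(?g \<longlongrightarrow> x ?g) F" by (simp only:)
    then have "((\<lambda>j. (2 * ?g j - 1) * B') \<longlongrightarrow> (2 * x ?g - 1) * B') F" by (intro tendsto_intros)
    moreover have "(2 * ?g j - 1) * B' = f j" for j using B'(1) by (simp add: field_simps)
    ultimately show ?thesis by auto
  qed
  ultimately show thesis using that unfolding limit_filter_def by blast
qed

text \<open>The limits \<nu> of the set integrals are finitely additive, and 0 \<le> f \<le> 1 makes
  them dominated by the measure \<open>M\<close>. This domination gives continuity at the empty set,
  hence countable additivity, and also absolute continuity.\<close>

lemma (in finite_measure) weak_limit_density:
  fixes f :: "nat \<Rightarrow> 'a \<Rightarrow> real"
  assumes lf: "limit_filter F"
    and meas [measurable]: "\<And>j. f j \<in> borel_measurable M"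
    and bd: "\<And>j x. x \<in> space M \<Longrightarrow> 0 \<le> f j x" "\<And>j x. x \<in> space M \<Longrightarrow> f j x \<le> 1"
  obtains w where "integrable M w" "\<And>x. 0 \<le> w x"
    "\<And>A. A \<in> sets M \<Longrightarrow> ((\<lambda>j. LINT x:A|M. f j x) \<longlongrightarrow> (LINT x:A|M. w x)) F"
proof -
  note F = limit_filter_not_bot[OF lf]
  define \<nu> where "\<nu> A = Lim F (\<lambda>j. LINT x:A|M. f j x)" for A
  have int: "integrable M (f j)" for j
    by (rule integrable_const_bound[of _ 1]) (use bd in auto)
  have sint: "set_integrable M A (f j)" if "A \<in> sets M" for A j
    unfolding set_integrable_def by (rule integrable_mult_indicator[OF that int])
  have nonneg: "0 \<le> (LINT x:A|M. f j x)" for A j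
    unfolding set_lebesgue_integral_def by (rule Bochner_Integration.integral_nonneg) (use bd in auto)
  have le: "(LINT x:A|M. f j x) \<le> measure M A" if A: "A \<in> sets M" for A j
  proof -
    have "(LINT x:A|M. f j x) \<le> (LINT x|M. indicator A x)"
      unfolding set_lebesgue_integral_def
    proof (rule Bochner_Integration.integral_mono)
      show "integrable M (\<lambda>x. indicator A x *\<^sub>R f j x)" by (rule integrable_mult_indicator[OF A int])
      show "integrable M (indicator A :: _ \<Rightarrow> real)" using A by (simp add: emeasure_eq_measure)
    qed (use bd in \<open>auto simp: indicator_def\<close>)
    moreover have "A \<inter> space M = A" using sets.sets_into_space[OF A] by blast
    ultimately show ?thesis by simp
  qed
  have \<nu>: "((\<lambda>j. LINT x:A|M. f j x) \<longlongrightarrow> \<nu> A) F" if A: "A \<in> sets M" for A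
  proof -
    have "\<bar>LINT x:A|M. f j x\<bar> \<le> measure M A" for j using nonneg[of A j] le[OF A, of j] by simp
    then obtain l where l: "((\<lambda>j. LINT x:A|M. f j x) \<longlongrightarrow> l) F"
      by (rule limit_filter_convergent[OF lf])
    then show ?thesis using tendsto_Lim[OF F l] by (simp add: \<nu>_def)
  qed
  have \<nu>_nonneg: "0 \<le> \<nu> A" if "A \<in> sets M" for A
    by (rule tendsto_lowerbound[OF \<nu>[OF that] _ F]) (use nonneg in auto)
  have \<nu>_le: "\<nu> A \<le> measure M A" if "A \<in> sets M" for A
    by (rule tendsto_upperbound[OF \<nu>[OF that] _ F]) (use le[OF that] in auto)
  have \<nu>_Un: "\<nu> (A \<union> B) = \<nu> A + \<nu> B" if A: "A \<in> sets M" "B \<in> sets M" "A \<inter> B = {}" for A B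
  proof -
    have "(\<lambda>j. LINT x:A \<union> B|M. f j x) = (\<lambda>j. (LINT x:A|M. f j x) + (LINT x:B|M. f j x))"
      by (rule ext, rule set_integral_Un) (use A sint in auto)
    then have "((\<lambda>j. LINT x:A \<union> B|M. f j x) \<longlongrightarrow> \<nu> A + \<nu> B) F"
      using tendsto_add[OF \<nu>[OF A(1)] \<nu>[OF A(2)]] by simp
    then show ?thesis using \<nu>[of "A \<union> B"] A tendsto_unique[OF F] by blast
  qed
  define N where "N = measure_of (space M) (sets M) (\<lambda>A. ennreal (\<nu> A))"
  have pos: "positive (sets M) (\<lambda>A. ennreal (\<nu> A))"
    using \<nu>_le[of "{}"] \<nu>_nonneg[of "{}"] by (simp add: positive_def)
  have "countably_additive (sets M) (\<lambda>A. ennreal (\<nu> A))"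
  proof (rule sets.empty_continuous_imp_countably_additive[OF pos])
    show "additive (sets M) (\<lambda>A. ennreal (\<nu> A))"
      by (auto simp: additive_def \<nu>_Un ennreal_plus \<nu>_nonneg)
    fix A :: "nat \<Rightarrow> 'a set" assume A: "range A \<subseteq> sets M" "decseq A" "(\<Inter>i. A i) = {}"
    have "(\<lambda>i. measure M (A i)) \<longlonglongrightarrow> 0"
      using finite_Lim_measure_decseq[OF A(1,2)] A(3) by simp
    then have "(\<lambda>i. \<nu> (A i)) \<longlonglongrightarrow> 0"
      by (rule tendsto_sandwich[rotated 3, of _ 0 sequentially "\<lambda>_. 0"])
         (use A(1) \<nu>_le \<nu>_nonneg in auto)
    then show "(\<lambda>i. ennreal (\<nu> (A i))) \<longlonglongrightarrow> 0"
      using tendsto_ennrealI by fastforce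
  qed auto
  then have emN: "emeasure N A = ennreal (\<nu> A)" if "A \<in> sets M" for A
    unfolding N_def by (rule emeasure_measure_of_sigma[OF sets.sigma_algebra_axioms pos _ that])
  have sN: "sets N = sets M" "space N = space M" by (simp_all add: N_def)
  have "absolutely_continuous M N"
    unfolding absolutely_continuous_def
  proof
    fix A assume "A \<in> null_sets M"
    then have "A \<in> sets M" "measure M A = 0" by (auto simp: null_sets_def measure_def)
    then show "A \<in> null_sets N" using emN \<nu>_le[of A] \<nu>_nonneg[of A] sN by (auto simp: null_sets_def)
  qed
  then obtain h where h [measurable]: "h \<in> borel_measurable M" and hN: "density M h = N"
    using Radon_Nikodym sN by blast
  have hA: "(\<integral>\<^sup>+x. h x * indicator A x \<partial>M) = ennreal (\<nu> A)" if "A \<in> sets M" for A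
    using emN[OF that] emeasure_density[OF h that] hN by simp
  have "(\<integral>\<^sup>+x. h x \<partial>M) = (\<integral>\<^sup>+x. h x * indicator (space M) x \<partial>M)"
    by (rule nn_integral_cong) simp
  then have "(\<integral>\<^sup>+x. h x \<partial>M) \<noteq> \<infinity>" using hA[of "space M"] by simp
  then have fin: "AE x in M. h x \<noteq> \<infinity>" by (rule nn_integral_PInf_AE[OF h])
  define w where "w x = enn2real (h x)" for x
  have w [measurable]: "w \<in> borel_measurable M" unfolding w_def by measurable
  have wA: "(\<integral>\<^sup>+x. ennreal (indicator A x *\<^sub>R w x) \<partial>M) = ennreal (\<nu> A)" if A: "A \<in> sets M" for A
  proof -
    have "(\<integral>\<^sup>+x. ennreal (indicator A x *\<^sub>R w x) \<partial>M) = (\<integral>\<^sup>+x. h x * indicator A x \<partial>M)"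
    proof (rule nn_integral_cong_AE)
      \<comment> \<open>\<open>enn2real\<close> alters h only where it is infinite, on a null
        set.\<close>
      show "AE x in M. ennreal (indicator A x *\<^sub>R w x) = h x * indicator A x"
        using fin by eventually_elim (auto simp: indicator_def w_def less_top)
    qed
    then show ?thesis using hA[OF A] by simp
  qed
  show thesis
  proof
    show "0 \<le> w x" for x by (simp add: w_def)
    show "integrable M w"
    proof (rule integrableI_nonneg)
      have "(\<integral>\<^sup>+x. ennreal (w x) \<partial>M) = (\<integral>\<^sup>+x. ennreal (indicator (space M) x *\<^sub>R w x) \<partial>M)"
        by (rule nn_integral_cong) simp
      then show "(\<integral>\<^sup>+x. ennreal (w x) \<partial>M) < \<infinity>" using wA[of "space M"] by simp
    qed (auto simp: w_def)
    fix A assume A: "A \<in> sets M"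
    have "(LINT x:A|M. w x) = enn2real (\<integral>\<^sup>+x. ennreal (indicator A x *\<^sub>R w x) \<partial>M)"
      unfolding set_lebesgue_integral_def
      by (rule integral_eq_nn_integral) (use A in \<open>auto simp: w_def\<close>)
    then have "(LINT x:A|M. w x) = \<nu> A" using wA[OF A] \<nu>_nonneg[OF A] by simp
    then show "((\<lambda>j. LINT x:A|M. f j x) \<longlongrightarrow> (LINT x:A|M. w x)) F" using \<nu>[OF A] by simp
  qed
qed

lemma set_integral_swap:
  assumes f: "f \<in> borel_measurable unit_square" and S: "S \<in> sets unit_interval" "T \<in> sets unit_interval"
  shows "(LINT z:S \<times> T|unit_square. f (snd z, fst z)) = (LINT z:T \<times> S|unit_square. f z :: real)"
proof -
  have "(\<lambda>z. indicator (T \<times> S) z *\<^sub>R f z) \<in> borel_measurable unit_square"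
    using f rect_in_unit_square[OF S(2,1)] by measurable
  from unit_square_swap[OF this] show ?thesis
    unfolding set_lebesgue_integral_def
    by (rule trans[rotated])
       (rule Bochner_Integration.integral_cong, auto simp: indicator_def)
qed

text \<open>A graphon needs a probability distribution at every point, whereas limiting densities
  sum to 1 only almost everywhere. On the exceptional set colour 1 is used, which is a valid colour
  as k \<ge> 1. That set is symmetric since p is, so the graphon stays symmetric.\<close>

lemma graphon_of_densities:
  fixes p :: "nat \<Rightarrow> real \<times> real \<Rightarrow> real"
  assumes k: "k \<ge> 1" and p: "\<And>c. p c \<in> borel_measurable unit_square" "\<And>c z. 0 \<le> p c z"
    and sym: "\<And>c x y. p c (x, y) = p c (y, x)"
    and sum: "AE z in unit_square. (\<Sum>c=1..k. p c z) = 1"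
  obtains W where "W \<in> graphons k" "AE z in unit_square. \<forall>c\<in>{1..k}. pr W c z = p c z"
proof -
  define W :: graphon where "W x y = (if (\<Sum>c=1..k. p c (x, y)) = 1
    then embed_pmf (\<lambda>c. if c \<in> {1..k} then p c (x, y) else 0) else return_pmf 1)" for x y
  have pW: "pmf (W x y) c = (if c \<in> {1..k} then p c (x, y) else 0)" if "(\<Sum>c=1..k. p c (x, y)) = 1" for x y c
  proof -
    have "(\<integral>\<^sup>+c. ennreal (if c \<in> {1..k} then p c (x, y) else 0) \<partial>count_space UNIV) =
        (\<Sum>c=1..k. ennreal (p c (x, y)))"
      by (subst nn_integral_count_space'[of "{1..k}"]) (auto simp: p)
    also have "\<dots> = 1" using that by (simp add: sum_ennreal p)
    finally show ?thesis unfolding W_def if_P[OF that] by (intro pmf_embed_pmf) (auto simp: p)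
  qed
  have pW': "pmf (W x y) c = (if (\<Sum>c=1..k. p c (x, y)) = 1 then (if c \<in> {1..k} then p c (x, y) else 0)
      else of_bool (c = 1))" for x y c
    using pW[of x y c] by (auto simp: W_def pmf_return indicator_def)
  show thesis
  proof
    show "W \<in> graphons k"
      unfolding graphons_def
    proof (intro CollectI conjI ballI)
      fix x y :: real
      show "W x y = W y x" unfolding W_def sym[of _ x y] by (rule refl)
      show "set_pmf (W x y) \<subseteq> {1..k}"
        using k by (auto simp: set_pmf_iff pW' split: if_splits)
    next
      fix i assume i: "i \<in> {1..k}"
      have [measurable]: "p c \<in> borel_measurable unit_square" for c by (rule p)
      have "(\<lambda>(x, y). pmf (W x y) i) = (\<lambda>z. if (\<Sum>c=1..k. p c z) = 1 then p i z else of_bool (i = 1))"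
        using i by (auto simp: pW' fun_eq_iff)
      also have "\<dots> \<in> borel_measurable unit_square" by measurable
      finally show "(\<lambda>(x, y). pmf (W x y) i) \<in> borel_measurable unit_square" .
    qed
    show "AE z in unit_square. \<forall>c\<in>{1..k}. pr W c z = p c z"
      using sum by eventually_elim (auto simp: pW')
  qed
qed

text \<open>The densities of the k colours are found separately. That they sum to 1 follows since
  the sum has the same integral as 1 over every set. They are symmetrised by averaging, which keeps
  the limits on rectangles because the approximating graphons are themselves symmetric.\<close>

lemma graphon_weak_limit:
  assumes k: "k \<ge> 1" and lf: "limit_filter F"
    and V: "\<And>j. V j \<in> graphons k"
  obtains W where "W \<in> graphons k"
    "\<And>c S T. c \<in> {1..k} \<Longrightarrow> S \<in> sets unit_interval \<Longrightarrow> T \<in> sets unit_interval \<Longrightarrow>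
      ((\<lambda>j. LINT z:S \<times> T|unit_square. pr (V j) c z) \<longlongrightarrow> (LINT z:S \<times> T|unit_square. pr W c z)) F"
proof -
  note F = limit_filter_not_bot[OF lf]
  have "\<exists>w. \<forall>c\<in>{1..k}. integrable unit_square (w c) \<and> (\<forall>x. 0 \<le> w c x) \<and> (\<forall>A\<in>sets unit_square.
      ((\<lambda>j. LINT x:A|unit_square. pr (V j) c x) \<longlongrightarrow> (LINT x:A|unit_square. w c x)) F)"
  proof (intro bchoice ballI)
    fix c assume c: "c \<in> {1..k}"
    show "\<exists>w. integrable unit_square w \<and> (\<forall>x. 0 \<le> w x) \<and> (\<forall>A\<in>sets unit_square.
      ((\<lambda>j. LINT x:A|unit_square. pr (V j) c x) \<longlongrightarrow> (LINT x:A|unit_square. w x)) F)"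
      by (rule unit_square.weak_limit_density[OF lf, of "\<lambda>j. pr (V j) c"])
         (use pr_measurable[OF V c] in \<open>auto simp: pmf_le_1\<close>)
  qed
  then obtain w where W: "\<forall>c\<in>{1..k}. integrable unit_square (w c) \<and> (\<forall>x. 0 \<le> w c x) \<and> (\<forall>A\<in>sets unit_square.
      ((\<lambda>j. LINT x:A|unit_square. pr (V j) c x) \<longlongrightarrow> (LINT x:A|unit_square. w c x)) F)" ..
  have w: "integrable unit_square (w c)" "0 \<le> w c x"
    "A \<in> sets unit_square \<Longrightarrow>
      ((\<lambda>j. LINT x:A|unit_square. pr (V j) c x) \<longlongrightarrow> (LINT x:A|unit_square. w c x)) F"
    if "c \<in> {1..k}" for c x A
    using bspec[OF W that] by blast+
  define p where "p c z = (if c \<in> {1..k} then (w c z + w c (snd z, fst z)) / 2 else 0)" for c and z :: "real \<times> real"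
  have swap_meas: "(\<lambda>z. (snd z, fst z)) \<in> measurable unit_square unit_square"
    unfolding unit_square_def by measurable
  have wm: "w c \<in> borel_measurable unit_square" if "c \<in> {1..k}" for c using w(1)[OF that] by simp
  have wsm: "(\<lambda>z. w c (snd z, fst z)) \<in> borel_measurable unit_square" if "c \<in> {1..k}" for c
    by (rule measurable_compose[OF swap_meas wm[OF that]])
  have wsi: "integrable unit_square (\<lambda>z. w c (snd z, fst z))" if "c \<in> {1..k}" for c
    using unit_pair.integrable_product_swap[of "w c"] w(1)[OF that]
    by (simp add: unit_square_def case_prod_unfold)
  have pm: "p c \<in> borel_measurable unit_square" for c
    using wm[of c] wsm[of c] by (cases "c \<in> {1..k}") (auto simp: p_def[abs_def])
  have pr_set: "set_integrable unit_square A (pr (V j) c)" if "A \<in> sets unit_square" "c \<in> {1..k}" for A j c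
    unfolding set_integrable_def by (rule integrable_mult_indicator[OF that(1) pr_integrable[OF V that(2)]])
  have w_set: "set_integrable unit_square A (w c)" if "A \<in> sets unit_square" "c \<in> {1..k}" for A c
    unfolding set_integrable_def by (rule integrable_mult_indicator[OF that(1) w(1)[OF that(2)]])
  have "AE z in unit_square. (\<Sum>c=1..k. w c z) = 1"
  proof (rule density_unique_real)
    show "integrable unit_square (\<lambda>z. \<Sum>c=1..k. w c z)" using w(1) by auto
    show "integrable unit_square (\<lambda>z. 1 :: real)" by simp
    fix A assume A: "A \<in> sets unit_square"
    have "((\<lambda>j. \<Sum>c=1..k. LINT x:A|unit_square. pr (V j) c x) \<longlongrightarrow> (\<Sum>c=1..k. LINT x:A|unit_square. w c x)) F"
      by (intro tendsto_sum w(3) A)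
    moreover have "(\<Sum>c=1..k. LINT x:A|unit_square. pr (V j) c x) = (LINT x:A|unit_square. 1)" for j
    proof -
      have "(\<Sum>c=1..k. LINT x:A|unit_square. pr (V j) c x) = (LINT x:A|unit_square. (\<Sum>c=1..k. pr (V j) c x))"
        unfolding set_lebesgue_integral_def scaleR_sum_right
        by (rule Bochner_Integration.integral_sum[symmetric])
           (rule integrable_mult_indicator[OF A pr_integrable[OF V]])
      also have "\<dots> = (LINT x:A|unit_square. 1)"
        unfolding set_lebesgue_integral_def
        by (rule Bochner_Integration.integral_cong) (simp_all only: sum_pr[OF V])
      finally show ?thesis .
    qed
    ultimately have "(\<Sum>c=1..k. LINT x:A|unit_square. w c x) = (LINT x:A|unit_square. 1)"
      using tendsto_unique[OF F _ tendsto_const] by simp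
    moreover have "(\<Sum>c=1..k. LINT x:A|unit_square. w c x) = (LINT x:A|unit_square. (\<Sum>c=1..k. w c x))"
      unfolding set_lebesgue_integral_def scaleR_sum_right
      by (rule Bochner_Integration.integral_sum[symmetric]) (rule integrable_mult_indicator[OF A w(1)])
    ultimately show "(LINT x:A|unit_square. (\<Sum>c=1..k. w c x)) = (LINT x:A|unit_square. 1)" by simp
  qed
  then have AE1: "AE z in unit_square. (\<Sum>c=1..k. w c z) = 1" .
  have "distr unit_square unit_square (\<lambda>z. (snd z, fst z)) = unit_square"
    using unit_pair.distr_pair_swap by (simp add: unit_square_def case_prod_unfold)
  then have "AE z in distr unit_square unit_square (\<lambda>z. (snd z, fst z)). (\<Sum>c=1..k. w c z) = 1"
    using AE1 by (simp only:)
  then have AE2: "AE z in unit_square. (\<Sum>c=1..k. w c (snd z, fst z)) = 1"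
    by (rule AE_distrD[OF swap_meas])
  have "AE z in unit_square. (\<Sum>c=1..k. p c z) = 1"
    using AE1 AE2
  proof eventually_elim
    case (elim z)
    have "(\<Sum>c=1..k. p c z) = (\<Sum>c=1..k. w c z / 2 + w c (snd z, fst z) / 2)"
      by (rule sum.cong) (auto simp: p_def add_divide_distrib)
    also have "\<dots> = 1" using elim by (simp add: sum.distrib sum_divide_distrib[symmetric])
    finally show ?case .
  qed
  then obtain W where W: "W \<in> graphons k" "AE z in unit_square. \<forall>c\<in>{1..k}. pr W c z = p c z"
    by (rule graphon_of_densities[OF k pm, rotated 2]) (use w(2) in \<open>auto simp: p_def add.commute\<close>)
  show thesis
  proof (rule that[OF W(1)])
    fix c S T assume c: "c \<in> {1..k}" and S: "S \<in> sets unit_interval" "T \<in> sets unit_interval"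
    have ST: "S \<times> T \<in> sets unit_square" "T \<times> S \<in> sets unit_square" using S by auto
    have 1: "(LINT z:S \<times> T|unit_square. pr W c z) =
      ((LINT z:S \<times> T|unit_square. w c z) + (LINT z:T \<times> S|unit_square. w c z)) / 2"
    proof -
      have "(LINT z:S \<times> T|unit_square. pr W c z) = (LINT z:S \<times> T|unit_square. p c z)"
        unfolding set_lebesgue_integral_def
      proof (rule integral_cong_AE)
        show "AE z in unit_square. indicator (S \<times> T) z *\<^sub>R pr W c z = indicator (S \<times> T) z *\<^sub>R p c z"
          using W(2) by eventually_elim (use c in auto)
      qed (use ST pr_measurable[OF W(1) c] pm[of c] in measurable)
      also have "\<dots> = (LINT z:S \<times> T|unit_square. w c z / 2) + (LINT z:S \<times> T|unit_square. w c (snd z, fst z) / 2)"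
      proof -
        have "p c = (\<lambda>z. w c z / 2 + w c (snd z, fst z) / 2)"
          using c by (auto simp: p_def fun_eq_iff add_divide_distrib)
        moreover have "set_integrable unit_square (S \<times> T) (\<lambda>z. w c z / 2)"
          unfolding set_integrable_def by (rule integrable_mult_indicator[OF ST(1)]) (use w(1)[OF c] in simp)
        moreover have "set_integrable unit_square (S \<times> T) (\<lambda>z. w c (snd z, fst z) / 2)"
          unfolding set_integrable_def by (rule integrable_mult_indicator[OF ST(1)]) (use wsi[OF c] in simp)
        ultimately show ?thesis by (simp only: set_integral_add(2))
      qed
      also have "(LINT z:S \<times> T|unit_square. w c (snd z, fst z) / 2) = (LINT z:T \<times> S|unit_square. w c z / 2)"
        using set_integral_swap[OF _ S, of "\<lambda>z. w c z / 2"] wm[OF c] by simp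
      finally show ?thesis by (simp add: add_divide_distrib)
    qed
    \<comment> \<open>By symmetry of \<open>V j\<close> the two mirrored rectangles have equal
      integrals, so their average has the form needed to compare with the symmetrised limit.\<close>
    have 2: "(LINT z:S \<times> T|unit_square. pr (V j) c z) =
      ((LINT z:S \<times> T|unit_square. pr (V j) c z) + (LINT z:T \<times> S|unit_square. pr (V j) c z)) / 2" for j
    proof -
      have "(LINT z:T \<times> S|unit_square. pr (V j) c z) = (LINT z:S \<times> T|unit_square. pr (V j) c (snd z, fst z))"
        by (rule set_integral_swap[OF pr_measurable[OF V c] S, symmetric])
      also have "\<dots> = (LINT z:S \<times> T|unit_square. pr (V j) c z)"
        unfolding set_lebesgue_integral_def
      proof (rule Bochner_Integration.integral_cong[OF refl])
        fix z assume "z \<in> space unit_square"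
        then have "V j (snd z) (fst z) = V j (fst z) (snd z)" using V[of j] by (auto simp: graphons_def mem_Times_iff)
        then show "indicator (S \<times> T) z *\<^sub>R pr (V j) c (snd z, fst z) = indicator (S \<times> T) z *\<^sub>R pr (V j) c z" by simp
      qed
      finally show ?thesis by simp
    qed
    show "((\<lambda>j. LINT z:S \<times> T|unit_square. pr (V j) c z) \<longlongrightarrow> (LINT z:S \<times> T|unit_square. pr W c z)) F"
      unfolding 1 by (subst 2) (intro tendsto_intros w(3)[OF c] ST, simp)
  qed
qed

section \<open>The Frieze--Kannan decomposition\<close>

definition rect_mean :: "nat \<Rightarrow> (nat \<Rightarrow> nat \<Rightarrow> real) \<Rightarrow> nat set \<Rightarrow> nat set \<Rightarrow> real" where
  "rect_mean n f X Y = (\<Sum>u\<in>X. \<Sum>v\<in>Y. f u v) / (real n)\<^sup>2"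

text \<open>All colours are tested on the same rectangle, as in \<open>cut_dist\<close>. A single
  greedy rectangle per step therefore serves all of them.\<close>

definition cut_value :: "nat \<Rightarrow> nat \<Rightarrow> (nat \<Rightarrow> nat \<Rightarrow> nat \<Rightarrow> real) \<Rightarrow> nat set \<times> nat set \<Rightarrow> real" where
  "cut_value n k f p = (\<Sum>c=1..k. \<bar>rect_mean n (f c) (fst p) (snd p)\<bar>)"

definition best_rect :: "nat \<Rightarrow> nat \<Rightarrow> (nat \<Rightarrow> nat \<Rightarrow> nat \<Rightarrow> real) \<Rightarrow> nat set \<times> nat set" where
  "best_rect n k f = (SOME p. p \<in> Pow {1..n} \<times> Pow {1..n} \<and>
     (\<forall>q\<in>Pow {1..n} \<times> Pow {1..n}. cut_value n k f q \<le> cut_value n k f p))"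

text \<open>Each step subtracts the mean over the whole square, not over the rectangle: this already
  lowers the energy by the square of the coefficient, keeps the coefficients bounded, and never divides
  by the area of an empty rectangle.\<close>

primrec residual :: "nat \<Rightarrow> nat \<Rightarrow> (nat \<Rightarrow> nat \<Rightarrow> nat \<Rightarrow> real) \<Rightarrow> nat \<Rightarrow> nat \<Rightarrow> nat \<Rightarrow> nat \<Rightarrow> real" where
  "residual n k f 0 = f"
| "residual n k f (Suc t) = (\<lambda>c u v. residual n k f t c u v -
     (let p = best_rect n k (residual n k f t) in
       rect_mean n (residual n k f t c) (fst p) (snd p) * of_bool (u \<in> fst p) * of_bool (v \<in> snd p)))"

abbreviation greedy_rect :: "nat \<Rightarrow> nat \<Rightarrow> (nat \<Rightarrow> nat \<Rightarrow> nat \<Rightarrow> real) \<Rightarrow> nat \<Rightarrow> nat set \<times> nat set" where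
  "greedy_rect n k f t \<equiv> best_rect n k (residual n k f t)"

definition greedy_coeff :: "nat \<Rightarrow> nat \<Rightarrow> (nat \<Rightarrow> nat \<Rightarrow> nat \<Rightarrow> real) \<Rightarrow> nat \<Rightarrow> nat \<Rightarrow> real" where
  "greedy_coeff n k f t c =
     rect_mean n (residual n k f t c) (fst (greedy_rect n k f t)) (snd (greedy_rect n k f t))"

definition greedy_gain :: "nat \<Rightarrow> nat \<Rightarrow> (nat \<Rightarrow> nat \<Rightarrow> nat \<Rightarrow> real) \<Rightarrow> nat \<Rightarrow> real" where
  "greedy_gain n k f t = cut_value n k (residual n k f t) (greedy_rect n k f t)"

definition energy :: "nat \<Rightarrow> nat \<Rightarrow> (nat \<Rightarrow> nat \<Rightarrow> nat \<Rightarrow> real) \<Rightarrow> real" where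
  "energy n k f = (\<Sum>c=1..k. \<Sum>u=1..n. \<Sum>v=1..n. (f c u v)\<^sup>2) / (real n)\<^sup>2"

lemma best_rect:
  shows "best_rect n k f \<in> Pow {1..n} \<times> Pow {1..n}"
    and "X \<subseteq> {1..n} \<Longrightarrow> Y \<subseteq> {1..n} \<Longrightarrow> cut_value n k f (X, Y) \<le> cut_value n k f (best_rect n k f)"
proof -
  let ?P = "Pow {1..n} \<times> Pow {1..n}"
  have fin: "finite (cut_value n k f ` ?P)" "cut_value n k f ` ?P \<noteq> {}" by auto
  from Max_in[OF this] obtain p where p: "p \<in> ?P" "cut_value n k f p = Max (cut_value n k f ` ?P)" by auto
  have "p \<in> ?P \<and> (\<forall>q\<in>?P. cut_value n k f q \<le> cut_value n k f p)"
    unfolding p(2) using p(1) Max_ge[OF fin(1)] by blast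
  then have *: "best_rect n k f \<in> ?P \<and> (\<forall>q\<in>?P. cut_value n k f q \<le> cut_value n k f (best_rect n k f))"
    unfolding best_rect_def by (rule someI)
  then show "best_rect n k f \<in> ?P" ..
  show "X \<subseteq> {1..n} \<Longrightarrow> Y \<subseteq> {1..n} \<Longrightarrow> cut_value n k f (X, Y) \<le> cut_value n k f (best_rect n k f)"
    using * by blast
qed

lemma residual_eq:
  "residual n k f t c u v = f c u v - (\<Sum>s<t. greedy_coeff n k f s c *
     of_bool (u \<in> fst (greedy_rect n k f s)) * of_bool (v \<in> snd (greedy_rect n k f s)))"
  by (induction t) (auto simp: greedy_coeff_def Let_def)

lemma cut_value_nonneg: "0 \<le> cut_value n k f p"
  by (simp add: cut_value_def sum_nonneg)

lemma energy_nonneg: "0 \<le> energy n k f"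
  by (simp add: energy_def sum_nonneg)

text \<open>Expanding the square, and since the sum of f over the rectangle is a n^2, the cross term
  contributes - 2 a^2 after normalisation. The quadratic term returns at most a^2, because the
  rectangle has at most n^2 cells.\<close>

lemma sum_squares_subtract_rect:
  fixes f :: "nat \<Rightarrow> nat \<Rightarrow> real"
  assumes n: "n \<ge> 1" and X: "X \<subseteq> {1..n}" "Y \<subseteq> {1..n}"
  defines "a \<equiv> rect_mean n f X Y"
  shows "(\<Sum>u=1..n. \<Sum>v=1..n. (f u v - a * of_bool (u \<in> X) * of_bool (v \<in> Y))\<^sup>2) / (real n)\<^sup>2
     \<le> (\<Sum>u=1..n. \<Sum>v=1..n. (f u v)\<^sup>2) / (real n)\<^sup>2 - a\<^sup>2"
proof -
  have n2: "(real n)\<^sup>2 > 0" using n by simp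
  have I: "{1..n} \<inter> X = X" "{1..n} \<inter> Y = Y" using X by auto
  have s1: "(\<Sum>u=1..n. \<Sum>v=1..n. of_bool (u \<in> X) * of_bool (v \<in> Y) * g u v) = (\<Sum>u\<in>X. \<Sum>v\<in>Y. g u v)"
    for g :: "nat \<Rightarrow> nat \<Rightarrow> real"
  proof -
    have "(\<Sum>u=1..n. \<Sum>v=1..n. of_bool (u \<in> X) * of_bool (v \<in> Y) * g u v) =
      (\<Sum>u=1..n. if u \<in> X then (\<Sum>v=1..n. if v \<in> Y then g u v else 0) else 0)"
    proof (rule sum.cong[OF refl])
      fix u
      show "(\<Sum>v=1..n. of_bool (u \<in> X) * of_bool (v \<in> Y) * g u v) =
        (if u \<in> X then (\<Sum>v=1..n. if v \<in> Y then g u v else 0) else 0)"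
        by (cases "u \<in> X") (simp_all only: of_bool_eq if_True if_False mult_1 mult_zero_left sum.neutral_const,
            rule sum.cong, auto)
    qed
    also have "\<dots> = (\<Sum>u\<in>X. \<Sum>v\<in>Y. g u v)"
      by (simp only: sum.inter_restrict[OF finite_atLeastAtMost, symmetric] I)
    finally show ?thesis .
  qed
  have "(\<Sum>u=1..n. \<Sum>v=1..n. (f u v - a * of_bool (u \<in> X) * of_bool (v \<in> Y))\<^sup>2) =
    (\<Sum>u=1..n. \<Sum>v=1..n. (f u v)\<^sup>2 - of_bool (u \<in> X) * of_bool (v \<in> Y) * (2 * a * f u v)
       + of_bool (u \<in> X) * of_bool (v \<in> Y) * a\<^sup>2)"
    by (intro sum.cong refl) (auto simp: power2_eq_square algebra_simps)
  also have "\<dots> = (\<Sum>u=1..n. \<Sum>v=1..n. (f u v)\<^sup>2) - (\<Sum>u\<in>X. \<Sum>v\<in>Y. 2 * a * f u v) + (\<Sum>u\<in>X. \<Sum>v\<in>Y. a\<^sup>2)"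
    by (simp only: sum.distrib sum_subtractf s1)
  also have "(\<Sum>u\<in>X. \<Sum>v\<in>Y. 2 * a * f u v) = 2 * a * (\<Sum>u\<in>X. \<Sum>v\<in>Y. f u v)"
    by (simp only: sum_distrib_left)
  also have "(\<Sum>u\<in>X. \<Sum>v\<in>Y. f u v) = a * (real n)\<^sup>2" using n2 by (simp add: a_def rect_mean_def)
  also have "(\<Sum>u\<in>X. \<Sum>v\<in>Y. a\<^sup>2) \<le> a\<^sup>2 * (real n)\<^sup>2"
  proof -
    have "card X \<le> n" "card Y \<le> n"
      using card_mono[OF _ X(1)] card_mono[OF _ X(2)] by auto
    then have "real (card X) * real (card Y) \<le> real n * real n" by (intro mult_mono) auto
    then have "real (card X) * real (card Y) * a\<^sup>2 \<le> (real n)\<^sup>2 * a\<^sup>2"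
      by (intro mult_right_mono) (auto simp: power2_eq_square)
    then show ?thesis by (simp add: mult_ac)
  qed
  finally have "(\<Sum>u=1..n. \<Sum>v=1..n. (f u v - a * of_bool (u \<in> X) * of_bool (v \<in> Y))\<^sup>2) \<le>
    (\<Sum>u=1..n. \<Sum>v=1..n. (f u v)\<^sup>2) - a\<^sup>2 * (real n)\<^sup>2" by (simp add: power2_eq_square algebra_simps)
  from divide_right_mono[OF this, of "(real n)\<^sup>2"] show ?thesis
    using n2 by (simp add: diff_divide_distrib)
qed

lemma energy_residual_Suc:
  assumes n: "n \<ge> 1" and k: "k \<ge> 1"
  shows "energy n k (residual n k f (Suc t)) \<le> energy n k (residual n k f t) - (greedy_gain n k f t)\<^sup>2 / real k"
proof -
  let ?r = "residual n k f t" and ?p = "greedy_rect n k f t"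
  have sub: "fst ?p \<subseteq> {1..n}" "snd ?p \<subseteq> {1..n}" using best_rect(1)[of n k ?r] by auto
  let ?a = "\<lambda>c. rect_mean n (?r c) (fst ?p) (snd ?p)"
  have "energy n k (residual n k f (Suc t)) =
    (\<Sum>c=1..k. (\<Sum>u=1..n. \<Sum>v=1..n. (?r c u v - ?a c * of_bool (u \<in> fst ?p) * of_bool (v \<in> snd ?p))\<^sup>2) / (real n)\<^sup>2)"
    by (simp add: energy_def Let_def sum_divide_distrib)
  also have "\<dots> \<le> (\<Sum>c=1..k. (\<Sum>u=1..n. \<Sum>v=1..n. (?r c u v)\<^sup>2) / (real n)\<^sup>2 - (?a c)\<^sup>2)"
    by (rule sum_mono) (rule sum_squares_subtract_rect[OF n sub])
  also have "\<dots> = energy n k ?r - (\<Sum>c=1..k. (?a c)\<^sup>2)"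
    by (simp only: sum_subtractf energy_def sum_divide_distrib)
  also have "\<dots> \<le> energy n k ?r - (greedy_gain n k f t)\<^sup>2 / real k"
  proof -
    \<comment> \<open>Cauchy-Schwarz over the colours turns the decrease by a sum of squares into a
      decrease by the squared total, at the price of a factor k.\<close>
    have "(\<Sum>c=1..k. \<bar>?a c\<bar>)\<^sup>2 \<le> (\<Sum>c=1..k. \<bar>?a c\<bar>\<^sup>2) * real (card {1..k})"
      by (rule sum_squared_le_sum_of_squares)
    then have "(greedy_gain n k f t)\<^sup>2 \<le> (\<Sum>c=1..k. (?a c)\<^sup>2) * real k"
      by (simp add: greedy_gain_def cut_value_def)
    then show ?thesis using k by (simp add: pos_divide_le_eq)
  qed
  finally show ?thesis .
qed

text \<open>The energies telescope. The bound depends neither on T nor on the graph, so the limits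
  of the gains along a sequence of graphs remain square summable.\<close>

lemma sum_greedy_gain:
  assumes n: "n \<ge> 1" and k: "k \<ge> 1" and e: "energy n k f \<le> 1"
  shows "(\<Sum>t<T. (greedy_gain n k f t)\<^sup>2) \<le> real k"
proof -
  have "energy n k (residual n k f T) + (\<Sum>t<T. (greedy_gain n k f t)\<^sup>2 / real k) \<le> energy n k f"
  proof (induction T)
    case (Suc T)
    then show ?case using energy_residual_Suc[OF n k, of f T] by (simp del: residual.simps(2))
  qed simp
  then have "(\<Sum>t<T. (greedy_gain n k f t)\<^sup>2) / real k \<le> 1"
    using e energy_nonneg[of n k "residual n k f T"] by (simp add: sum_divide_distrib)
  then show ?thesis using k by simp
qed

text \<open>Only a bound uniform in the graph and the step matters here: it makes gains and
  coefficients converge along the limit filter.\<close>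

lemma greedy_gain_bounds:
  assumes n: "n \<ge> 1" and k: "k \<ge> 1" and e: "energy n k f \<le> 1"
  shows "0 \<le> greedy_gain n k f t" "greedy_gain n k f t \<le> real k"
proof -
  show "0 \<le> greedy_gain n k f t" by (simp add: greedy_gain_def cut_value_nonneg)
  have "(greedy_gain n k f t)\<^sup>2 \<le> (\<Sum>t<Suc t. (greedy_gain n k f t)\<^sup>2)"
    by (rule member_le_sum) auto
  also have "\<dots> \<le> real k" by (rule sum_greedy_gain[OF assms])
  also have "\<dots> \<le> (real k)\<^sup>2" using k by (simp add: power2_eq_square)
  finally show "greedy_gain n k f t \<le> real k" by (rule power2_le_imp_le) simp
qed

lemma greedy_coeff_bound:
  assumes n: "n \<ge> 1" and k: "k \<ge> 1" and e: "energy n k f \<le> 1" and c: "c \<in> {1..k}"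
  shows "\<bar>greedy_coeff n k f t c\<bar> \<le> real k"
proof -
  have "\<bar>greedy_coeff n k f t c\<bar> \<le> greedy_gain n k f t"
    unfolding greedy_gain_def greedy_coeff_def cut_value_def
    by (rule member_le_sum[where i=c]) (use c in auto)
  then show ?thesis using greedy_gain_bounds(2)[OF n k e, of t] by simp
qed

lemma residual_cut_le:
  assumes "X \<subseteq> {1..n}" "Y \<subseteq> {1..n}"
  shows "(\<Sum>c=1..k. \<bar>rect_mean n (residual n k f t c) X Y\<bar>) \<le> greedy_gain n k f t"
  using best_rect(2)[OF assms, of k "residual n k f t"] by (simp add: cut_value_def greedy_gain_def)

text \<open>The key of a vertex records, in base 4, to which sides of the first \<open>t\<close> greedy
  rectangles it belongs. Sorting the vertices by a late key also sorts them by all earlier ones.\<close>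

primrec greedy_key :: "nat \<Rightarrow> nat \<Rightarrow> (nat \<Rightarrow> nat \<Rightarrow> nat \<Rightarrow> real) \<Rightarrow> nat \<Rightarrow> nat \<Rightarrow> nat" where
  "greedy_key n k f 0 v = 0"
| "greedy_key n k f (Suc t) v = 4 * greedy_key n k f t v +
     2 * of_bool (v \<in> fst (greedy_rect n k f t)) + of_bool (v \<in> snd (greedy_rect n k f t))"

lemma greedy_key_less: "greedy_key n k f t v < 4 ^ t"
  by (induction t) auto

lemma greedy_key_div: "greedy_key n k f (t + m) v div 4 ^ m = greedy_key n k f t v"
proof (induction m)
  case (Suc m)
  have "greedy_key n k f (t + Suc m) v div 4 ^ Suc m = greedy_key n k f (Suc (t + m)) v div 4 div 4 ^ m"
    by (simp add: div_mult2_eq)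
  also have "greedy_key n k f (Suc (t + m)) v div 4 = greedy_key n k f (t + m) v"
  proof -
    \<comment> \<open>The two flags of the last step add at most 3, so division by 4 erases exactly
      that step.\<close>
    have "(4 * a + b) div 4 = a" if "b < 4" for a b :: nat using that by simp
    from this[of "2 * of_bool P + of_bool Q" for P Q] show ?thesis by (simp add: add.assoc)
  qed
  finally show ?case using Suc by simp
qed simp

lemma greedy_key_mem:
  "v \<in> fst (greedy_rect n k f t) \<longleftrightarrow> odd (greedy_key n k f (Suc t) v div 2)"
  "v \<in> snd (greedy_rect n k f t) \<longleftrightarrow> odd (greedy_key n k f (Suc t) v)"
  by auto

text \<open>An earlier key is the quotient of a later one by a power of 4, and division is monotone.
  One sorting thus puts all earlier keys in order as well.\<close>

lemma greedy_key_mono: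
  assumes "t \<le> J" "greedy_key n k f J u \<le> greedy_key n k f J v"
  shows "greedy_key n k f t u \<le> greedy_key n k f t v"
proof -
  have "greedy_key n k f (t + (J - t)) u div 4 ^ (J - t) \<le> greedy_key n k f (t + (J - t)) v div 4 ^ (J - t)"
    by (rule div_le_mono) (use assms in simp)
  then show ?thesis by (simp only: greedy_key_div)
qed

section \<open>Sorting the vertices, and rounding measurable rectangles to vertex rectangles\<close>

lemma exists_sorting_permutation:
  fixes key :: "nat \<Rightarrow> nat"
  obtains \<pi> where "\<pi> permutes {1..n}"
    "\<And>i j. i \<in> {1..n} \<Longrightarrow> j \<in> {1..n} \<Longrightarrow> i \<le> j \<Longrightarrow> key (\<pi> i) \<le> key (\<pi> j)"
proof -
  define xs where "xs = sort_key key [1..<Suc n]"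
  have xs: "length xs = n" "distinct xs" "set xs = {1..n}" "sorted (map key xs)"
    by (auto simp: xs_def)
  define \<pi> where "\<pi> i = (if i \<in> {1..n} then xs ! (i - 1) else i)" for i
  show thesis
  proof
    have "bij_betw (\<lambda>i. i - 1) {1..n} {..<n}"
      by (rule bij_betwI[where g=Suc]) auto
    then have "bij_betw ((!) xs \<circ> (\<lambda>i. i - 1)) {1..n} {1..n}"
      using bij_betw_nth[OF xs(2), of "{..<n}" "{1..n}"] xs by (auto intro: bij_betw_trans)
    then have "bij_betw \<pi> {1..n} {1..n}"
      by (rule bij_betw_cong[THEN iffD1, rotated]) (simp add: \<pi>_def)
    then show "\<pi> permutes {1..n}" by (rule bij_imp_permutes) (auto simp: \<pi>_def)
    fix i j assume *: "i \<in> {1..n}" "j \<in> {1..n}" "i \<le> j"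
    then have "map key xs ! (i - 1) \<le> map key xs ! (j - 1)"
      by (intro sorted_nth_mono[OF xs(4)]) (use xs in auto)
    moreover have "i - 1 < length xs" "j - 1 < length xs" using * xs by auto
    ultimately show "key (\<pi> i) \<le> key (\<pi> j)" unfolding \<pi>_def using * by simp
  qed
qed

text \<open>A linear form on the box with sides [0, B] is largest when full weight sits exactly on
  the positive coefficients.\<close>

lemma weighted_sum_le_subset:
  fixes r s :: "nat \<Rightarrow> real"
  assumes "finite I" "\<And>u. u \<in> I \<Longrightarrow> 0 \<le> s u" "\<And>u. u \<in> I \<Longrightarrow> s u \<le> B"
  shows "(\<Sum>u\<in>I. r u * s u) \<le> B * (\<Sum>u\<in>{u \<in> I. r u > 0}. r u)"
proof -
  have "(\<Sum>u\<in>I. r u * s u) \<le> (\<Sum>u\<in>I. if r u > 0 then B * r u else 0)"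
    by (rule sum_mono) (use assms in \<open>auto simp: mult.commute[of B] intro!: mult_left_mono mult_nonpos_nonneg\<close>)
  also have "\<dots> = B * (\<Sum>u\<in>{u \<in> I. r u > 0}. r u)"
    using assms(1) by (simp add: sum.inter_filter[symmetric] sum_distrib_left)
  finally show ?thesis .
qed

text \<open>The vectors s and t describe a fractional rectangle, the portion of each block covered
  by a measurable set. Rounding first s and then t to an extreme point never decreases the form, so
  an honest vertex rectangle does at least as well.\<close>

lemma bilinear_le_rect:
  fixes h :: "nat \<Rightarrow> nat \<Rightarrow> real"
  assumes s: "\<And>u. 0 \<le> s u" "\<And>u. u \<in> {1..n} \<Longrightarrow> s u \<le> 1 / real n"
    and t: "\<And>v. 0 \<le> t v" "\<And>v. v \<in> {1..n} \<Longrightarrow> t v \<le> 1 / real n"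
  obtains X Y where "X \<subseteq> {1..n}" "Y \<subseteq> {1..n}"
    "(\<Sum>u=1..n. \<Sum>v=1..n. h u v * (s u * t v)) \<le> rect_mean n h X Y"
proof -
  define X where "X = {u \<in> {1..n}. (\<Sum>v=1..n. h u v * t v) > 0}"
  define Y where "Y = {v \<in> {1..n}. (\<Sum>u\<in>X. h u v) > 0}"
  have "(\<Sum>u=1..n. \<Sum>v=1..n. h u v * (s u * t v)) = (\<Sum>u=1..n. (\<Sum>v=1..n. h u v * t v) * s u)"
    by (intro sum.cong refl) (simp add: sum_distrib_left sum_distrib_right mult_ac)
  also have "\<dots> \<le> 1 / real n * (\<Sum>u\<in>X. \<Sum>v=1..n. h u v * t v)"
    unfolding X_def by (rule weighted_sum_le_subset) (use s in auto)
  also have "(\<Sum>u\<in>X. \<Sum>v=1..n. h u v * t v) = (\<Sum>v=1..n. (\<Sum>u\<in>X. h u v) * t v)"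
    by (subst sum.swap) (simp add: sum_distrib_right)
  also have "1 / real n * (\<Sum>v=1..n. (\<Sum>u\<in>X. h u v) * t v) \<le>
      1 / real n * (1 / real n * (\<Sum>v\<in>Y. \<Sum>u\<in>X. h u v))"
    unfolding Y_def by (intro mult_left_mono weighted_sum_le_subset) (use t in auto)
  also have "\<dots> = rect_mean n h X Y"
    by (subst sum.swap) (simp add: rect_mean_def power2_eq_square)
  finally show thesis by (rule that[rotated 2]) (auto simp: X_def Y_def)
qed

text \<open>The supremum over measurable rectangles is attained in effect by unions of blocks: a
  bound checked on vertex sets transfers to all measurable S and T without any loss of
  constants.\<close>

lemma step_fun_cut_le:
  assumes n: "n \<ge> 1"
    and B: "\<And>X Y. X \<subseteq> {1..n} \<Longrightarrow> Y \<subseteq> {1..n} \<Longrightarrow> (\<Sum>c=1..k. \<bar>rect_mean n (f c) X Y\<bar>) \<le> B"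
    and S: "S \<in> sets unit_interval" "T \<in> sets unit_interval"
  shows "(\<Sum>c=1..k. \<bar>LINT z:S \<times> T|unit_square. f c (vertex_index n (fst z)) (vertex_index n (snd z))\<bar>) \<le> B"
proof -
  define s t where "s u = measure unit_interval (S \<inter> block n u)"
    and "t v = measure unit_interval (T \<inter> block n v)" for u v
  let ?I = "\<lambda>c. LINT z:S \<times> T|unit_square. f c (vertex_index n (fst z)) (vertex_index n (snd z))"
  have R: "(LINT z:block n u \<times> block n v|unit_square. indicator (S \<times> T) z) = s u * t v" for u v
  proof -
    have SB: "S \<inter> block n u \<in> sets unit_interval" "T \<inter> block n v \<in> sets unit_interval" using S by auto
    have "(LINT z:block n u \<times> block n v|unit_square. indicator (S \<times> T) z) =
      (LINT z|unit_square. indicator ((S \<inter> block n u) \<times> (T \<inter> block n v)) z :: real)"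
      unfolding set_lebesgue_integral_def
      by (rule Bochner_Integration.integral_cong) (auto simp: indicator_def)
    also have "\<dots> = measure unit_square ((S \<inter> block n u) \<times> (T \<inter> block n v))"
      using sets.sets_into_space[OF rect_in_unit_square[OF SB]]
      by (simp add: Int_absorb2 del: space_unit_square)
    finally show ?thesis by (simp add: measure_rect[OF SB] s_def t_def)
  qed
  have I: "?I c = (\<Sum>u=1..n. \<Sum>v=1..n. f c u v * (s u * t v))" for c
  proof -
    have "?I c = (LINT z|unit_square. f c (vertex_index n (fst z)) (vertex_index n (snd z)) * indicator (S \<times> T) z)"
      by (simp add: set_lebesgue_integral_def mult.commute)
    also have "\<dots> = (\<Sum>u=1..n. \<Sum>v=1..n. f c u v * (LINT z:block n u \<times> block n v|unit_square. indicator (S \<times> T) z))"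
    proof (rule step_fun_integral[OF n])
      show "integrable unit_square (indicator (S \<times> T) :: _ \<Rightarrow> real)"
        by (rule integrable_bounded_square[where B=1]) (use rect_in_unit_square[OF S] in auto)
    qed
    also have "\<dots> = (\<Sum>u=1..n. \<Sum>v=1..n. f c u v * (s u * t v))" by (simp only: R)
    finally show ?thesis .
  qed
  have sb: "s u \<le> 1 / real n" if "u \<in> {1..n}" for u
    unfolding s_def using measure_block[OF that]
      unit_interval.finite_measure_mono[OF Int_lower2 block_sets, of S n u] by simp
  have tb: "t u \<le> 1 / real n" if "u \<in> {1..n}" for u
    unfolding t_def using measure_block[OF that]
      unit_interval.finite_measure_mono[OF Int_lower2 block_sets, of T n u] by simp
  \<comment> \<open>Fixing the signs of the k integrals merges the sum of absolute values into one
    bilinear form, so that one rounding serves all colours simultaneously.\<close>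
  let ?h = "\<lambda>u v. \<Sum>c=1..k. sgn (?I c) * f c u v"
  obtain X Y where XY: "X \<subseteq> {1..n}" "Y \<subseteq> {1..n}"
    "(\<Sum>u=1..n. \<Sum>v=1..n. ?h u v * (s u * t v)) \<le> rect_mean n ?h X Y"
    by (rule bilinear_le_rect[of s n t ?h]) (use sb tb in \<open>auto simp: s_def t_def\<close>)
  have "(\<Sum>c=1..k. \<bar>?I c\<bar>) = (\<Sum>c=1..k. \<Sum>u=1..n. \<Sum>v=1..n. sgn (?I c) * f c u v * (s u * t v))"
  proof (rule sum.cong[OF refl])
    fix c
    have "\<bar>?I c\<bar> = sgn (?I c) * ?I c" by (simp add: abs_sgn mult.commute)
    also have "\<dots> = sgn (?I c) * (\<Sum>u=1..n. \<Sum>v=1..n. f c u v * (s u * t v))" by (simp only: I)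
    finally show "\<bar>?I c\<bar> = (\<Sum>u=1..n. \<Sum>v=1..n. sgn (?I c) * f c u v * (s u * t v))"
      by (simp only: sum_distrib_left mult.assoc)
  qed
  also have "\<dots> = (\<Sum>u=1..n. \<Sum>v=1..n. \<Sum>c=1..k. sgn (?I c) * f c u v * (s u * t v))"
    by (subst sum.swap, rule sum.cong[OF refl], rule sum.swap)
  also have "\<dots> = (\<Sum>u=1..n. \<Sum>v=1..n. ?h u v * (s u * t v))" by (simp only: sum_distrib_right)
  also note XY(3)
  also have "rect_mean n ?h X Y = (\<Sum>c=1..k. sgn (?I c) * rect_mean n (f c) X Y)"
  proof -
    have "(\<Sum>u\<in>X. \<Sum>v\<in>Y. ?h u v) = (\<Sum>u\<in>X. \<Sum>c=1..k. \<Sum>v\<in>Y. sgn (?I c) * f c u v)"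
      by (rule sum.cong[OF refl], rule sum.swap)
    also have "\<dots> = (\<Sum>c=1..k. \<Sum>u\<in>X. \<Sum>v\<in>Y. sgn (?I c) * f c u v)" by (rule sum.swap)
    finally show ?thesis
      by (simp only: rect_mean_def sum_distrib_left[symmetric] sum_divide_distrib[symmetric] times_divide_eq_right)
  qed
  also have "\<dots> \<le> (\<Sum>c=1..k. \<bar>rect_mean n (f c) X Y\<bar>)"
  proof (rule sum_mono)
    fix c
    show "sgn (?I c) * rect_mean n (f c) X Y \<le> \<bar>rect_mean n (f c) X Y\<bar>"
      by (cases "?I c" "0::real" rule: linorder_cases) auto
  qed
  also have "\<dots> \<le> B" by (rule B[OF XY(1,2)])
  finally show ?thesis .
qed

lemma energy_colour_indicator:
  assumes "G \<in> coloured_graphs k" "d \<in> {1..k}" "fst G = n" "n \<ge> 1"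
  shows "energy n k (\<lambda>c u v. of_bool (pair_colour d G u v = c)) \<le> 1"
proof -
  have "(\<Sum>c=1..k. \<Sum>u=1..n. \<Sum>v=1..n. (of_bool (pair_colour d G u v = c) :: real)\<^sup>2)
     = (\<Sum>u=1..n. \<Sum>v=1..n. \<Sum>c=1..k. of_bool (pair_colour d G u v = c))"
  proof -
    have "(of_bool P :: real)\<^sup>2 = of_bool P" for P by (cases P) auto
    then show ?thesis by (simp only:) (subst sum.swap, rule sum.cong[OF refl], rule sum.swap)
  qed
  also have "\<dots> = (\<Sum>u=1..n. \<Sum>v=1..n. 1)"
  proof (intro sum.cong refl)
    fix u v
    show "(\<Sum>c=1..k. of_bool (pair_colour d G u v = c)) = (1::real)"
      using pair_colour_range[OF assms(1,2), of u v] by (simp add: of_bool_def)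
  qed
  finally show ?thesis using assms by (simp add: energy_def power2_eq_square)
qed

section \<open>Compactness\<close>

text \<open>The common bound on all \<open>f j\<close> and g is part of the notion because
  \<open>L\<^sup>1\<close> convergence alone is not preserved by products, and the greedy
  approximations are sums of products.\<close>

definition L1_limit :: "nat filter \<Rightarrow> (nat \<Rightarrow> real \<times> real \<Rightarrow> real) \<Rightarrow> (real \<times> real \<Rightarrow> real) \<Rightarrow> bool" where
  "L1_limit F f g \<longleftrightarrow> (\<forall>j. f j \<in> borel_measurable unit_square) \<and> g \<in> borel_measurable unit_square \<and>
     (\<exists>B. \<forall>z\<in>space unit_square. \<bar>g z\<bar> \<le> B \<and> (\<forall>j. \<bar>f j z\<bar> \<le> B)) \<and>
     ((\<lambda>j. LINT z|unit_square. \<bar>f j z - g z\<bar>) \<longlongrightarrow> 0) F"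

lemma L1_limitE:
  assumes "L1_limit F f g"
  obtains B where "B \<ge> 0" "\<And>z. z \<in> space unit_square \<Longrightarrow> \<bar>g z\<bar> \<le> B"
    "\<And>j z. z \<in> space unit_square \<Longrightarrow> \<bar>f j z\<bar> \<le> B"
    "\<And>j. integrable unit_square (f j)" "integrable unit_square g"
    "((\<lambda>j. LINT z|unit_square. \<bar>f j z - g z\<bar>) \<longlongrightarrow> 0) F"
proof -
  from assms obtain B where B: "\<And>z. z \<in> space unit_square \<Longrightarrow> \<bar>g z\<bar> \<le> B"
    "\<And>j z. z \<in> space unit_square \<Longrightarrow> \<bar>f j z\<bar> \<le> B" unfolding L1_limit_def by blast
  have "(0, 0) \<in> space unit_square" by simp
  from B(1)[OF this] have "B \<ge> 0" by simp
  show thesis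
    by (rule that[OF \<open>B \<ge> 0\<close> B])
       (use assms B in \<open>auto simp: L1_limit_def intro!: integrable_bounded_square[where B=B] simp del: space_unit_square\<close>)
qed

lemma L1_limit_intro:
  assumes "\<And>j. f j \<in> borel_measurable unit_square" "g \<in> borel_measurable unit_square"
    "\<And>z. z \<in> space unit_square \<Longrightarrow> \<bar>g z\<bar> \<le> B" "\<And>j z. z \<in> space unit_square \<Longrightarrow> \<bar>f j z\<bar> \<le> B"
    and h: "\<And>j. (LINT z|unit_square. \<bar>f j z - g z\<bar>) \<le> h j" "(h \<longlongrightarrow> 0) F"
  shows "L1_limit F f g"
proof -
  have "((\<lambda>j. LINT z|unit_square. \<bar>f j z - g z\<bar>) \<longlongrightarrow> 0) F"
    by (rule tendsto_sandwich[OF _ _ tendsto_const h(2)]) (use h(1) in auto)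
  with assms(1-4) show ?thesis unfolding L1_limit_def by blast
qed

lemma L1_limit_const:
  assumes "(a \<longlongrightarrow> l) F" "\<And>j. \<bar>a j\<bar> \<le> (B :: real)"
  shows "L1_limit F (\<lambda>j z. a j) (\<lambda>z. l)"
proof (rule L1_limit_intro[where B="max B \<bar>l\<bar>" and h="\<lambda>j. \<bar>a j - l\<bar>"])
  show "(LINT z|unit_square. \<bar>a j - l\<bar>) \<le> \<bar>a j - l\<bar>" for j using unit_square.prob_space by simp
  show "((\<lambda>j. \<bar>a j - l\<bar>) \<longlongrightarrow> 0) F"
    using tendsto_rabs_zero[OF LIM_zero[OF assms(1)]] .
qed (use assms(2) in \<open>auto simp: le_max_iff_disj\<close>)

lemma L1_limit_add:
  assumes "L1_limit F f g" "L1_limit F f' g'"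
  shows "L1_limit F (\<lambda>j z. f j z + f' j z) (\<lambda>z. g z + g' z)"
proof -
  obtain B where B: "B \<ge> 0" "\<And>z. z \<in> space unit_square \<Longrightarrow> \<bar>g z\<bar> \<le> B"
    "\<And>j z. z \<in> space unit_square \<Longrightarrow> \<bar>f j z\<bar> \<le> B"
    "\<And>j. integrable unit_square (f j)" "integrable unit_square g"
    "((\<lambda>j. LINT z|unit_square. \<bar>f j z - g z\<bar>) \<longlongrightarrow> 0) F" using assms(1) by (rule L1_limitE) blast
  obtain B' where B': "B' \<ge> 0" "\<And>z. z \<in> space unit_square \<Longrightarrow> \<bar>g' z\<bar> \<le> B'"
    "\<And>j z. z \<in> space unit_square \<Longrightarrow> \<bar>f' j z\<bar> \<le> B'"
    "\<And>j. integrable unit_square (f' j)" "integrable unit_square g'"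
    "((\<lambda>j. LINT z|unit_square. \<bar>f' j z - g' z\<bar>) \<longlongrightarrow> 0) F" using assms(2) by (rule L1_limitE) blast
  have [measurable]: "f j \<in> borel_measurable unit_square" "f' j \<in> borel_measurable unit_square"
    "g \<in> borel_measurable unit_square" "g' \<in> borel_measurable unit_square" for j
    using assms unfolding L1_limit_def by blast+
  show ?thesis
  proof (rule L1_limit_intro[where B="B + B'"])
    fix j
    have "(LINT z|unit_square. \<bar>f j z + f' j z - (g z + g' z)\<bar>) \<le>
      (LINT z|unit_square. \<bar>f j z - g z\<bar> + \<bar>f' j z - g' z\<bar>)"
      by (rule Bochner_Integration.integral_mono) (use B B' in auto)
    also have "\<dots> = (LINT z|unit_square. \<bar>f j z - g z\<bar>) + (LINT z|unit_square. \<bar>f' j z - g' z\<bar>)"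
      by (rule Bochner_Integration.integral_add) (use B B' in auto)
    finally show "(LINT z|unit_square. \<bar>f j z + f' j z - (g z + g' z)\<bar>) \<le>
      (LINT z|unit_square. \<bar>f j z - g z\<bar>) + (LINT z|unit_square. \<bar>f' j z - g' z\<bar>)" .
  next
    show "((\<lambda>j. (LINT z|unit_square. \<bar>f j z - g z\<bar>) + (LINT z|unit_square. \<bar>f' j z - g' z\<bar>)) \<longlongrightarrow> 0) F"
      using tendsto_add[OF B(6) B'(6)] by simp
    fix z assume z: "z \<in> space unit_square"
    show "\<bar>g z + g' z\<bar> \<le> B + B'" using B(2)[OF z] B'(2)[OF z] by linarith
    show "\<bar>f j z + f' j z\<bar> \<le> B + B'" for j using B(3)[OF z, of j] B'(3)[OF z, of j] by linarith
  qed measurable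
qed

lemma L1_limit_mult:
  assumes "L1_limit F f g" "L1_limit F f' g'"
  shows "L1_limit F (\<lambda>j z. f j z * f' j z) (\<lambda>z. g z * g' z)"
proof -
  obtain B where B: "B \<ge> 0" "\<And>z. z \<in> space unit_square \<Longrightarrow> \<bar>g z\<bar> \<le> B"
    "\<And>j z. z \<in> space unit_square \<Longrightarrow> \<bar>f j z\<bar> \<le> B"
    "\<And>j. integrable unit_square (f j)" "integrable unit_square g"
    "((\<lambda>j. LINT z|unit_square. \<bar>f j z - g z\<bar>) \<longlongrightarrow> 0) F" using assms(1) by (rule L1_limitE) blast
  obtain B' where B': "B' \<ge> 0" "\<And>z. z \<in> space unit_square \<Longrightarrow> \<bar>g' z\<bar> \<le> B'"
    "\<And>j z. z \<in> space unit_square \<Longrightarrow> \<bar>f' j z\<bar> \<le> B'"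
    "\<And>j. integrable unit_square (f' j)" "integrable unit_square g'"
    "((\<lambda>j. LINT z|unit_square. \<bar>f' j z - g' z\<bar>) \<longlongrightarrow> 0) F" using assms(2) by (rule L1_limitE) blast
  have bd: "\<bar>g z * g' z\<bar> \<le> B * B'" "\<bar>f j z * f' j z\<bar> \<le> B * B'" if "z \<in> space unit_square" for z j
    unfolding abs_mult using B B' that by (auto intro!: mult_mono)
  have [measurable]: "f j \<in> borel_measurable unit_square" "f' j \<in> borel_measurable unit_square"
    "g \<in> borel_measurable unit_square" "g' \<in> borel_measurable unit_square" for j
    using assms unfolding L1_limit_def by blast+
  have meas: "(\<lambda>z. f j z * f' j z) \<in> borel_measurable unit_square" "(\<lambda>z. g z * g' z) \<in> borel_measurable unit_square" for j
    by measurable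
  show ?thesis
  proof (rule L1_limit_intro[where B="B * B'"])
    fix j
    have int: "integrable unit_square (\<lambda>z. f j z * f' j z)" "integrable unit_square (\<lambda>z. g z * g' z)"
      by (rule integrable_bounded_square[OF meas(1) bd(2)], assumption,
          rule integrable_bounded_square[OF meas(2) bd(1)])
    have "(LINT z|unit_square. \<bar>f j z * f' j z - g z * g' z\<bar>) \<le>
      (LINT z|unit_square. B' * \<bar>f j z - g z\<bar> + B * \<bar>f' j z - g' z\<bar>)"
    proof (rule Bochner_Integration.integral_mono)
      fix z assume z: "z \<in> space unit_square"
      have "f j z * f' j z - g z * g' z = (f j z - g z) * f' j z + g z * (f' j z - g' z)"
        by (simp add: algebra_simps)
      then have "\<bar>f j z * f' j z - g z * g' z\<bar> \<le> \<bar>f j z - g z\<bar> * \<bar>f' j z\<bar> + \<bar>g z\<bar> * \<bar>f' j z - g' z\<bar>"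
        using abs_triangle_ineq[of "(f j z - g z) * f' j z" "g z * (f' j z - g' z)"] by (simp add: abs_mult)
      also have "\<dots> \<le> \<bar>f j z - g z\<bar> * B' + B * \<bar>f' j z - g' z\<bar>"
        using B(2)[OF z] B'(3)[OF z] by (intro add_mono mult_left_mono mult_right_mono) auto
      finally show "\<bar>f j z * f' j z - g z * g' z\<bar> \<le> B' * \<bar>f j z - g z\<bar> + B * \<bar>f' j z - g' z\<bar>"
        by (simp add: mult.commute)
    qed (use B B' int in auto)
    also have "\<dots> = B' * (LINT z|unit_square. \<bar>f j z - g z\<bar>) + B * (LINT z|unit_square. \<bar>f' j z - g' z\<bar>)"
      by (subst Bochner_Integration.integral_add) (use B B' in auto)
    finally show "(LINT z|unit_square. \<bar>f j z * f' j z - g z * g' z\<bar>) \<le>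
      B' * (LINT z|unit_square. \<bar>f j z - g z\<bar>) + B * (LINT z|unit_square. \<bar>f' j z - g' z\<bar>)" .
  next
    show "((\<lambda>j. B' * (LINT z|unit_square. \<bar>f j z - g z\<bar>) + B * (LINT z|unit_square. \<bar>f' j z - g' z\<bar>)) \<longlongrightarrow> 0) F"
      using tendsto_add[OF tendsto_mult_left[OF B(6), of B'] tendsto_mult_left[OF B'(6), of B]] by simp
  qed (use bd meas in auto)
qed

definition L1_convergent :: "nat filter \<Rightarrow> (nat \<Rightarrow> real \<times> real \<Rightarrow> real) \<Rightarrow> bool" where
  "L1_convergent F f \<longleftrightarrow> (\<exists>g. L1_limit F f g)"

lemma L1_convergent_const:
  assumes "limit_filter F" "\<And>j. \<bar>a j\<bar> \<le> (B :: real)"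
  shows "L1_convergent F (\<lambda>j z. a j)"
  using limit_filter_convergent[OF assms(1), of a B] L1_limit_const[of a _ F B] assms(2)
  unfolding L1_convergent_def by metis

lemma L1_convergent_add:
  "L1_convergent F f \<Longrightarrow> L1_convergent F f' \<Longrightarrow> L1_convergent F (\<lambda>j z. f j z + f' j z)"
  unfolding L1_convergent_def using L1_limit_add by blast

lemma L1_convergent_mult:
  "L1_convergent F f \<Longrightarrow> L1_convergent F f' \<Longrightarrow> L1_convergent F (\<lambda>j z. f j z * f' j z)"
  unfolding L1_convergent_def using L1_limit_mult by blast

lemma L1_convergent_sum:
  assumes "limit_filter F" "finite I" "\<And>i. i \<in> I \<Longrightarrow> L1_convergent F (\<lambda>j z. f i j z)"
  shows "L1_convergent F (\<lambda>j z. \<Sum>i\<in>I. f i j z)"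
  using assms(2,3)
proof (induction I rule: finite_induct)
  case empty
  show ?case using L1_convergent_const[OF assms(1), of "\<lambda>_. 0" 0] by simp
next
  case (insert i I)
  then show ?case using L1_convergent_add[of F "f i" "\<lambda>j z. \<Sum>i\<in>I. f i j z"] by simp
qed

lemma L1_convergent_diff:
  assumes "limit_filter F" "L1_convergent F f" "L1_convergent F f'"
  shows "L1_convergent F (\<lambda>j z. f j z - f' j z)"
  using L1_convergent_add[OF assms(2) L1_convergent_mult[OF L1_convergent_const[OF assms(1), of "\<lambda>_. -1" 1] assms(3)]]
  by simp

lemma L1_convergent_cong:
  assumes "L1_convergent F f" "\<And>j z. z \<in> space unit_square \<Longrightarrow> f j z = f' j z"
  shows "L1_convergent F f'"
proof -
  obtain g where g: "L1_limit F f g" using assms(1) unfolding L1_convergent_def by blast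
  have "f j \<in> borel_measurable unit_square \<longleftrightarrow> f' j \<in> borel_measurable unit_square" for j
    by (rule measurable_cong) (rule assms(2))
  moreover have "(LINT z|unit_square. \<bar>f j z - g z\<bar>) = (LINT z|unit_square. \<bar>f' j z - g z\<bar>)" for j
    by (rule Bochner_Integration.integral_cong) (simp_all only: assms(2))
  moreover have "(\<exists>B. \<forall>z\<in>space unit_square. \<bar>g z\<bar> \<le> B \<and> (\<forall>j. \<bar>f j z\<bar> \<le> B)) \<Longrightarrow>
      (\<exists>B. \<forall>z\<in>space unit_square. \<bar>g z\<bar> \<le> B \<and> (\<forall>j. \<bar>f' j z\<bar> \<le> B))"
    using assms(2) by metis
  ultimately have "L1_limit F f' g" using g unfolding L1_limit_def by simp
  then show ?thesis unfolding L1_convergent_def by blast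
qed

text \<open>For nested sets the \<open>L\<^sup>1\<close> distance is a difference of two numbers.
  Within a chain of sets, convergence of the measures is therefore enough.\<close>

lemma integral_abs_indicator_diff_nested:
  assumes "A \<in> sets unit_square" "B \<in> sets unit_square" "A \<subseteq> B \<or> B \<subseteq> A"
  shows "(LINT z|unit_square. \<bar>indicator A z - indicator B z :: real\<bar>) =
    \<bar>measure unit_square A - measure unit_square B\<bar>"
proof -
  have *: "(LINT z|unit_square. \<bar>indicator A z - indicator B z :: real\<bar>) = measure unit_square B - measure unit_square A"
    if "A \<in> sets unit_square" "B \<in> sets unit_square" "A \<subseteq> B" for A B
  proof -
    have I: "A \<inter> space unit_square = A" "B \<inter> space unit_square = B"
      using sets.sets_into_space that by blast+
    have i: "integrable unit_square (indicator A :: _ \<Rightarrow> real)" "integrable unit_square (indicator B :: _ \<Rightarrow> real)"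
      by (rule integrable_bounded_square[where B=1]; use that in auto)+
    have "(LINT z|unit_square. \<bar>indicator A z - indicator B z :: real\<bar>) = (LINT z|unit_square. indicator B z - indicator A z)"
      by (rule Bochner_Integration.integral_cong) (use that(3) in \<open>auto simp: indicator_def\<close>)
    also have "\<dots> = measure unit_square B - measure unit_square A"
      using i by (simp add: I del: space_unit_square)
    finally show ?thesis .
  qed
  have le: "A \<subseteq> B \<Longrightarrow> measure unit_square A \<le> measure unit_square B" "B \<subseteq> A \<Longrightarrow> measure unit_square B \<le> measure unit_square A"
    using unit_square.finite_measure_mono assms by blast+
  show ?thesis
  proof (cases "A \<subseteq> B")
    case True then show ?thesis using *[OF assms(1,2)] le by simp
  next
    case False
    then have "B \<subseteq> A" using assms by blast
    then show ?thesis using *[OF assms(2,1)] le by (simp add: abs_minus_commute)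
  qed
qed

text \<open>These are the intervals ending at 1, without that endpoint. They form a chain, and each
  is determined up to a null set by its length.\<close>

definition upward_closed :: "real set \<Rightarrow> bool" where
  "upward_closed E \<longleftrightarrow> E \<subseteq> {0..<1} \<and> (\<forall>x\<in>E. \<forall>y. x \<le> y \<longrightarrow> y < 1 \<longrightarrow> y \<in> E)"

lemma upward_closed_nested:
  assumes "upward_closed A" "upward_closed B"
  shows "A \<subseteq> B \<or> B \<subseteq> A"
proof (rule ccontr)
  assume "\<not> ?thesis"
  then obtain a b where "a \<in> A" "a \<notin> B" "b \<in> B" "b \<notin> A" by blast
  moreover from this have "a < 1" "b < 1" using assms by (auto simp: upward_closed_def)
  ultimately show False using assms unfolding upward_closed_def by (meson linear)
qed

text \<open>The lengths are bounded reals and converge along \<open>F\<close>; since the sets are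
  nested with the interval of limiting length, they converge to it in \<open>L\<^sup>1\<close>.
  Monotonicity is required only eventually because early graphs are not sorted by later
  keys.\<close>

lemma L1_convergent_upward_closed:
  assumes F: "limit_filter F" and E: "\<And>j. E j \<in> sets unit_interval"
    and up: "\<forall>\<^sub>F j in F. upward_closed (E j)"
  shows "L1_convergent F (\<lambda>j z. indicator (E j) (fst z))" "L1_convergent F (\<lambda>j z. indicator (E j) (snd z))"
proof -
  have I: "{0..1} \<in> sets unit_interval" using sets.top[of unit_interval] by simp
  define b where "b j = measure unit_interval (E j)" for j
  have b01: "0 \<le> b j" "b j \<le> 1" for j by (auto simp: b_def unit_interval.prob_le_1)
  then obtain \<beta> where \<beta>: "(b \<longlongrightarrow> \<beta>) F" using limit_filter_convergent[OF F, of b 1] by auto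
  have \<beta>01: "0 \<le> \<beta>" "\<beta> \<le> 1"
    using tendsto_lowerbound[OF \<beta> _ limit_filter_not_bot[OF F], of 0]
      tendsto_upperbound[OF \<beta> _ limit_filter_not_bot[OF F], of 1] b01 by auto
  \<comment> \<open>The interval of length \<beta> at the right end; leaving out both endpoints
    changes no measure and keeps it inside [0, 1).\<close>
  define E' where "E' = {1 - \<beta><..<1}"
  have E': "E' \<in> sets unit_interval" using \<beta>01 by (auto simp: E'_def sets_unit_interval)
  have mE': "measure unit_interval E' = \<beta>"
    using measure_unit_interval[OF E'] \<beta>01 by (simp add: E'_def)
  have upE': "upward_closed E'" using \<beta>01 by (auto simp: E'_def upward_closed_def)
  have top: "measure unit_interval {0..1} = 1" using unit_interval.prob_space by simp
  have conv: "L1_limit F (\<lambda>j. indicator (A j)) (indicator A')"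
    if A: "\<And>j. A j \<in> sets unit_square" "A' \<in> sets unit_square"
      and n: "\<And>j. upward_closed (E j) \<Longrightarrow> A j \<subseteq> A' \<or> A' \<subseteq> A j"
      and m: "\<And>j. measure unit_square (A j) = b j" "measure unit_square A' = \<beta>" for A A'
  proof -
    have "((\<lambda>j. \<bar>b j - \<beta>\<bar>) \<longlongrightarrow> 0) F" using tendsto_rabs_zero[OF LIM_zero[OF \<beta>]] .
    moreover have "\<forall>\<^sub>F j in F. \<bar>b j - \<beta>\<bar> = (LINT z|unit_square. \<bar>indicator (A j) z - indicator A' z :: real\<bar>)"
      using up by eventually_elim (use integral_abs_indicator_diff_nested[OF A n] m in simp)
    ultimately have "((\<lambda>j. LINT z|unit_square. \<bar>indicator (A j) z - indicator A' z :: real\<bar>) \<longlongrightarrow> 0) F"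
      by (rule Lim_transform_eventually)
    then show ?thesis unfolding L1_limit_def using A
      by (auto intro!: exI[of _ 1] simp: indicator_def)
  qed
  have "L1_limit F (\<lambda>j. indicator (E j \<times> {0..1})) (indicator (E' \<times> {0..1}))"
    by (rule conv) (use E E' I upward_closed_nested[OF _ upE'] in \<open>auto simp: measure_rect top mE' b_def\<close>)
  then have "L1_convergent F (\<lambda>j. indicator (E j \<times> {0..1}))" unfolding L1_convergent_def by blast
  then show "L1_convergent F (\<lambda>j z. indicator (E j) (fst z))"
    by (rule L1_convergent_cong) (auto simp: indicator_def)
  have "L1_limit F (\<lambda>j. indicator ({0..1} \<times> E j)) (indicator ({0..1} \<times> E'))"
    by (rule conv) (use E E' I upward_closed_nested[OF _ upE'] in \<open>auto simp: measure_rect top mE' b_def\<close>)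
  then have "L1_convergent F (\<lambda>j. indicator ({0..1} \<times> E j))" unfolding L1_convergent_def by blast
  then show "L1_convergent F (\<lambda>j z. indicator (E j) (snd z))"
    by (rule L1_convergent_cong) (auto simp: indicator_def)
qed

text \<open>Exactly one difference of consecutive thresholds is nonzero, the one at a = m. Any
  predicate of a bounded key thereby becomes a fixed linear combination of threshold
  indicators.\<close>

lemma of_bool_threshold_sum:
  fixes P :: "nat \<Rightarrow> bool"
  assumes "m < M"
  shows "(of_bool (P m) :: real) = (\<Sum>a<M. of_bool (P a) * (of_bool (a \<le> m) - of_bool (Suc a \<le> m)))"
proof -
  have "(\<Sum>a<M. of_bool (P a) * (of_bool (a \<le> m) - of_bool (Suc a \<le> m))) = (\<Sum>a<M. if a = m then of_bool (P a) else (0::real))"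
    by (rule sum.cong) auto
  also have "\<dots> = of_bool (P m)" using assms by simp
  finally show ?thesis ..
qed

text \<open>A monotone key with values below M has upward closed threshold sets, whose indicators
  converge, and P is a finite combination of them. The point 1 lies in no threshold set, so P has to
  fail there for the identity to hold on the whole interval.\<close>

lemma L1_convergent_monotone_keys:
  fixes \<kappa> :: "nat \<Rightarrow> real \<Rightarrow> nat"
  assumes F: "limit_filter F" and m: "\<And>j. \<kappa> j \<in> measurable unit_interval (count_space UNIV)"
    and M: "\<And>j x. \<kappa> j x < M"
    and mono: "\<forall>\<^sub>F j in F. \<forall>x y. 0 \<le> x \<longrightarrow> x \<le> y \<longrightarrow> y < 1 \<longrightarrow> \<kappa> j x \<le> \<kappa> j y"
    and one: "\<And>j. \<not> P (\<kappa> j 1)"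
  shows "L1_convergent F (\<lambda>j z. of_bool (P (\<kappa> j (fst z))))" "L1_convergent F (\<lambda>j z. of_bool (P (\<kappa> j (snd z))))"
proof -
  define E where "E a j = {x \<in> {0..<1}. a \<le> \<kappa> j x}" for a j
  have E: "E a j \<in> sets unit_interval" for a j
  proof -
    have "E a j = (\<kappa> j -` {a..} \<inter> space unit_interval) \<inter> {0..<1}" by (auto simp: E_def)
    also have "\<dots> \<in> sets unit_interval"
      by (intro sets.Int measurable_sets[OF m]) (auto simp: sets_unit_interval)
    finally show ?thesis .
  qed
  have up: "\<forall>\<^sub>F j in F. upward_closed (E a j)" for a
    using mono
  proof eventually_elim
    case (elim j)
    then show ?case unfolding upward_closed_def E_def by (auto intro: order_trans)
  qed
  note conv = L1_convergent_upward_closed[OF F E up]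
  have eq: "(\<Sum>a<M. of_bool (P a) * (indicator (E a j) x - indicator (E (Suc a) j) x)) = (of_bool (P (\<kappa> j x)) :: real)"
    if "x \<in> {0..1}" for j x
  proof (cases "x = 1")
    case True
    then have "indicator (E a j) x = (0::real)" for a by (simp add: E_def)
    then show ?thesis using one True by simp
  next
    case False
    with that have "indicator (E a j) x = (of_bool (a \<le> \<kappa> j x) :: real)" for a by (auto simp: E_def indicator_def)
    then show ?thesis using of_bool_threshold_sum[OF M, of P j x] by simp
  qed
  have "L1_convergent F (\<lambda>j z. \<Sum>a<M. of_bool (P a) * (indicator (E a j) (fst z) - indicator (E (Suc a) j) (fst z)))"
    by (intro L1_convergent_sum[OF F] L1_convergent_mult L1_convergent_diff[OF F] conv
        L1_convergent_const[OF F, of _ 1]) auto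
  then show "L1_convergent F (\<lambda>j z. of_bool (P (\<kappa> j (fst z))))"
    by (rule L1_convergent_cong) (rule eq, auto)
  have "L1_convergent F (\<lambda>j z. \<Sum>a<M. of_bool (P a) * (indicator (E a j) (snd z) - indicator (E (Suc a) j) (snd z)))"
    by (intro L1_convergent_sum[OF F] L1_convergent_mult L1_convergent_diff[OF F] conv
        L1_convergent_const[OF F, of _ 1]) auto
  then show "L1_convergent F (\<lambda>j z. of_bool (P (\<kappa> j (snd z))))"
    by (rule L1_convergent_cong) (rule eq, auto)
qed

lemma vertex_index_mono: "x \<le> y \<Longrightarrow> vertex_index n x \<le> vertex_index n y"
  by (auto simp: vertex_index_def intro!: nat_mono floor_mono mult_left_mono)

text \<open>The bound does not depend on A, so it passes to the supremum in the cut
  distance.\<close>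

lemma L1_limit_set_integral:
  assumes "L1_limit F f g" "A \<in> sets unit_square"
  shows "\<bar>(LINT z:A|unit_square. f j z) - (LINT z:A|unit_square. g z)\<bar> \<le> (LINT z|unit_square. \<bar>f j z - g z\<bar>)"
proof -
  have i: "integrable unit_square (f j)" "integrable unit_square g" by (rule L1_limitE[OF assms(1)], blast)+
  have si: "set_integrable unit_square A (f j)" "set_integrable unit_square A g"
    unfolding set_integrable_def by (rule integrable_mult_indicator[OF assms(2)], fact)+
  have "(LINT z:A|unit_square. f j z) - (LINT z:A|unit_square. g z) = (LINT z:A|unit_square. f j z - g z)"
    by (rule set_integral_diff(2)[OF si, symmetric])
  moreover have "norm (LINT z:A|unit_square. f j z - g z) \<le> (LINT z|unit_square. \<bar>f j z - g z\<bar>)"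
    unfolding set_lebesgue_integral_def
  proof (rule Bochner_Integration.integral_norm_bound_integral)
    show "integrable unit_square (\<lambda>z. indicator A z *\<^sub>R (f j z - g z))"
      by (rule integrable_mult_indicator[OF assms(2)]) (use i in simp)
  qed (use i in \<open>auto simp: indicator_def\<close>)
  ultimately show ?thesis by simp
qed

text \<open>Weak convergence to \<open>W\<close> does not suffice for the cut distance, which is
  uniform over rectangles. The truncated greedy approximations supply the uniformity: they converge
  in \<open>L\<^sup>1\<close>, and what they leave over has cut norm bounded by the gain, before and
  after the limit.\<close>

lemma graph_sequence_compact:
  fixes G :: "nat \<Rightarrow> cgraph"
  assumes k: "k \<ge> 1" and d: "d \<in> {1..k}" and G: "\<And>j. G j \<in> coloured_graphs k" "\<And>j. fst (G j) \<ge> 1"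
  obtains W s \<pi> where "W \<in> graphons k" "strict_mono (s :: nat \<Rightarrow> nat)" "\<And>j. \<pi> j permutes {1..fst (G j)}"
    "(\<lambda>j. cut_dist k (step_graphon d (relabel (\<pi> (s j)) (G (s j)))) W) \<longlonglongrightarrow> 0"
proof -
  obtain F where F: "limit_filter F" by (rule exists_limit_filter)
  have Fbot: "F \<noteq> bot" and Fseq: "F \<le> sequentially" using F by (auto simp: limit_filter_def)
  define n where "n j = fst (G j)" for j
  have n: "n j \<ge> 1" for j using G(2) by (simp add: n_def)
  define f where "f j c u v = (of_bool (pair_colour d (G j) u v = c) :: real)" for j c u v
  have en: "energy (n j) k (f j) \<le> 1" for j
    unfolding f_def by (rule energy_colour_indicator[OF G(1) d _ n]) (simp add: n_def)
  \<comment> \<open>Graph j is sorted by its key of depth j, so each fixed depth is sorted in all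
    but finitely many graphs.\<close>
  have "\<exists>\<pi>. \<forall>j. \<pi> j permutes {1..n j} \<and> (\<forall>u\<in>{1..n j}. \<forall>v\<in>{1..n j}. u \<le> v \<longrightarrow>
      greedy_key (n j) k (f j) j (\<pi> j u) \<le> greedy_key (n j) k (f j) j (\<pi> j v))"
  proof (intro choice allI)
    fix j
    obtain p where "p permutes {1..n j}" "\<And>u v. u \<in> {1..n j} \<Longrightarrow> v \<in> {1..n j} \<Longrightarrow> u \<le> v \<Longrightarrow>
      greedy_key (n j) k (f j) j (p u) \<le> greedy_key (n j) k (f j) j (p v)"
      by (rule exists_sorting_permutation[of "n j" "greedy_key (n j) k (f j) j"]) blast
    then show "\<exists>p. p permutes {1..n j} \<and> (\<forall>u\<in>{1..n j}. \<forall>v\<in>{1..n j}. u \<le> v \<longrightarrow>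
      greedy_key (n j) k (f j) j (p u) \<le> greedy_key (n j) k (f j) j (p v))" by blast
  qed
  then obtain \<pi> where \<pi>: "\<And>j. \<pi> j permutes {1..n j}"
    and sorted: "\<And>j u v. u \<in> {1..n j} \<Longrightarrow> v \<in> {1..n j} \<Longrightarrow> u \<le> v \<Longrightarrow>
      greedy_key (n j) k (f j) j (\<pi> j u) \<le> greedy_key (n j) k (f j) j (\<pi> j v)" by blast
  define V where "V j = step_graphon d (relabel (\<pi> j) (G j))" for j
  have V: "V j \<in> graphons k" for j
    unfolding V_def by (rule step_graphon_graphon[OF relabel_coloured_graph[OF G(1)] d]) (use \<pi> in \<open>simp add: n_def\<close>)
  define p where "p j x = \<pi> j (vertex_index (n j) x)" for j x
  have prV: "pr (V j) c z = f j c (p j (fst z)) (p j (snd z))" for j c z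
    using \<pi>[of j] unfolding V_def pr_step_graphon f_def p_def n_def by (simp add: pair_colour_relabel)
  define rect where "rect j t = greedy_rect (n j) k (f j) t" for j t
  define h where "h t c j z = (\<Sum>s<t. greedy_coeff (n j) k (f j) s c * of_bool (p j (fst z) \<in> fst (rect j s)) *
      of_bool (p j (snd z) \<in> snd (rect j s)))" for t c j and z :: "real \<times> real"
  \<comment> \<open>The residual after t steps, read in the sorted labels, is the step graphon minus
    its greedy approximation.\<close>
  have res: "residual (n j) k (f j) t c (p j (fst z)) (p j (snd z)) = pr (V j) c z - h t c j z" for t c j z
    by (simp add: residual_eq prV h_def rect_def)
  have hconv: "L1_convergent F (h t c)" if c: "c \<in> {1..k}" for t c
  proof -
    have rects: "L1_convergent F (\<lambda>j z. of_bool (p j (fst z) \<in> fst (rect j s)))"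
      "L1_convergent F (\<lambda>j z. of_bool (p j (snd z) \<in> snd (rect j s)))" for s
    proof -
      define \<kappa> where "\<kappa> j x = greedy_key (n j) k (f j) (Suc s) (p j x)" for j x
      have m: "\<kappa> j \<in> measurable unit_interval (count_space UNIV)" for j
        unfolding \<kappa>_def p_def by (rule measurable_compose[OF vertex_index_measurable]) simp
      have less: "\<kappa> j x < 4 ^ Suc s" for j x unfolding \<kappa>_def by (rule greedy_key_less)
      \<comment> \<open>Membership in rectangle s is read off the key of depth s + 1, which the
        sorting controls from this index on.\<close>
      have "\<forall>\<^sub>F j in F. j \<ge> Suc s" using Fseq eventually_ge_at_top filter_leD by blast
      then have mono: "\<forall>\<^sub>F j in F. \<forall>x y. 0 \<le> x \<longrightarrow> x \<le> y \<longrightarrow> y < 1 \<longrightarrow> \<kappa> j x \<le> \<kappa> j y"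
      proof eventually_elim
        case (elim j)
        show ?case
        proof (intro allI impI)
          fix x y :: real assume xy: "0 \<le> x" "x \<le> y" "y < 1"
          have r: "vertex_index (n j) x \<in> {1..n j}" "vertex_index (n j) y \<in> {1..n j}"
            by (rule vertex_index_range[OF _ _ n]; use xy in simp)+
          show "\<kappa> j x \<le> \<kappa> j y"
            unfolding \<kappa>_def p_def
            by (rule greedy_key_mono[OF elim]) (rule sorted[OF r vertex_index_mono[OF xy(2)]])
        qed
      qed
      have p1: "p j 1 = n j + 1" for j
        using permutes_not_in[OF \<pi>, of "n j + 1" j] by (simp add: p_def)
      have sub: "fst (rect j s) \<subseteq> {1..n j}" "snd (rect j s) \<subseteq> {1..n j}" for j
        using best_rect(1)[of "n j" k "residual (n j) k (f j) s"] by (auto simp: rect_def)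
      have mem: "p j x \<in> fst (rect j s) \<longleftrightarrow> odd (\<kappa> j x div 2)" "p j x \<in> snd (rect j s) \<longleftrightarrow> odd (\<kappa> j x)" for j x
        unfolding rect_def \<kappa>_def by (rule greedy_key_mem)+
      have not1: "\<not> odd (\<kappa> j 1 div 2)" "\<not> odd (\<kappa> j 1)" for j
        unfolding mem[symmetric] p1 using sub[of j] by auto
      show "L1_convergent F (\<lambda>j z. of_bool (p j (fst z) \<in> fst (rect j s)))"
        unfolding mem by (rule L1_convergent_monotone_keys(1)[where P="\<lambda>a. odd (a div 2)", OF F m less mono not1(1)])
      show "L1_convergent F (\<lambda>j z. of_bool (p j (snd z) \<in> snd (rect j s)))"
        unfolding mem by (rule L1_convergent_monotone_keys(2)[where P=odd, OF F m less mono not1(2)])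
    qed
    show ?thesis
      unfolding h_def
      by (intro L1_convergent_sum[OF F] L1_convergent_mult rects
          L1_convergent_const[OF F greedy_coeff_bound[OF n k en c]]) auto
  qed
  then have "\<forall>tc. \<exists>g. snd tc \<in> {1..k} \<longrightarrow> L1_limit F (h (fst tc) (snd tc)) g"
    unfolding L1_convergent_def by blast
  then obtain H where H: "\<forall>tc. snd tc \<in> {1..k} \<longrightarrow> L1_limit F (h (fst tc) (snd tc)) (H tc)" by (rule choice[THEN exE])
  define hl where "hl t c = H (t, c)" for t c
  have hl: "L1_limit F (h t c) (hl t c)" if "c \<in> {1..k}" for t c
    using H[rule_format, of "(t, c)"] that by (simp add: hl_def)
  define gain where "gain t j = greedy_gain (n j) k (f j) t" for t j
  have "\<exists>\<gamma>. \<forall>t. (gain t \<longlongrightarrow> \<gamma> t) F"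
  proof (intro choice allI)
    fix t
    have "\<bar>gain t j\<bar> \<le> real k" for j
      using greedy_gain_bounds[OF n[of j] k en[of j], of t] by (simp add: gain_def)
    then show "\<exists>l. (gain t \<longlongrightarrow> l) F" by (rule limit_filter_convergent[OF F, of "gain t" "real k"]) blast
  qed
  then obtain \<gamma> where \<gamma>: "\<And>t. (gain t \<longlongrightarrow> \<gamma> t) F" by blast
  \<comment> \<open>Finite sums of squared gains keep their bound k in the limit. This forces
    \<gamma> to 0, although no rate is known.\<close>
  have "summable (\<lambda>t. (\<gamma> t)\<^sup>2)"
  proof (rule summableI_nonneg_bounded[where x="real k"])
    fix T
    have "((\<lambda>j. \<Sum>t<T. (gain t j)\<^sup>2) \<longlongrightarrow> (\<Sum>t<T. (\<gamma> t)\<^sup>2)) F"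
      by (intro tendsto_sum tendsto_power \<gamma>)
    then show "(\<Sum>t<T. (\<gamma> t)\<^sup>2) \<le> real k"
      by (rule tendsto_upperbound[OF _ _ Fbot]) (auto simp: gain_def sum_greedy_gain[OF n k en])
  qed simp
  then have "(\<lambda>t. (\<gamma> t)\<^sup>2) \<longlonglongrightarrow> 0" by (rule summable_LIMSEQ_zero)
  from tendsto_real_sqrt[OF this] have \<gamma>0: "\<gamma> \<longlonglongrightarrow> 0"
    by (simp add: tendsto_rabs_zero_iff)
  obtain W where W: "W \<in> graphons k"
    and Wlim: "\<And>c S T. c \<in> {1..k} \<Longrightarrow> S \<in> sets unit_interval \<Longrightarrow> T \<in> sets unit_interval \<Longrightarrow>
      ((\<lambda>j. LINT z:S \<times> T|unit_square. pr (V j) c z) \<longlongrightarrow> (LINT z:S \<times> T|unit_square. pr W c z)) F"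
    by (rule graphon_weak_limit[where V=V, OF k F V]) blast
  define L where "L t j = (\<Sum>c=1..k. LINT z|unit_square. \<bar>h t c j z - hl t c z\<bar>)" for t j
  have L: "(L t \<longlongrightarrow> 0) F" for t
  proof -
    have "((\<lambda>j. LINT z|unit_square. \<bar>h t c j z - hl t c z\<bar>) \<longlongrightarrow> 0) F" if "c \<in> {1..k}" for c
      using hl[OF that] by (simp add: L1_limit_def)
    then have "((\<lambda>j. \<Sum>c=1..k. LINT z|unit_square. \<bar>h t c j z - hl t c z\<bar>) \<longlongrightarrow> (\<Sum>c=1..k. 0)) F"
      by (intro tendsto_sum) auto
    then show ?thesis by (simp add: L_def[abs_def])
  qed
  have h_int: "integrable unit_square (h t c j)" "integrable unit_square (hl t c)" if "c \<in> {1..k}" for t c j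
    by (rule L1_limitE[OF hl[OF that]], blast)+
  \<comment> \<open>Three differences: \<open>V j\<close> from its approximation h, costing the
    gain; h from its limit hl, costing \<open>L t j\<close>; hl from \<open>W\<close>, costing
    \<open>\<gamma> t\<close>.\<close>
  have cut: "cut_dist k (V j) W \<le> gain t j + L t j + \<gamma> t" for t j
  proof (rule cut_dist_least)
    fix S T assume S: "S \<in> sets unit_interval" "T \<in> sets unit_interval"
    then have ST: "S \<times> T \<in> sets unit_square" by auto
    let ?I = "\<lambda>f. LINT z:S \<times> T|unit_square. f z"
    have si: "set_integrable unit_square (S \<times> T) f" if "integrable unit_square f" for f :: "_ \<Rightarrow> real"
      unfolding set_integrable_def by (rule integrable_mult_indicator[OF ST that])
    have Vint: "integrable unit_square (pr (V j) c)" if "c \<in> {1..k}" for c j by (rule pr_integrable[OF V that])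
    have 1: "(\<Sum>c=1..k. \<bar>?I (pr (V j) c) - ?I (h t c j)\<bar>) \<le> gain t j" for j
    proof -
      have "(\<Sum>c=1..k. \<bar>LINT z:S \<times> T|unit_square.
          (\<lambda>u v. residual (n j) k (f j) t c (\<pi> j u) (\<pi> j v)) (vertex_index (n j) (fst z)) (vertex_index (n j) (snd z))\<bar>) \<le> gain t j"
      proof (rule step_fun_cut_le[OF n _ S])
        fix X Y assume XY: "X \<subseteq> {1..n j}" "Y \<subseteq> {1..n j}"
        have "rect_mean (n j) (\<lambda>u v. residual (n j) k (f j) t c (\<pi> j u) (\<pi> j v)) X Y =
            rect_mean (n j) (residual (n j) k (f j) t c) (\<pi> j ` X) (\<pi> j ` Y)" for c
          unfolding rect_mean_def
          using permutes_inj_on[OF \<pi>, of j] by (simp add: sum.reindex)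
        moreover have "\<pi> j ` X \<subseteq> {1..n j}" "\<pi> j ` Y \<subseteq> {1..n j}"
          using XY permutes_image[OF \<pi>, of j] by blast+
        ultimately show "(\<Sum>c=1..k. \<bar>rect_mean (n j) (\<lambda>u v. residual (n j) k (f j) t c (\<pi> j u) (\<pi> j v)) X Y\<bar>) \<le> gain t j"
          unfolding gain_def using residual_cut_le by simp
      qed
      moreover have "(LINT z:S \<times> T|unit_square.
          (\<lambda>u v. residual (n j) k (f j) t c (\<pi> j u) (\<pi> j v)) (vertex_index (n j) (fst z)) (vertex_index (n j) (snd z)))
          = ?I (pr (V j) c) - ?I (h t c j)" if c: "c \<in> {1..k}" for c
        using res[of j t c] set_integral_diff(2)[OF si[OF Vint[OF c]] si[OF h_int(1)[OF c, of t j]], of j]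
        unfolding p_def by simp
      ultimately show ?thesis by simp
    qed
    have 2: "\<bar>?I (h t c j) - ?I (hl t c)\<bar> \<le> (LINT z|unit_square. \<bar>h t c j z - hl t c z\<bar>)" if "c \<in> {1..k}" for c j
      by (rule L1_limit_set_integral[OF hl[OF that] ST])
    \<comment> \<open>The first estimate in the limit along \<open>F\<close>. On a fixed rectangle
      the integrals of \<open>V j\<close> converge weakly and those of h by \<open>L\<^sup>1\<close>
      convergence, and the resulting bound is again uniform in the rectangle.\<close>
    have 3: "(\<Sum>c=1..k. \<bar>?I (pr W c) - ?I (hl t c)\<bar>) \<le> \<gamma> t"
    proof (rule tendsto_le[OF Fbot \<gamma>[of t]])
      show "((\<lambda>j. \<Sum>c=1..k. \<bar>?I (pr (V j) c) - ?I (h t c j)\<bar>) \<longlongrightarrow> (\<Sum>c=1..k. \<bar>?I (pr W c) - ?I (hl t c)\<bar>)) F"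
      proof (intro tendsto_sum tendsto_rabs tendsto_diff Wlim S)
        fix c assume c: "c \<in> {1..k}"
        have "((\<lambda>j. ?I (h t c j) - ?I (hl t c)) \<longlongrightarrow> 0) F"
        proof (rule tendsto_0_le[where K=1])
          show "((\<lambda>j. LINT z|unit_square. \<bar>h t c j z - hl t c z\<bar>) \<longlongrightarrow> 0) F"
            using hl[OF c] by (simp add: L1_limit_def)
        qed (use 2[OF c] in \<open>auto intro: order_trans[OF _ abs_ge_self]\<close>)
        then show "((\<lambda>j. ?I (h t c j)) \<longlongrightarrow> ?I (hl t c)) F" by (rule LIM_zero_cancel)
      qed
    qed (use 1 in simp)
    have "rect_discrepancy k (V j) W S T = (\<Sum>c=1..k. \<bar>?I (pr (V j) c) - ?I (pr W c)\<bar>)"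
      unfolding rect_discrepancy_def
      by (intro sum.cong refl arg_cong[where f=abs] set_integral_diff(2) si Vint pr_integrable[OF W])
    also have "\<dots> \<le> (\<Sum>c=1..k. \<bar>?I (pr (V j) c) - ?I (h t c j)\<bar> + (LINT z|unit_square. \<bar>h t c j z - hl t c z\<bar>) +
        \<bar>?I (pr W c) - ?I (hl t c)\<bar>)"
    proof (rule sum_mono)
      fix c assume "c \<in> {1..k}"
      from 2[OF this, of j]
      show "\<bar>?I (pr (V j) c) - ?I (pr W c)\<bar> \<le> \<bar>?I (pr (V j) c) - ?I (h t c j)\<bar> +
          (LINT z|unit_square. \<bar>h t c j z - hl t c z\<bar>) + \<bar>?I (pr W c) - ?I (hl t c)\<bar>"
        by linarith
    qed
    also have "\<dots> \<le> gain t j + L t j + \<gamma> t"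
      using 1[of j] 3 by (simp add: sum.distrib L_def)
    finally show "rect_discrepancy k (V j) W S T \<le> gain t j + L t j + \<gamma> t" .
  qed
  \<comment> \<open>First t is fixed to make \<open>\<gamma> t\<close> small, then the gain and
    \<open>L t j\<close> are small eventually along \<open>F\<close>. Events that hold eventually
    along \<open>F\<close> occur at arbitrarily late j, which yields an ordinary
    subsequence.\<close>
  have ex: "\<exists>j>N. cut_dist k (V j) W < e" if e: "e > 0" for e N
  proof -
    have "\<forall>\<^sub>F t in sequentially. \<gamma> t < e / 4" using \<gamma>0 e by (intro order_tendstoD(2)) auto
    then obtain t where t: "\<gamma> t < e / 4" by (meson eventually_sequentially order_refl)
    have "\<forall>\<^sub>F j in F. gain t j < e / 4" using \<gamma>[of t] t by (rule order_tendstoD(2))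
    moreover have "\<forall>\<^sub>F j in F. L t j < e / 4" using L[of t] e by (intro order_tendstoD(2)) auto
    moreover have "\<forall>\<^sub>F j in F. j > N" using Fseq eventually_gt_at_top filter_leD by blast
    ultimately have "\<forall>\<^sub>F j in F. j > N \<and> cut_dist k (V j) W < e"
    proof eventually_elim
      case (elim j)
      then show ?case using cut[of j t] t e by linarith
    qed
    then show ?thesis using eventually_happens'[OF Fbot] by blast
  qed
  have "\<exists>s. \<forall>i. cut_dist k (V (s i)) W < 1 / real (Suc i) \<and> s i < s (Suc i)"
  proof (rule dependent_nat_choice)
    show "\<exists>j. cut_dist k (V j) W < 1 / real (Suc 0)" using ex[of 1 0] by auto
    show "\<exists>j'. cut_dist k (V j') W < 1 / real (Suc (Suc i)) \<and> j < j'" for j i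
      using ex[of "1 / real (Suc (Suc i))" j] by auto
  qed
  then obtain s where s: "\<And>i. cut_dist k (V (s i)) W < 1 / real (Suc i)" "\<And>i. s i < s (Suc i)" by blast
  show thesis
  proof (rule that[OF W])
    show "strict_mono s" using s(2) by (simp add: strict_mono_Suc_iff)
    show "\<pi> j permutes {1..fst (G j)}" for j using \<pi> by (simp add: n_def)
    show "(\<lambda>j. cut_dist k (step_graphon d (relabel (\<pi> (s j)) (G (s j)))) W) \<longlonglongrightarrow> 0"
      unfolding V_def[symmetric]
    proof (rule tendsto_sandwich[OF _ _ tendsto_const])
      show "(\<lambda>i. 1 / real (Suc i)) \<longlonglongrightarrow> 0" using LIMSEQ_inverse_real_of_nat by (simp add: inverse_eq_divide)
    qed (use s(1) cut_dist_nonneg[OF V W] in \<open>auto intro!: always_eventually less_imp_le\<close>)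
  qed
qed

section \<open>Graph limits and the growth of a class\<close>

lemma image_complete_edges_bij:
  assumes "bij_betw \<pi> {1..n} {1..n}" "e \<in> complete_edges n"
  shows "\<pi> ` e \<in> complete_edges n"
proof -
  from assms(2) obtain u v where e: "e = {u, v}" "u < v" "u \<in> {1..n}" "v \<in> {1..n}"
    by (rule complete_edgesE)
  then have "\<pi> u \<noteq> \<pi> v" using bij_betw_imp_inj_on[OF assms(1)] by (auto dest: inj_onD)
  then show ?thesis using e bij_betwE[OF assms(1)] by simp
qed

lemma graph_iso_sym:
  assumes "graph_iso G H"
  shows "graph_iso H G"
proof -
  from assms obtain \<pi> where eq: "fst G = fst H" and \<pi>: "bij_betw \<pi> {1..fst G} {1..fst G}"
    and H: "\<And>e. e \<in> complete_edges (fst G) \<Longrightarrow> snd H (\<pi> ` e) = snd G e"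
    unfolding graph_iso_def by blast
  let ?\<sigma> = "inv_into {1..fst G} \<pi>"
  have \<sigma>: "bij_betw ?\<sigma> {1..fst G} {1..fst G}" by (rule bij_betw_inv_into[OF \<pi>])
  have "snd G (?\<sigma> ` e) = snd H e" if e: "e \<in> complete_edges (fst G)" for e
  proof -
    have "e \<subseteq> {1..fst G}" using e by (auto simp: complete_edges_def nsets_def)
    then have "\<pi> ` ?\<sigma> ` e = e" by (rule image_inv_into_cancel[OF bij_betw_imp_surj_on[OF \<pi>]])
    then show ?thesis using H[OF image_complete_edges_bij[OF \<sigma> e]] by simp
  qed
  with \<sigma> eq show ?thesis unfolding graph_iso_def by auto
qed

lemma graph_iso_trans:
  assumes "graph_iso G H" "graph_iso H K"
  shows "graph_iso G K"
proof -
  from assms obtain \<pi> where \<pi>: "fst G = fst H" "bij_betw \<pi> {1..fst G} {1..fst G}"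
    "\<And>e. e \<in> complete_edges (fst G) \<Longrightarrow> snd H (\<pi> ` e) = snd G e"
    unfolding graph_iso_def by blast
  from assms obtain \<sigma> where \<sigma>: "fst H = fst K" "bij_betw \<sigma> {1..fst H} {1..fst H}"
    "\<And>e. e \<in> complete_edges (fst H) \<Longrightarrow> snd K (\<sigma> ` e) = snd H e"
    unfolding graph_iso_def by blast
  have "bij_betw (\<sigma> \<circ> \<pi>) {1..fst G} {1..fst G}" using \<pi> \<sigma> bij_betw_trans by metis
  moreover have "snd K ((\<sigma> \<circ> \<pi>) ` e) = snd G e" if "e \<in> complete_edges (fst G)" for e
    using \<pi>(3)[OF that] \<sigma>(3)[of "\<pi> ` e"] image_complete_edges_bij[OF \<pi>(2) that] \<pi>(1)
    by (simp add: image_comp)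
  ultimately show ?thesis using \<pi>(1) \<sigma>(1) unfolding graph_iso_def by auto
qed

section \<open>Total boundedness up to relabelling, and clusters of representatives\<close>

lemma finite_coloured_graphs_order_le: "finite {H \<in> coloured_graphs k. fst H \<le> N}"
proof (rule finite_subset)
  show "{H \<in> coloured_graphs k. fst H \<le> N} \<subseteq> (SIGMA n:{..N}. complete_edges n \<rightarrow>\<^sub>E {1..k})"
    by (auto simp: coloured_graphs_def)
  show "finite (SIGMA n:{..N}. complete_edges n \<rightarrow>\<^sub>E {1..k})"
    by (intro finite_SigmaI finite_PiE) auto
qed

text \<open>If it failed, each N would give a graph far from all graphs of order at most N. A
  convergent subsequence of relabelled ones contains two close members, of which the later was meant
  to be far from all graphs of the earlier one's order.\<close>

lemma totally_bounded_graphs: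
  assumes k: "k \<ge> 1" and d: "d \<in> {1..k}" and e: "e > 0"
  obtains N where "\<And>G. G \<in> coloured_graphs k \<Longrightarrow> fst G \<ge> 1 \<Longrightarrow>
    \<exists>H\<in>coloured_graphs k. fst H \<le> N \<and> (\<exists>\<pi>. \<pi> permutes {1..fst G} \<and>
      cut_dist k (step_graphon d (relabel \<pi> G)) (step_graphon d H) < e)"
proof (rule ccontr)
  assume "\<not> thesis"
  with that have "\<forall>N. \<exists>G. G \<in> coloured_graphs k \<and> fst G \<ge> 1 \<and> (\<forall>H\<in>coloured_graphs k. fst H \<le> N \<longrightarrow>
      (\<forall>\<pi>. \<pi> permutes {1..fst G} \<longrightarrow> \<not> cut_dist k (step_graphon d (relabel \<pi> G)) (step_graphon d H) < e))"
    by meson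
  then obtain G where G: "\<And>N. G N \<in> coloured_graphs k" "\<And>N. fst (G N) \<ge> 1" and
    far: "\<And>N H \<pi>. H \<in> coloured_graphs k \<Longrightarrow> fst H \<le> N \<Longrightarrow> \<pi> permutes {1..fst (G N)} \<Longrightarrow>
      \<not> cut_dist k (step_graphon d (relabel \<pi> (G N))) (step_graphon d H) < e"
    by metis
  obtain W s \<pi> where W: "W \<in> graphons k" "strict_mono (s :: nat \<Rightarrow> nat)" "\<And>j. \<pi> j permutes {1..fst (G j)}"
    "(\<lambda>j. cut_dist k (step_graphon d (relabel (\<pi> (s j)) (G (s j)))) W) \<longlonglongrightarrow> 0"
    by (rule graph_sequence_compact[where G=G, OF k d G]) blast
  define X where "X j = relabel (\<pi> (s j)) (G (s j))" for j
  have X: "X j \<in> coloured_graphs k" "step_graphon d (X j) \<in> graphons k" for j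
    using relabel_coloured_graph[OF G(1) W(3)] step_graphon_graphon[OF _ d] by (auto simp: X_def)
  have "\<forall>\<^sub>F j in sequentially. cut_dist k (step_graphon d (X j)) W < e / 2"
    unfolding X_def using W(4) e by (intro order_tendstoD(2)) auto
  then obtain i where i: "\<And>j. j \<ge> i \<Longrightarrow> cut_dist k (step_graphon d (X j)) W < e / 2"
    by (auto simp: eventually_sequentially)
  \<comment> \<open>Large enough for convergence and also for the order of \<open>X i\<close> to be
    at most \<open>s j\<close>, so that \<open>X i\<close> is among the graphs excluded for
    \<open>G (s j)\<close>.\<close>
  define j where "j = max i (fst (X i))"
  have "fst (X i) \<le> s j" using seq_suble[OF W(2), of j] by (simp add: j_def)
  moreover have "cut_dist k (step_graphon d (X j)) (step_graphon d (X i)) < e"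
    using cut_dist_triangle[OF X(2) W(1) X(2), of j i] i[of i] i[of j]
    by (simp add: j_def cut_dist_commute[of k W])
  ultimately show False
    using far[OF X(1), of i "s j" "\<pi> (s j)"] W(3) by (auto simp: X_def)
qed

text \<open>Each isomorphism class is represented by a member aligned with some graph of the finite
  net B, and the pigeonhole principle finds a net graph that serves a fraction 1 / |B| of the
  classes. The constant K depends on e but not on n.\<close>

lemma large_clustered_subfamily:
  assumes k: "k \<ge> 1" and d: "d \<in> {1..k}" and Q: "graph_class k Q" and e: "e > 0"
  obtains K :: nat where "K \<ge> 1" "\<And>n. n \<ge> 1 \<Longrightarrow> \<exists>A \<subseteq> {G \<in> Q. fst G = n}.
    card (unlabelled k Q n) \<le> K * card A \<and>
    (\<forall>G\<in>A. \<forall>H\<in>A. cut_dist k (step_graphon d G) (step_graphon d H) < e)"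
proof -
  have e2: "e / 2 > 0" using e by simp
  obtain N where N: "\<And>G. G \<in> coloured_graphs k \<Longrightarrow> fst G \<ge> 1 \<Longrightarrow>
    \<exists>H\<in>coloured_graphs k. fst H \<le> N \<and> (\<exists>\<pi>. \<pi> permutes {1..fst G} \<and>
      cut_dist k (step_graphon d (relabel \<pi> G)) (step_graphon d H) < e / 2)"
    by (rule totally_bounded_graphs[OF k d e2]) blast
  define B where "B = {H \<in> coloured_graphs k. fst H \<le> N}"
  have finB: "finite B" unfolding B_def by (rule finite_coloured_graphs_order_le)
  have QC: "Q \<subseteq> coloured_graphs k" using Q by (simp add: graph_class_def)
  show thesis
  \<comment> \<open>The added 1 ensures K \<ge> 1 even if the net is empty.\<close>
  proof (rule that[of "card B + 1"])
    fix n :: nat assume n: "n \<ge> 1"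
    let ?U = "unlabelled k Q n"
    have "\<exists>X\<in>C. \<exists>H\<in>B. X \<in> Q \<and> fst X = n \<and> cut_dist k (step_graphon d X) (step_graphon d H) < e / 2"
      if "C \<in> ?U" for C
    proof -
      from that obtain G where G: "G \<in> Q" "fst G = n" "C = graph_iso_rel k `` {G}"
        unfolding unlabelled_def quotient_def by blast
      then have GC: "G \<in> coloured_graphs k" using QC by blast
      obtain H \<pi> where H: "H \<in> B" "\<pi> permutes {1..fst G}"
        "cut_dist k (step_graphon d (relabel \<pi> G)) (step_graphon d H) < e / 2"
        using N[OF GC] G(2) n unfolding B_def by blast
      have "relabel \<pi> G \<in> C"
        using G(3) GC relabel_coloured_graph[OF GC H(2)] graph_iso_relabel[OF GC H(2)]
        by (simp add: graph_iso_rel_def)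
      moreover have "relabel \<pi> G \<in> Q" by (rule relabel_in_class[OF Q G(1) H(2)])
      ultimately show ?thesis using H G(2) by (intro bexI[of _ "relabel \<pi> G"] bexI[of _ H]) auto
    qed
    then obtain X where X: "\<And>C. C \<in> ?U \<Longrightarrow> X C \<in> C \<and> X C \<in> Q \<and> fst (X C) = n \<and>
      (\<exists>H\<in>B. cut_dist k (step_graphon d (X C)) (step_graphon d H) < e / 2)" by metis
    then obtain Y where Y: "\<And>C. C \<in> ?U \<Longrightarrow> Y C \<in> B \<and>
      cut_dist k (step_graphon d (X C)) (step_graphon d (Y C)) < e / 2" by metis
    \<comment> \<open>Distinct classes are disjoint, so the chosen representatives are distinct
      labelled graphs and the unlabelled count is not lost.\<close>
    have disj: "C = D" if CD: "C \<in> ?U" "D \<in> ?U" "Z \<in> C" "Z \<in> D" for C D Z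
    proof -
      from CD(1) obtain G where G: "C = graph_iso_rel k `` {G}" unfolding unlabelled_def quotient_def by blast
      from CD(2) obtain H where H: "D = graph_iso_rel k `` {H}" unfolding unlabelled_def quotient_def by blast
      from G H CD(3,4) have "graph_iso G Z" "graph_iso H Z" "G \<in> coloured_graphs k" "H \<in> coloured_graphs k"
        by (auto simp: graph_iso_rel_def)
      then show ?thesis unfolding G H graph_iso_rel_def
        using graph_iso_sym graph_iso_trans by blast
    qed
    have inj: "inj_on X ?U" using X disj by (metis inj_onI)
    show "\<exists>A \<subseteq> {G \<in> Q. fst G = n}. card ?U \<le> (card B + 1) * card A \<and>
      (\<forall>G\<in>A. \<forall>H\<in>A. cut_dist k (step_graphon d G) (step_graphon d H) < e)"
    proof (cases "?U = {}")
      case True then show ?thesis by (intro exI[of _ "{}"]) simp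
    next
      case False
      then have Bne: "B \<noteq> {}" using Y by blast
      have finU: "finite ?U"
      proof (rule inj_on_finite[OF inj])
        show "X ` ?U \<subseteq> {H \<in> coloured_graphs k. fst H \<le> n}" using X QC by auto
      qed (rule finite_coloured_graphs_order_le)
      have "\<exists>H\<in>B. card (Y -` {H} \<inter> ?U) * card B \<ge> card ?U"
        by (rule pigeonhole_card) (use Y finU finB Bne in auto)
      then obtain H where H: "H \<in> B" "card (Y -` {H} \<inter> ?U) * card B \<ge> card ?U" by blast
      let ?A = "X ` (Y -` {H} \<inter> ?U)"
      have cA: "card ?A = card (Y -` {H} \<inter> ?U)"
        by (rule card_image) (rule inj_on_subset[OF inj], blast)
      have HG: "step_graphon d H \<in> graphons k" using H(1) step_graphon_graphon[OF _ d] by (simp add: B_def)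
      show ?thesis
      proof (intro exI[of _ ?A] conjI ballI)
        show "?A \<subseteq> {G \<in> Q. fst G = n}" using X by auto
        show "card ?U \<le> (card B + 1) * card ?A" using H(2) cA by (simp add: mult.commute)
        fix G1 G2 assume "G1 \<in> ?A" "G2 \<in> ?A"
        then obtain C1 C2 where C: "G1 = X C1" "Y C1 = H" "C1 \<in> ?U" "G2 = X C2" "Y C2 = H" "C2 \<in> ?U" by blast
        have g: "step_graphon d G1 \<in> graphons k" "step_graphon d G2 \<in> graphons k"
          using X C QC step_graphon_graphon[OF _ d] by blast+
        show "cut_dist k (step_graphon d G1) (step_graphon d G2) < e"
          using cut_dist_triangle[OF g(1) HG g(2)] Y[OF C(3)] Y[OF C(6)] C
          by (simp add: cut_dist_commute[of k "step_graphon d H"])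
      qed
    qed
  qed simp
qed

section \<open>Limits of the class: growth rate and maximal entropy\<close>

lemma limit_of_in_graph_limits:
  assumes d: "d \<in> {1..k}" and Q: "graph_class k Q" and W: "W \<in> graphons k"
    and G: "\<And>j. G j \<in> Q" "filterlim (\<lambda>j. fst (G j)) at_top sequentially"
    and lim: "(\<lambda>j. cut_dist k (step_graphon d (G j)) W) \<longlonglongrightarrow> 0"
  shows "limit_of k W \<in> graph_limits k d Q"
proof -
  have g: "step_graphon d (G j) \<in> graphons k" for j
  proof -
    have "G j \<in> coloured_graphs k" using G(1) Q by (auto simp: graph_class_def)
    then show ?thesis by (rule step_graphon_graphon[OF _ d])
  qed
  have "(\<lambda>j. graphon_dist k (step_graphon d (G j)) W) \<longlonglongrightarrow> 0"
  proof (rule tendsto_sandwich[OF _ _ tendsto_const lim])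
    show "\<forall>\<^sub>F j in sequentially. 0 \<le> graphon_dist k (step_graphon d (G j)) W"
      using graphon_dist_nonneg[OF g W] by simp
    show "\<forall>\<^sub>F j in sequentially. graphon_dist k (step_graphon d (G j)) W \<le> cut_dist k (step_graphon d (G j)) W"
      using graphon_dist_le_cut_dist[OF g W id_mpm] by simp
  qed
  then show ?thesis using W G unfolding graph_limits_def by blast
qed

lemma real_choose_two: "real (n choose 2) = real n * (real n - 1) / 2"
proof -
  have "even (n * (n - 1))" by (cases n) auto
  then have "real (n choose 2) = real (n * (n - 1)) / 2"
    unfolding choose_two by (simp add: real_of_nat_div)
  then show ?thesis by (cases n) (auto simp: algebra_simps)
qed

lemma filterlim_strict_mono_fst:
  assumes "strict_mono (s :: nat \<Rightarrow> nat)" "\<And>j. f j \<ge> (j :: nat)"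
  shows "filterlim (\<lambda>j. f (s j)) at_top sequentially"
proof (rule filterlim_at_top_mono[OF filterlim_ident])
  have "j \<le> f (s j)" for j using seq_suble[OF assms(1), of j] assms(2)[of "s j"] by simp
  then show "\<forall>\<^sub>F j in sequentially. j \<le> f (s j)" by simp
qed

lemma choice2: "(\<And>j. \<exists>x y. P j x y) \<Longrightarrow> \<exists>f g. \<forall>j. P j (f j) (g j)"
  by metis

lemma choice3: "(\<And>j. \<exists>x y z. P j x y z) \<Longrightarrow> \<exists>f g h. \<forall>j. P j (f j) (g j) (h j)"
  by metis

text \<open>The slack x - y pays for the factor K lost by clustering at each scale 1 / (j + 1).
  Since the clusters shrink, the limit of any choice of one member from each is a limit of the
  clusters as a whole, so the counting bound near it applies to all their members.\<close>

lemma growth_gives_limit: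
  assumes k: "k \<ge> 2" and d: "d \<in> {1..k}" and Q: "graph_class k Q" and yx: "y < x"
    and freq: "\<And>N. \<exists>n\<ge>N. real k powr (x * real (n choose 2)) < real (card (unlabelled k Q n))"
  obtains W where "limit_of k W \<in> graph_limits k d Q" "W \<in> graphons k" "y \<le> graphon_entropy k W"
proof -
  have k1: "k \<ge> 1" and kr: "real k > 1" using k by auto
  have QC: "Q \<subseteq> coloured_graphs k" using Q by (simp add: graph_class_def)
  have "\<exists>n A. \<forall>j. n j \<ge> j + 2 \<and> A j \<subseteq> {G \<in> Q. fst G = n j} \<and>
    real k powr (y * real (n j choose 2)) < real (card (A j)) \<and>
    (\<forall>G\<in>A j. \<forall>H\<in>A j. cut_dist k (step_graphon d G) (step_graphon d H) < 1 / real (Suc j))"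
  proof (rule choice2)
    fix j :: nat
    have j: "1 / real (Suc j) > 0" by simp
    obtain K :: nat where K: "K \<ge> 1" and A: "\<And>n. n \<ge> 1 \<Longrightarrow> \<exists>A \<subseteq> {G \<in> Q. fst G = n}.
      card (unlabelled k Q n) \<le> K * card A \<and>
      (\<forall>G\<in>A. \<forall>H\<in>A. cut_dist k (step_graphon d G) (step_graphon d H) < 1 / real (Suc j))"
      by (rule large_clustered_subfamily[OF k1 d Q j]) blast
    \<comment> \<open>Beyond this order K is at most k powr ((x - y) times the number of edges); n -
      1 bounds the number of edges from below once n \<ge> 2.\<close>
    obtain n0 :: nat where n0: "log (real k) (real K) / (x - y) \<le> real n0" using real_arch_simple by blast
    obtain n where n: "n \<ge> max (j + 2) (n0 + 1)" "real k powr (x * real (n choose 2)) < real (card (unlabelled k Q n))"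
      using freq by blast
    then have n1: "n \<ge> 2" "real n \<ge> 2" "real n0 \<le> real n - 1" by auto
    obtain A where A: "A \<subseteq> {G \<in> Q. fst G = n}" "card (unlabelled k Q n) \<le> K * card A"
      "\<forall>G\<in>A. \<forall>H\<in>A. cut_dist k (step_graphon d G) (step_graphon d H) < 1 / real (Suc j)"
      using A[of n] n1 by auto
    have "2 * (real n - 1) \<le> real n * (real n - 1)" using n1 by (intro mult_right_mono) auto
    then have "real n - 1 \<le> real (n choose 2)" by (simp add: real_choose_two)
    then have "log (real k) (real K) / (x - y) \<le> real (n choose 2)" using n0 n1 by linarith
    then have "log (real k) (real K) \<le> (x - y) * real (n choose 2)" using yx by (simp add: pos_divide_le_eq mult.commute)
    then have "real K \<le> real k powr ((x - y) * real (n choose 2))"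
      using kr K by (simp add: log_le_iff)
    then have "real K * real k powr (y * real (n choose 2)) \<le>
      real k powr ((x - y) * real (n choose 2)) * real k powr (y * real (n choose 2))"
      by (rule mult_right_mono) simp
    also have "\<dots> = real k powr (x * real (n choose 2))"
      by (simp add: powr_add[symmetric] left_diff_distrib)
    also have "\<dots> < real (K * card A)" using n(2) A(2) by linarith
    finally have "real k powr (y * real (n choose 2)) < real (card A)" using K by simp
    then show "\<exists>n A. n \<ge> j + 2 \<and> A \<subseteq> {G \<in> Q. fst G = n} \<and> real k powr (y * real (n choose 2)) < real (card A) \<and>
      (\<forall>G\<in>A. \<forall>H\<in>A. cut_dist k (step_graphon d G) (step_graphon d H) < 1 / real (Suc j))"
      using A(1,3) n(1) by (intro exI[of _ n] exI[of _ A]) auto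
  qed
  then obtain n A where nA: "\<forall>j. n j \<ge> j + 2 \<and> A j \<subseteq> {G \<in> Q. fst G = n j} \<and>
    real k powr (y * real (n j choose 2)) < real (card (A j)) \<and>
    (\<forall>G\<in>A j. \<forall>H\<in>A j. cut_dist k (step_graphon d G) (step_graphon d H) < 1 / real (Suc j))"
    by (elim exE)
  then have n: "\<And>j. n j \<ge> j + 2" and A: "\<And>j. A j \<subseteq> {G \<in> Q. fst G = n j}"
    and cA: "\<And>j. real k powr (y * real (n j choose 2)) < real (card (A j))"
    and dA: "\<And>j G H. G \<in> A j \<Longrightarrow> H \<in> A j \<Longrightarrow> cut_dist k (step_graphon d G) (step_graphon d H) < 1 / real (Suc j)"
    by blast+
  define G where "G j = (SOME g. g \<in> A j)" for j
  have G: "G j \<in> A j" for j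
  proof -
    have "A j \<noteq> {}" using cA[of j] by auto
    then show ?thesis by (simp add: G_def some_in_eq)
  qed
  have GQ: "G j \<in> Q" "fst (G j) = n j" "G j \<in> coloured_graphs k" for j using G[of j] A[of j] QC by auto
  have G1: "fst (G j) \<ge> 1" for j using n[of j] GQ(2) by simp
  obtain W s \<pi> where W: "W \<in> graphons k" "strict_mono (s :: nat \<Rightarrow> nat)" "\<And>j. \<pi> j permutes {1..fst (G j)}"
    "(\<lambda>j. cut_dist k (step_graphon d (relabel (\<pi> (s j)) (G (s j)))) W) \<longlonglongrightarrow> 0"
    by (rule graph_sequence_compact[where G=G, OF k1 d GQ(3) G1]) blast
  have lim: "limit_of k W \<in> graph_limits k d Q"
  proof (rule limit_of_in_graph_limits[OF d Q W(1) _ _ W(4)])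
    show "relabel (\<pi> (s j)) (G (s j)) \<in> Q" for j by (rule relabel_in_class[OF Q GQ(1) W(3)])
    show "filterlim (\<lambda>j. fst (relabel (\<pi> (s j)) (G (s j)))) at_top sequentially"
    proof -
      have "j \<le> n j" for j using n[of j] by simp
      from filterlim_strict_mono_fst[OF W(2) this] show ?thesis by (simp add: GQ(2))
    qed
  qed
  have "y \<le> graphon_entropy k W"
  proof (rule ccontr)
    assume "\<not> y \<le> graphon_entropy k W"
    \<comment> \<open>Half of the assumed gap: the counting bound then grows at rate y - e, strictly
      below the rate y of the clusters.\<close>
    define e where "e = (y - graphon_entropy k W) / 2"
    have e: "e > 0" "graphon_entropy k W + e = y - e" using \<open>\<not> y \<le> _\<close> by (auto simp: e_def field_simps)
    obtain \<delta> where \<delta>: "\<delta> > 0" "\<And>n A. n \<ge> 1 \<Longrightarrow> A \<subseteq> {G \<in> coloured_graphs k. fst G = n} \<Longrightarrow>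
      (\<And>G. G \<in> A \<Longrightarrow> cut_dist k (step_graphon d G) W < \<delta>) \<Longrightarrow>
      real (card A) \<le> real k powr ((graphon_entropy k W + e) * (real n)\<^sup>2 / 2)"
      by (rule card_graphs_near_graphon[OF k d W(1) e(1)]) blast
    have "\<forall>\<^sub>F i in sequentially. cut_dist k (step_graphon d (relabel (\<pi> (s i)) (G (s i)))) W < \<delta> / 2"
      using W(4) \<delta>(1) by (intro order_tendstoD(2)) auto
    moreover have "\<forall>\<^sub>F i in sequentially. 1 / real (Suc i) < \<delta> / 2"
    proof (rule order_tendstoD(2))
      show "(\<lambda>i. 1 / real (Suc i)) \<longlonglongrightarrow> 0" using LIMSEQ_inverse_real_of_nat by (simp add: inverse_eq_divide)
    qed (use \<delta>(1) in simp)
    \<comment> \<open>This compares n^2 with n (n - 1): the two counts contradict each other as soon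
      as n is at least y / e.\<close>
    moreover have "\<forall>\<^sub>F i in sequentially. y / e \<le> real i"
      using filterlim_real_sequentially by (simp add: filterlim_at_top)
    ultimately have "\<forall>\<^sub>F i in sequentially. False"
    proof eventually_elim
      case (elim i)
      let ?j = "s i" and ?p = "\<pi> (s i)"
      have ij: "i \<le> ?j" by (rule seq_suble[OF W(2)])
      have p: "?p permutes {1..n ?j}" using W(3)[of ?j] GQ(2) by simp
      have Aj: "H \<in> coloured_graphs k" "fst H = n ?j" "?p permutes {1..fst H}" if "H \<in> A ?j" for H
        using that A[of ?j] QC p by auto
      \<comment> \<open>The permutation found for the single graph \<open>G ?j\<close> is applied to
        the whole cluster; being invertible, it preserves the number of graphs.\<close>
      have "inj_on (relabel ?p) (A ?j)"
        by (rule inj_on_inverseI[where g="relabel (inv ?p)"]) (rule relabel_relabel_inv[OF Aj(1,3)])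
      then have "real (card (A ?j)) = real (card (relabel ?p ` A ?j))" by (simp add: card_image)
      also have "\<dots> \<le> real k powr ((graphon_entropy k W + e) * (real (n ?j))\<^sup>2 / 2)"
      proof (rule \<delta>(2))
        show "n ?j \<ge> 1" using n[of ?j] by simp
        show "relabel ?p ` A ?j \<subseteq> {G \<in> coloured_graphs k. fst G = n ?j}"
          using Aj relabel_coloured_graph by auto
        fix H' assume "H' \<in> relabel ?p ` A ?j"
        then obtain H where H: "H \<in> A ?j" "H' = relabel ?p H" by blast
        have g: "step_graphon d H' \<in> graphons k" "step_graphon d (relabel ?p (G ?j)) \<in> graphons k"
          using H relabel_coloured_graph[OF Aj(1,3)] relabel_coloured_graph[OF GQ(3) W(3)]
            step_graphon_graphon[OF _ d] by auto
        have "cut_dist k (step_graphon d H') (step_graphon d (relabel ?p (G ?j))) \<le>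
            cut_dist k (step_graphon d H) (step_graphon d (G ?j))"
          unfolding H(2)
          by (rule cut_dist_relabel_le[OF Aj(1)[OF H(1)] d Aj(3)[OF H(1)]])
             (use Aj(2)[OF H(1)] GQ n[of ?j] in auto)
        also have "\<dots> < 1 / real (Suc ?j)" by (rule dA[OF H(1) G])
        also have "\<dots> \<le> 1 / real (Suc i)" using ij by (intro divide_left_mono) auto
        finally show "cut_dist k (step_graphon d H') W < \<delta>"
          using cut_dist_triangle[OF g W(1)] elim by linarith
      qed
      finally have "real k powr (y * real (n ?j choose 2)) < real k powr ((y - e) * (real (n ?j))\<^sup>2 / 2)"
        using cA[of ?j] e(2) by simp
      then have "y * real (n ?j choose 2) < (y - e) * (real (n ?j))\<^sup>2 / 2" using kr by simp
      then have "y * (real (n ?j) * (real (n ?j) - 1)) < (y - e) * (real (n ?j) * real (n ?j))"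
        unfolding real_choose_two power2_eq_square by simp
      then have "real (n ?j) * (y * (real (n ?j) - 1)) < real (n ?j) * ((y - e) * real (n ?j))"
        by (simp only: mult_ac)
      then have "y * (real (n ?j) - 1) < (y - e) * real (n ?j)" using n[of ?j] by simp
      then have "real (n ?j) < y / e" using e(1) by (simp add: pos_less_divide_eq algebra_simps)
      moreover have "real i \<le> real (n ?j)" using ij n[of ?j] by simp
      ultimately show False using elim by linarith
    qed
    then show False by simp
  qed
  with lim W(1) show thesis using that by blast
qed

text \<open>Compactness is available for graphs only, so each nearly maximal limit is replaced by a
  graph of the class close to it. A limit \<open>W\<close> of these graphs is compared with
  pullbacks of the nearly maximal limits, which have the same entropies, and semicontinuity at
  \<open>W\<close> gives the supremum.\<close>

lemma entropy_maximum_attained: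
  assumes k: "k \<ge> 2" and d: "d \<in> {1..k}" and Q: "graph_class k Q" and ne: "graph_limits k d Q \<noteq> {}"
  shows "\<exists>\<Gamma>\<in>graph_limits k d Q. \<forall>\<Gamma>'\<in>graph_limits k d Q. limit_entropy k \<Gamma>' \<le> limit_entropy k \<Gamma>"
proof -
  have k1: "k \<ge> 1" using k by simp
  have QC: "Q \<subseteq> coloured_graphs k" using Q by (simp add: graph_class_def)
  define S where "S = Sup (limit_entropy k ` graph_limits k d Q)"
  have bdd: "bdd_above (limit_entropy k ` graph_limits k d Q)"
  proof (rule bdd_aboveI)
    fix r assume "r \<in> limit_entropy k ` graph_limits k d Q"
    then obtain W where "W \<in> graphons k" "r = limit_entropy k (limit_of k W)"
      unfolding graph_limits_def by blast
    then show "r \<le> 1" using limit_entropy_eq[OF k] entropy_le_1[OF k] by simp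
  qed
  have "\<exists>U G \<phi>. \<forall>i. U i \<in> graphons k \<and> S - 1 / real (Suc i) < graphon_entropy k (U i) \<and>
    G i \<in> Q \<and> fst (G i) \<ge> Suc i \<and> \<phi> i \<in> measure_preserving_maps \<and>
    cut_dist k (step_graphon d (G i)) (pullback (U i) (\<phi> i)) < 1 / real (Suc i)"
  proof (rule choice3)
    fix i :: nat
    have "S - 1 / real (Suc i) < S" by simp
    then obtain r where "r \<in> limit_entropy k ` graph_limits k d Q" "S - 1 / real (Suc i) < r"
      unfolding S_def using ne by (metis image_is_empty less_cSupD)
    then obtain W G where W: "W \<in> graphons k" "S - 1 / real (Suc i) < limit_entropy k (limit_of k W)"
      and G: "\<And>j. G j \<in> Q" "filterlim (\<lambda>j. fst (G j)) at_top sequentially"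
        "(\<lambda>j. graphon_dist k (step_graphon d (G j)) W) \<longlonglongrightarrow> 0"
      unfolding graph_limits_def by blast
    \<comment> \<open>Orders are forced to grow with i so that \<open>W\<close> is again a limit of
      the class in the sense of \<open>graph_limits\<close>.\<close>
    have big: "\<forall>\<^sub>F j in sequentially. fst (G j) \<ge> Suc i" using G(2) by (simp add: filterlim_at_top)
    have near: "\<forall>\<^sub>F j in sequentially. graphon_dist k (step_graphon d (G j)) W < 1 / real (Suc i)"
      using G(3) by (rule order_tendstoD(2)) simp
    obtain j where j: "fst (G j) \<ge> Suc i" "graphon_dist k (step_graphon d (G j)) W < 1 / real (Suc i)"
      using eventually_happens'[OF sequentially_bot eventually_conj[OF big near]] by blast
    obtain \<phi> where "\<phi> \<in> measure_preserving_maps" "cut_dist k (step_graphon d (G j)) (pullback W \<phi>) < 1 / real (Suc i)"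
      by (rule graphon_dist_lessD[OF j(2)])
    with W j(1) G(1) show "\<exists>W G \<phi>. W \<in> graphons k \<and> S - 1 / real (Suc i) < graphon_entropy k W \<and>
      G \<in> Q \<and> fst G \<ge> Suc i \<and> \<phi> \<in> measure_preserving_maps \<and>
      cut_dist k (step_graphon d G) (pullback W \<phi>) < 1 / real (Suc i)"
      unfolding limit_entropy_eq[OF k W(1)] by (intro exI[of _ W] exI[of _ "G j"] exI[of _ \<phi>]) simp
  qed
  then obtain U G \<phi> where UG: "\<forall>i. U i \<in> graphons k \<and> S - 1 / real (Suc i) < graphon_entropy k (U i) \<and>
    G i \<in> Q \<and> fst (G i) \<ge> Suc i \<and> \<phi> i \<in> measure_preserving_maps \<and>
    cut_dist k (step_graphon d (G i)) (pullback (U i) (\<phi> i)) < 1 / real (Suc i)"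
    by (elim exE)
  then have U: "\<And>i. U i \<in> graphons k" "\<And>i. S - 1 / real (Suc i) < graphon_entropy k (U i)"
    and G: "\<And>i. G i \<in> Q" "\<And>i. fst (G i) \<ge> Suc i" and \<phi>: "\<And>i. \<phi> i \<in> measure_preserving_maps"
    and close: "\<And>i. cut_dist k (step_graphon d (G i)) (pullback (U i) (\<phi> i)) < 1 / real (Suc i)"
    by blast+
  have GC: "G i \<in> coloured_graphs k" and G1: "fst (G i) \<ge> 1" for i using G[of i] QC by auto
  obtain W s \<pi> where W: "W \<in> graphons k" "strict_mono (s :: nat \<Rightarrow> nat)" "\<And>j. \<pi> j permutes {1..fst (G j)}"
    "(\<lambda>j. cut_dist k (step_graphon d (relabel (\<pi> (s j)) (G (s j)))) W) \<longlonglongrightarrow> 0"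
    by (rule graph_sequence_compact[where G=G, OF k1 d GC G1]) blast
  have lim: "limit_of k W \<in> graph_limits k d Q"
  proof (rule limit_of_in_graph_limits[OF d Q W(1) _ _ W(4)])
    show "relabel (\<pi> (s j)) (G (s j)) \<in> Q" for j by (rule relabel_in_class[OF Q G(1) W(3)])
    show "filterlim (\<lambda>j. fst (relabel (\<pi> (s j)) (G (s j)))) at_top sequentially"
      using filterlim_strict_mono_fst[OF W(2), of "\<lambda>j. fst (G j)"] G(2) by (simp add: Suc_leD)
  qed
  have inv0: "(\<lambda>i. 1 / real (Suc i)) \<longlonglongrightarrow> 0" using LIMSEQ_inverse_real_of_nat by (simp add: inverse_eq_divide)
  have "S \<le> graphon_entropy k W"
  proof (rule field_le_epsilon)
    fix e :: real assume "e > 0"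
    then have e2: "e / 2 > 0" by simp
    obtain \<delta> where \<delta>: "\<delta> > 0" "\<And>V \<psi>. V \<in> graphons k \<Longrightarrow> \<psi> \<in> measure_preserving_maps \<Longrightarrow>
      cut_dist k V (pullback W \<psi>) < \<delta> \<Longrightarrow> graphon_entropy k V \<le> graphon_entropy k W + e / 2"
      by (rule entropy_upper_semicontinuous[OF k W(1) e2]) blast
    have "\<forall>\<^sub>F i in sequentially. cut_dist k (step_graphon d (relabel (\<pi> (s i)) (G (s i)))) W < \<delta> / 2"
      using W(4) \<delta>(1) by (intro order_tendstoD(2)) auto
    moreover have "\<forall>\<^sub>F i in sequentially. 1 / real (Suc i) < \<delta> / 2"
      by (rule order_tendstoD(2)[OF inv0]) (use \<delta>(1) in simp)
    moreover have "\<forall>\<^sub>F i in sequentially. 1 / real (Suc i) < e / 2"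
      by (rule order_tendstoD(2)[OF inv0 e2])
    ultimately have "\<forall>\<^sub>F i in sequentially. S \<le> graphon_entropy k W + e"
    proof eventually_elim
      case (elim i)
      let ?j = "s i" and ?p = "\<pi> (s i)"
      have "i \<le> ?j" by (rule seq_suble[OF W(2)])
      then have ij: "1 / real (Suc ?j) \<le> 1 / real (Suc i)" by (intro divide_left_mono) auto
      \<comment> \<open>The relabelling that brings the graph near \<open>W\<close> has to be
        applied to the nearby limit too; this is a second pullback, after \<phi>.\<close>
      define \<beta> where "\<beta> = block_perm (fst (G ?j)) ?p"
      have \<beta>: "\<beta> \<in> measure_preserving_maps" unfolding \<beta>_def by (rule block_perm_mpm[OF W(3) G1])
      let ?U = "pullback (U ?j) (\<phi> ?j)"
      have UG: "?U \<in> graphons k" "pullback ?U \<beta> \<in> graphons k"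
        using pullback_graphon U(1) \<phi> \<beta> by auto
      have XG: "step_graphon d (relabel ?p (G ?j)) \<in> graphons k"
        by (rule step_graphon_graphon[OF relabel_coloured_graph[OF GC W(3)] d])
      have "cut_dist k (step_graphon d (relabel ?p (G ?j))) (pullback ?U \<beta>) \<le> cut_dist k (step_graphon d (G ?j)) ?U"
        unfolding \<beta>_def by (rule cut_dist_relabel_pullback_le[OF GC d W(3) G1 UG(1)])
      also have "\<dots> < 1 / real (Suc ?j)" by (rule close)
      finally have "cut_dist k (pullback ?U \<beta>) (pullback W (\<lambda>x. x)) < \<delta>"
        using cut_dist_triangle[OF UG(2) XG W(1)] elim ij
        by (simp add: cut_dist_commute[of k "pullback ?U \<beta>"])
      from \<delta>(2)[OF UG(2) id_mpm this]
      have "graphon_entropy k (U ?j) \<le> graphon_entropy k W + e / 2"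
        using entropy_pullback[OF UG(1) \<beta>] entropy_pullback[OF U(1) \<phi>, of ?j] by simp
      then show ?case using U(2)[of ?j] ij elim by linarith
    qed
    then show "S \<le> graphon_entropy k W + e" by simp
  qed
  then have "\<forall>\<Gamma>'\<in>graph_limits k d Q. limit_entropy k \<Gamma>' \<le> limit_entropy k (limit_of k W)"
    using cSup_upper[OF _ bdd] unfolding S_def limit_entropy_eq[OF k W(1)] by fastforce
  with lim show ?thesis by blast
qed

text \<open>The maximum is expressed as a supremum in \<open>ereal\<close> that is attained whenever
  there is a limit. For a class without limits the supremum is - \<infinity>, in keeping with the
  convention for the logarithm of 0.\<close>

theorem theorem7p1:
  fixes k d :: nat and Q :: "cgraph set"
  assumes "k \<ge> 2" and "d \<in> {1..k}" and "graph_class k Q"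
  shows "limsup (\<lambda>n. log_card k (unlabelled k Q n) / ereal (real (n choose 2)))
           \<le> (SUP \<Gamma>\<in>graph_limits k d Q. ereal (limit_entropy k \<Gamma>))
         \<and> (graph_limits k d Q \<noteq> {} \<longrightarrow>
              (\<exists>\<Gamma>\<in>graph_limits k d Q. \<forall>\<Gamma>'\<in>graph_limits k d Q.
                 limit_entropy k \<Gamma>' \<le> limit_entropy k \<Gamma>))"
proof (intro conjI impI)
  let ?f = "\<lambda>n. log_card k (unlabelled k Q n) / ereal (real (n choose 2))"
  let ?S = "SUP \<Gamma>\<in>graph_limits k d Q. ereal (limit_entropy k \<Gamma>)"
  show "limsup ?f \<le> ?S"
  proof (rule ccontr)
    assume "\<not> limsup ?f \<le> ?S"
    then have "?S < limsup ?f" by simp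
    \<comment> \<open>Two real numbers are inserted: the class exceeds rate x infinitely often, and
      the loss from x to y makes room for clustering. Both are finite even if the supremum is -
      \<infinity>.\<close>
    then obtain y where y: "?S < ereal y" "ereal y < limsup ?f" using ereal_dense2 by blast
    obtain x where x: "ereal y < ereal x" "ereal x < limsup ?f" using ereal_dense2[OF y(2)] by blast
    have "\<exists>n\<ge>N. real k powr (x * real (n choose 2)) < real (card (unlabelled k Q n))" for N
    proof -
      have "\<not> (\<forall>\<^sub>F n in sequentially. ?f n \<le> ereal x)"
        using Limsup_bounded[of ?f "ereal x" sequentially] x(2) by (auto simp: not_le)
      \<comment> \<open>With n \<ge> 2 there is at least one edge, so the quotient is a genuine one;
        exceeding x then rules out an empty set of classes.\<close>
      then obtain n where n: "n \<ge> max N 2" "ereal x < ?f n"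
        unfolding eventually_sequentially by (metis not_le)
      let ?c = "card (unlabelled k Q n)" and ?b = "real (n choose 2)"
      have b: "?b > 0" using n(1) by (simp add: zero_less_binomial_iff)
      have c: "?c \<noteq> 0"
      proof
        assume "?c = 0"
        then show False using n(2) b by (simp add: log_card_def)
      qed
      then have "x < log (real k) (real ?c) / ?b" using n(2) b by (simp add: log_card_def)
      then have "x * ?b < log (real k) (real ?c)" using b by (simp add: pos_less_divide_eq)
      then have "real k powr (x * ?b) < real ?c" using c assms(1) by (simp add: less_log_iff)
      then show ?thesis using n(1) by auto
    qed
    then obtain W where W: "limit_of k W \<in> graph_limits k d Q" "W \<in> graphons k" "y \<le> graphon_entropy k W"
      using growth_gives_limit[OF assms, of y x] x(1) by auto
    have "ereal y \<le> ereal (limit_entropy k (limit_of k W))"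
      using W(3) limit_entropy_eq[OF assms(1) W(2)] by simp
    also have "\<dots> \<le> ?S" using W(1) by (rule SUP_upper)
    finally show False using y(1) by simp
  qed
qed (rule entropy_maximum_attained[OF assms])

end
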